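(* Let $q=p^f$, where $p$ is prime and $f\ge 1$. Let $e$ be a nonnegative integer, and let $C$ be an antiGriesmer code with parameters $[a_q(k,\delta),k,\delta]_q$, i.e. a full-length $k$-dimensional linear code over $\mathbb{F}_q$ of length $a_q(k,\delta)$ and maximum Hamming weight $\delta$. 1. If $q^e\mid\delta$, then $C$ is $p^e$-divisible. 2. If $p^e\mid\delta$, then $C$ is $\left\lceil p^{e-(f-1)(q-2)}\right\rceil$-divisible.
   Context: For $k\ge1$ and an integer $x\ge0$, $a_q(k,x)=x+\sum_{i=1}^{k-1}\left\lfloor x/q^i\right\rfloor$. A linear code has full length if no coordinate is identically zero on it. An antiGriesmer code is a full-length $k$-dimensional linear code in $\mathbb{F}_q^n$ with maximum Hamming weight $\delta$ such that $n=a_q(k,\delta)$. For a positive integer $\Delta$, a code $C$ is $\Delta$-divisible if $\Delta$ divides the Hamming weight $\mathrm{wt}(c)$ of every $c\in C$. *)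

theory Defs
  imports "HOL-Analysis.Analysis" "HOL-Computational_Algebra.Primes"
begin

text \<open>
  Codes over the field with \<open>q\<close> elements are sets of vectors of type \<open>'a ^ 'n\<close>, where
  \<open>'a\<close> is a finite field with \<open>CARD('a) = q\<close> and the length is \<open>n = CARD('n)\<close>. Index types
  are nonempty, which excludes only length 0; no code of dimension at least 1 has length 0.
\<close>

definition hamming_weight :: "'a::zero ^ 'n::finite \<Rightarrow> nat" where
  "hamming_weight c = card {i. c $ i \<noteq> 0}"

definition full_length :: "('a::zero ^ 'n::finite) set \<Rightarrow> bool" where
  "full_length C \<longleftrightarrow> (\<forall>i. \<exists>c\<in>C. c $ i \<noteq> 0)"

definition divisible_code :: "nat \<Rightarrow> ('a::zero ^ 'n::finite) set \<Rightarrow> bool" where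
  "divisible_code \<Delta> C \<longleftrightarrow> \<Delta> > 0 \<and> (\<forall>c\<in>C. \<Delta> dvd hamming_weight c)"

definition anti_griesmer_length :: "nat \<Rightarrow> nat \<Rightarrow> nat \<Rightarrow> nat" where
  "anti_griesmer_length q k x = x + (\<Sum>i=1..k - 1. x div q ^ i)"

definition anti_griesmer_code :: "nat \<Rightarrow> nat \<Rightarrow> ('a::{field,finite} ^ 'n::finite) set \<Rightarrow> bool" where
  "anti_griesmer_code k \<delta> C \<longleftrightarrow>
     k \<ge> 1 \<and> vec.subspace C \<and> vec.dim C = k \<and> full_length C \<and>
     Max (hamming_weight ` C) = \<delta> \<and>
     CARD('n) = anti_griesmer_length CARD('a) k \<delta>"

end

theory Submission
  imports Defs "HOL-Library.Multiset" "HOL-Number_Theory.Cong"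
begin

text \<open>
  Write \<open>w\<close> for the weight. If \<open>x\<close> has maximum weight \<open>\<delta>\<close>, the residual code at \<open>x\<close> is again
  antiGriesmer, with maximum weight \<open>\<lfloor>\<delta>/q\<rfloor>\<close>, and the sum of \<open>w\<close> over a line \<open>y + \<langle>x\<rangle>\<close> is
  \<open>(q - 1) \<delta>\<close> plus \<open>q\<close> times the residual weight of \<open>y\<close>. By induction these line sums are
  divisible by a high power \<open>p ^ J\<close> for all directions \<open>x\<close> of maximum weight. Raising \<open>j < J\<close>
  step by step, it suffices that \<open>g = w / p ^ j\<close> modulo \<open>p\<close> has vanishing line sums in all
  directions, given this for the directions of maximum weight; the line through \<open>0\<close> then
  gives \<open>g = 0\<close>.

  For this, expand line sums into the operators \<open>X\<^sub>z\<^sup>u = \<Sum>\<^sub>s s\<^sup>q\<^sup>-\<^sup>1\<^sup>-\<^sup>u T\<^sub>s\<^sub>z\<close>, where \<open>T\<close> denotes translation;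
  they behave like divided powers, except that their weights \<open>u\<close> only matter modulo \<open>q - 1\<close>.
  If \<open>q\<^sup>2\<close> divides \<open>\<delta>\<close>, every subspace of dimension at most 2 consisting of words of maximum
  weight can be extended in spanning many directions, so vectors in a product of operators
  can be made arbitrary one at a time. The errors of this process are products in which an operator of
  weight \<open>p ^ i\<close> has been split. Measuring a product by the sums of all \<open>f\<close> rotations of the
  base-\<open>p\<close> digits of its weights, the errors are larger in a well-founded order, and
  long products vanish. If only \<open>q\<close> divides \<open>\<delta>\<close>, then \<open>w\<close> modulo \<open>p\<close> is a sum of
  \<open>(q - 1)\<close>-st powers of linear forms, which all errors annihilate. Altogether
  \<open>q ^ (E + 1)\<close> dividing \<open>\<delta>\<close> makes all weights divisible by \<open>p ^ (f E + 1)\<close>, which implies both claims.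
\<close>

section \<open>Power sums and automorphisms of finite fields\<close>

lemma card_UNIV_field_gt1: "CARD('a::{field,finite}) > 1"
proof -
  have "card {0, 1 :: 'a} \<le> CARD('a)"
    by (rule card_mono) auto
  then show ?thesis
    by simp
qed

lemma power_card_minus_1:
  fixes x :: "'a::{field,finite}"
  assumes "x \<noteq> 0"
  shows "x ^ (CARD('a) - 1) = 1"
proof -
  have "(\<Prod>y\<in>UNIV-{0}. x * y) = (\<Prod>y\<in>UNIV-{0}. y)"
    by (rule prod.reindex_bij_witness[of _ "\<lambda>y. y / x" "\<lambda>y. x * y"]) (use assms in auto)
  then have "x ^ (CARD('a) - 1) * (\<Prod>y\<in>UNIV-{0::'a}. y) = 1 * (\<Prod>y\<in>UNIV-{0::'a}. y)"
    by (simp add: prod.distrib card_Diff_singleton)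
  moreover have "(\<Prod>y\<in>UNIV-{0::'a}. y) \<noteq> 0"
    by simp
  ultimately show ?thesis
    by (metis mult_right_cancel)
qed

lemma power_card_eq_self: "(x :: 'a::{field,finite}) ^ CARD('a) = x"
proof (cases "x = 0")
  case False
  then have "x ^ CARD('a) = x * x ^ (CARD('a) - 1)"
    by (metis card_UNIV_field_gt1 power_minus_mult mult.commute zero_less_one less_trans)
  then show ?thesis
    using power_card_minus_1[OF False] by simp
qed (use card_UNIV_field_gt1[where 'a='a] in auto)

text \<open>Nonzero elements have order dividing q - 1. The condition on zero exponents covers
  \<open>x = 0\<close>, where \<open>0 ^ 0 = 1\<close>.\<close>

lemma power_eq_power_if_cong:
  fixes x :: "'a::{field,finite}"
  assumes "m mod (CARD('a) - 1) = n mod (CARD('a) - 1)" and "m = 0 \<longleftrightarrow> n = 0"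
  shows "x ^ m = x ^ n"
proof (cases "x = 0")
  case True
  then show ?thesis using assms(2) by (simp add: power_0_left)
next
  case False
  have "x ^ k = x ^ (k mod (CARD('a) - 1))" for k
  proof -
    have "x ^ k = x ^ ((CARD('a) - 1) * (k div (CARD('a) - 1)) + k mod (CARD('a) - 1))"
      by simp
    also have "\<dots> = x ^ (k mod (CARD('a) - 1))"
      by (simp only: power_add power_mult power_card_minus_1[OF False]) simp
    finally show ?thesis .
  qed
  then show ?thesis using assms(1) by metis
qed

lemma of_nat_CARD_field: "of_nat CARD('a) = (0 :: 'a::{field,finite})"
proof -
  have "(\<Sum>x\<in>UNIV. x + 1) = (\<Sum>x\<in>UNIV. x :: 'a)"
    by (rule sum.reindex_bij_witness[of _ "\<lambda>y. y - 1" "\<lambda>y. y + 1"]) auto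
  then show ?thesis
    by (simp add: sum.distrib)
qed

lemma CHAR_finite_field:
  assumes "prime p" and "CARD('a::{field,finite}) = p ^ f"
  shows "CHAR('a) = p"
proof -
  have "CHAR('a) dvd p ^ f"
    using of_nat_CARD_field[where 'a='a] assms(2) by (metis of_nat_eq_0_iff_char_dvd)
  moreover have "prime CHAR('a)"
    by (intro prime_CHAR_semidom finite_imp_CHAR_pos) simp
  ultimately show ?thesis
    using assms(1) by (metis prime_dvd_power primes_dvd_imp_eq)
qed

text \<open>Replacing s by x s scales the sum by \<open>x ^ m\<close>, so it vanishes once some
  nonzero x has \<open>x ^ m \<noteq> 1\<close>. Exponent 0 is exceptional: all q elements
  contribute 1, giving q = 0 instead of - 1.\<close>

lemma sum_power_UNIV:
  fixes m :: nat
  shows "(\<Sum>s\<in>(UNIV::'a::{field,finite} set). s ^ m) = (if m > 0 \<and> (CARD('a) - 1) dvd m then - 1 else 0)"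
proof -
  consider "m = 0" | "m > 0" "(CARD('a) - 1) dvd m" | "\<not> (CARD('a) - 1) dvd m"
    by auto
  then show ?thesis
  proof cases
    case 1
    then show ?thesis using of_nat_CARD_field[where 'a='a] by simp
  next
    case 2
    have "(\<Sum>s\<in>(UNIV::'a set). s ^ m) = (\<Sum>s\<in>UNIV - {0::'a}. s ^ m)"
      using 2 by (intro sum.mono_neutral_right) auto
    also have "\<dots> = (\<Sum>s\<in>UNIV - {0::'a}. 1)"
    proof (rule sum.cong)
      fix s :: 'a assume "s \<in> UNIV - {0}"
      then show "s ^ m = 1"
        using 2(2) power_card_minus_1[of s] by (auto simp: power_mult dvd_def)
    qed auto
    also have "\<dots> = of_nat (CARD('a) - 1)"
      by (simp add: card_Diff_singleton)
    also have "\<dots> = - 1"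
      using of_nat_CARD_field[where 'a='a] card_UNIV_field_gt1[where 'a='a] by (simp add: of_nat_diff)
    finally show ?thesis using 2 by simp
  next
    case 3
    define r where "r = m mod (CARD('a) - 1)"
    have r: "0 < r" "r < CARD('a) - 1"
      using 3 card_UNIV_field_gt1[where 'a='a] by (auto simp: r_def mod_greater_zero_iff_not_dvd)
    \<comment> \<open>A nonzero polynomial of degree r < q - 1 cannot vanish at all q - 1 nonzero
      elements.\<close>
    have "\<exists>x::'a. x \<noteq> 0 \<and> x ^ r \<noteq> 1"
    proof (rule ccontr)
      assume *: "\<not> ?thesis"
      define P :: "'a poly" where "P = monom 1 r - 1"
      have "degree P = r"
        unfolding P_def using r
        by (metis degree_1 degree_diff_less degree_monom_eq degree_add_eq_left diff_conv_add_uminus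
            degree_minus zero_neq_one)
      then have "card {x. poly P x = 0} \<le> r"
        using card_poly_roots_bound[of P] r by fastforce
      moreover have "UNIV - {0} \<subseteq> {x. poly P x = 0}"
        using * by (auto simp: P_def poly_monom)
      then have "card (UNIV - {0::'a}) \<le> card {x. poly P x = 0}"
        by (intro card_mono) auto
      ultimately show False
        using r by (simp add: card_Diff_singleton)
    qed
    then obtain x :: 'a where x: "x \<noteq> 0" "x ^ r \<noteq> 1" by blast
    have "m \<noteq> 0" using 3 by (metis dvd_0_right)
    then have xm: "x ^ m \<noteq> 1"
      using x(2) power_eq_power_if_cong[of m r x] r(1) by (simp add: r_def)
    have "(\<Sum>s\<in>(UNIV::'a set). s ^ m) = (\<Sum>s\<in>(UNIV::'a set). (x * s) ^ m)"
      by (rule sum.reindex_bij_witness[of _ "\<lambda>y. x * y" "\<lambda>y. y / x"]) (use x in auto)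
    also have "\<dots> = x ^ m * (\<Sum>s\<in>(UNIV::'a set). s ^ m)"
      by (simp add: power_mult_distrib sum_distrib_left)
    finally have "(x ^ m - 1) * (\<Sum>s\<in>(UNIV::'a set). s ^ m) = 0"
      by (simp add: algebra_simps)
    then show ?thesis using xm 3 by simp
  qed
qed

text \<open>Powers of Frobenius are carried along as twists, because rotating the base-p digits of
  weights changes the twist.\<close>

definition field_aut :: "('a::field \<Rightarrow> 'a) \<Rightarrow> bool" where
  "field_aut \<sigma> \<longleftrightarrow> bij \<sigma> \<and> (\<forall>x y. \<sigma> (x + y) = \<sigma> x + \<sigma> y) \<and> (\<forall>x y. \<sigma> (x * y) = \<sigma> x * \<sigma> y)"

lemma field_aut_0: "field_aut \<sigma> \<Longrightarrow> \<sigma> 0 = 0"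
  by (metis add_cancel_right_right field_aut_def)

lemma field_aut_eq_0_iff: "field_aut \<sigma> \<Longrightarrow> \<sigma> x = 0 \<longleftrightarrow> x = 0"
  by (metis field_aut_0 field_aut_def bij_pointE)

lemma field_aut_frobenius:
  assumes "prime p" and "CARD('a::{field,finite}) = p ^ f"
  shows "field_aut (\<lambda>s::'a. s ^ (p ^ t))"
proof -
  have [simp]: "CHAR('a) = p"
    using CHAR_finite_field assms by blast
  have add: "(x + y) ^ (p ^ t) = x ^ (p ^ t) + y ^ (p ^ t)" for x y :: 'a
    by (rule freshmans_dream') (use assms in auto)
  have "inj (\<lambda>s::'a. s ^ (p ^ t))"
  proof (rule injI)
    fix x y :: 'a assume *: "x ^ p ^ t = y ^ p ^ t"
    have "x ^ p ^ t = (x - y) ^ p ^ t + y ^ p ^ t"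
      using add[of "x - y" y] by simp
    then show "x = y" using * by simp
  qed
  then have "bij (\<lambda>s::'a. s ^ (p ^ t))"
    using finite_UNIV_inj_surj[of "\<lambda>s::'a. s ^ (p ^ t)"] by (simp add: bij_def)
  then show ?thesis
    by (auto simp: field_aut_def add power_mult_distrib)
qed

lemma sum_field_aut_power:
  assumes "field_aut (\<sigma> :: 'a::{field,finite} \<Rightarrow> 'a)"
  shows "(\<Sum>s\<in>UNIV. \<sigma> s ^ m) = (if m > 0 \<and> (CARD('a) - 1) dvd m then - 1 else 0)"
proof -
  have "bij \<sigma>" using assms by (simp add: field_aut_def)
  then have "(\<Sum>s\<in>UNIV. \<sigma> s ^ m) = (\<Sum>s\<in>(UNIV::'a set). s ^ m)"
    using sum.reindex_bij_betw[of \<sigma> UNIV UNIV "\<lambda>s. s ^ m"] by simp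
  then show ?thesis by (simp add: sum_power_UNIV)
qed

section \<open>Weighted translation operators\<close>

text \<open>For u in 1, ..., q - 1 this is minus the coefficient of \<open>\<sigma> s ^ u\<close>
  when \<open>G (y + s *s z) - G y\<close> is expanded in these powers. Weight q - 1 has exponent 0
  and is the plain sum over the line.\<close>

definition dop :: "('a \<Rightarrow> 'a) \<Rightarrow> nat \<Rightarrow> 'a::{field,finite} ^ 'n \<Rightarrow> ('a ^ 'n \<Rightarrow> 'a) \<Rightarrow> 'a ^ 'n \<Rightarrow> 'a" where
  "dop \<sigma> u z G y = (\<Sum>s\<in>UNIV. \<sigma> s ^ (CARD('a) - 1 - u) * G (y + s *s z))"

lemma dop_commute: "dop \<sigma> u z (dop \<tau> v w G) = dop \<tau> v w (dop \<sigma> u z G)"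
proof
  fix y
  show "dop \<sigma> u z (dop \<tau> v w G) y = dop \<tau> v w (dop \<sigma> u z G) y"
    unfolding dop_def sum_distrib_left by (subst sum.swap) (simp add: algebra_simps)
qed

text \<open>For A \<noteq> B, adding the term c = 0 gives the quotient of
  \<open>A ^ q - B ^ q\<close> by \<open>A - B\<close>, which is 1 since \<open>x ^ q = x\<close>.
  For A = B nonzero there are q - 1 ones, hence - 1.\<close>

lemma power_sum_kernel:
  fixes A B :: "'a::{field,finite}"
  shows "(\<Sum>c=1..CARD('a) - 1. A ^ c * B ^ (CARD('a) - 1 - c)) =
           (if A = 0 then 0 else (if B = 0 then 1 else 0) - (if A = B then 1 else 0))"
proof (cases "A = 0")
  case True
  then show ?thesis by (auto intro!: sum.neutral)
next
  case False
  define n where "n = CARD('a) - 1"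
  have n: "n \<ge> 1" "CARD('a) = Suc n"
    using card_UNIV_field_gt1[where 'a='a] by (auto simp: n_def)
  have split: "(\<Sum>c=0..n. A ^ c * B ^ (n - c)) = B ^ n + (\<Sum>c=1..n. A ^ c * B ^ (n - c))"
    using n by (subst sum.atLeast_Suc_atMost) auto
  show ?thesis
  proof (cases "A = B")
    case True
    have "(\<Sum>c=1..n. A ^ c * B ^ (n - c)) = (\<Sum>c=1..n. 1)"
      using False True power_card_minus_1[of A] by (intro sum.cong) (auto simp: n_def simp flip: power_add)
    also have "\<dots> = -1"
      using of_nat_CARD_field[where 'a='a] n by (simp add: add_eq_0_iff)
    finally show ?thesis using False True by (simp add: n_def)
  next
    case neq: False
    have "A ^ Suc n = A" "B ^ Suc n = B"
      using power_card_eq_self[of A] power_card_eq_self[of B] n by metis+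
    then have "A - B = (A - B) * (\<Sum>c<Suc n. A ^ c * B ^ (n - c))"
      using diff_power_eq_sum[of A n B] by metis
    then have "(\<Sum>c<Suc n. A ^ c * B ^ (n - c)) = 1"
      using neq by (metis mult_cancel_left2 right_minus_eq)
    then have "(\<Sum>c=1..n. A ^ c * B ^ (n - c)) = 1 - B ^ n"
      using split by (simp add: lessThan_Suc_atMost atMost_atLeast0 eq_diff_eq add.commute
          del: lessThan_Suc sum.lessThan_Suc)
    moreover have "B ^ n = (if B = 0 then 0 else 1)"
      using n(1) power_card_minus_1[of B, folded n_def] by (auto simp: power_0_left)
    ultimately show ?thesis using False neq by (simp add: n_def)
  qed
qed

text \<open>Fourier inversion along a line.\<close>

lemma translate_eq_sum_dop:
  assumes \<sigma>: "field_aut (\<sigma> :: 'a::{field,finite} \<Rightarrow> 'a)"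
  shows "G (y + s *s z) - G y = - (\<Sum>c=1..CARD('a) - 1. \<sigma> s ^ c * dop \<sigma> c z G y)"
proof -
  have inj: "\<sigma> a = \<sigma> b \<longleftrightarrow> a = b" for a b
    using \<sigma> by (auto simp: field_aut_def dest!: bij_is_inj injD)
  have "(\<Sum>c=1..CARD('a) - 1. \<sigma> s ^ c * dop \<sigma> c z G y)
      = (\<Sum>c=1..CARD('a) - 1. \<Sum>r\<in>UNIV. (\<sigma> s ^ c * \<sigma> r ^ (CARD('a) - 1 - c)) * G (y + r *s z))"
    by (simp add: dop_def sum_distrib_left mult.assoc)
  also have "\<dots> = (\<Sum>r\<in>UNIV. (\<Sum>c=1..CARD('a) - 1. \<sigma> s ^ c * \<sigma> r ^ (CARD('a) - 1 - c)) * G (y + r *s z))"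
    by (subst sum.swap) (simp add: sum_distrib_right)
  also have "\<dots> = (\<Sum>r\<in>UNIV. (if s = 0 then 0 else (if r = 0 then 1 else 0) - (if s = r then 1 else 0)) * G (y + r *s z))"
    by (simp only: power_sum_kernel field_aut_eq_0_iff[OF \<sigma>] inj)
  also have "\<dots> = (if s = 0 then 0 else G y - G (y + s *s z))"
    by (auto simp: left_diff_distrib sum_subtractf if_distrib[of "\<lambda>x. x * _"] cong: if_cong)
  finally show ?thesis by auto
qed

lemma sum_power_short:
  assumes \<sigma>: "field_aut (\<sigma> :: 'a::{field,finite} \<Rightarrow> 'a)" and u: "1 \<le> u"
  shows "(\<Sum>s\<in>UNIV. \<sigma> s ^ (CARD('a) - 1 - u)) = 0"
  using u card_UNIV_field_gt1[where 'a='a]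
  by (auto simp: sum_field_aut_power[OF \<sigma>] dest!: dvd_imp_le)

lemma dop_zero: 
  assumes \<sigma>: "field_aut (\<sigma> :: 'a::{field,finite} \<Rightarrow> 'a)" and u: "1 \<le> u"
  shows "dop \<sigma> u 0 G y = 0"
  using sum_power_short[OF assms] by (simp add: dop_def flip: sum_distrib_right)

text \<open>With translations, T_y T_z - 1 = (T_y - 1) + (T_z - 1) + (T_y - 1)(T_z - 1). The first
  two differences give the linear part. Fourier inversion in both directions expands the mixed term,
  and summing over s keeps c + d congruent to u modulo q - 1.\<close>

lemma dop_add:
  assumes \<sigma>: "field_aut (\<sigma> :: 'a::{field,finite} \<Rightarrow> 'a)" and u: "1 \<le> u" "u \<le> CARD('a) - 1"
  shows "dop \<sigma> u (y + z) G r = dop \<sigma> u y G r + dop \<sigma> u z G r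
     - (\<Sum>c=1..CARD('a) - 1. \<Sum>d | d \<in> {1..CARD('a) - 1} \<and> (c + d) mod (CARD('a) - 1) = u mod (CARD('a) - 1).
          dop \<sigma> c y (dop \<sigma> d z G) r)"
proof -
  define n where "n = CARD('a) - 1"
  have n: "n \<ge> 1" using card_UNIV_field_gt1[where 'a='a] by (auto simp: n_def)
  define E where "E s = (\<Sum>c=1..n. \<Sum>d=1..n. \<sigma> s ^ (c + d) * dop \<sigma> c y (dop \<sigma> d z G) r)" for s
  have sd: "G (r + s *s (y + z)) = G r + (G (r + s *s y) - G r) + (G (r + s *s z) - G r) + E s" for s
  proof -
    have "G (r + s *s y + s *s z) - G (r + s *s y) - (G (r + s *s z) - G r)
        = - (\<Sum>d=1..n. \<sigma> s ^ d * (dop \<sigma> d z G (r + s *s y) - dop \<sigma> d z G r))"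
      using translate_eq_sum_dop[OF \<sigma>, of G "r + s *s y" s z] translate_eq_sum_dop[OF \<sigma>, of G r s z]
      by (simp add: n_def right_diff_distrib sum_subtractf)
    also have "\<dots> = E s"
    proof -
      have "dop \<sigma> d z G (r + s *s y) - dop \<sigma> d z G r = - (\<Sum>c=1..n. \<sigma> s ^ c * dop \<sigma> c y (dop \<sigma> d z G) r)" for d
        using translate_eq_sum_dop[OF \<sigma>, of "dop \<sigma> d z G" r s y] by (simp add: n_def)
      then show ?thesis
        unfolding E_def by (subst sum.swap) (simp add: sum_distrib_left sum_negf power_add mult_ac)
    qed
    finally have "G (r + s *s y + s *s z) = G r + (G (r + s *s y) - G r) + (G (r + s *s z) - G r) + E s"
      by (simp add: diff_eq_eq add_ac)
    then show ?thesis
      by (simp add: vec.scale_right_distrib add.assoc)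
  qed
  have "dop \<sigma> u (y + z) G r = (\<Sum>s\<in>UNIV. \<sigma> s ^ (n - u) * (G r + (G (r + s *s y) - G r) + (G (r + s *s z) - G r) + E s))"
    unfolding dop_def n_def[symmetric] sd ..
  also have "\<dots> = dop \<sigma> u y G r + dop \<sigma> u z G r + (\<Sum>s\<in>UNIV. \<sigma> s ^ (n - u) * E s)
       - (\<Sum>s\<in>UNIV. \<sigma> s ^ (n - u)) * G r"
    by (simp add: dop_def n_def distrib_left right_diff_distrib sum.distrib sum_subtractf sum_distrib_right)
  also have "(\<Sum>s\<in>UNIV. \<sigma> s ^ (n - u)) = 0"
    using sum_power_short[OF \<sigma> u(1)] by (simp add: n_def)
  also have "(\<Sum>s\<in>UNIV. \<sigma> s ^ (n - u) * E s)
      = (\<Sum>c=1..n. \<Sum>d=1..n. (\<Sum>s\<in>UNIV. \<sigma> s ^ (n - u + c + d)) * dop \<sigma> c y (dop \<sigma> d z G) r)"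
  proof -
    have "(\<Sum>s\<in>UNIV. \<sigma> s ^ (n - u) * E s)
       = (\<Sum>s\<in>UNIV. \<Sum>c=1..n. \<Sum>d=1..n. \<sigma> s ^ (n - u + c + d) * dop \<sigma> c y (dop \<sigma> d z G) r)"
      by (simp only: E_def sum_distrib_left power_add mult.assoc)
    also have "\<dots> = (\<Sum>c=1..n. \<Sum>s\<in>UNIV. \<Sum>d=1..n. \<sigma> s ^ (n - u + c + d) * dop \<sigma> c y (dop \<sigma> d z G) r)"
      by (rule sum.swap)
    also have "\<dots> = (\<Sum>c=1..n. \<Sum>d=1..n. \<Sum>s\<in>UNIV. \<sigma> s ^ (n - u + c + d) * dop \<sigma> c y (dop \<sigma> d z G) r)"
      by (intro sum.cong refl sum.swap)
    finally show ?thesis by (simp only: sum_distrib_right)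
  qed
  also have "\<dots> = (\<Sum>c=1..n. \<Sum>d=1..n. (if (c + d) mod n = u mod n then - dop \<sigma> c y (dop \<sigma> d z G) r else 0))"
  proof (intro sum.cong refl)
    fix c d assume "c \<in> {1..n}" "d \<in> {1..n}"
    have "n dvd (n - u + c + d) \<longleftrightarrow> int n dvd int n + (int (c + d) - int u)"
      using u by (subst of_nat_dvd_iff[symmetric]) (simp add: n_def of_nat_diff algebra_simps)
    also have "\<dots> \<longleftrightarrow> int (c + d) mod int n = int u mod int n"
      by (simp only: dvd_add_right_iff dvd_refl mod_eq_dvd_iff)
    also have "\<dots> \<longleftrightarrow> (c + d) mod n = u mod n"
      by (metis of_nat_eq_iff of_nat_mod)
    finally have "n dvd (n - u + c + d) \<longleftrightarrow> (c + d) mod n = u mod n" .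
    then show "(\<Sum>s\<in>UNIV. \<sigma> s ^ (n - u + c + d)) * dop \<sigma> c y (dop \<sigma> d z G) r
       = (if (c + d) mod n = u mod n then - dop \<sigma> c y (dop \<sigma> d z G) r else 0)"
      using \<open>c \<in> {1..n}\<close> by (simp add: sum_field_aut_power[OF \<sigma>] n_def)
  qed
  also have "\<dots> = - (\<Sum>c=1..n. \<Sum>d | d \<in> {1..n} \<and> (c + d) mod n = u mod n. dop \<sigma> c y (dop \<sigma> d z G) r)"
  proof -
    have "(\<Sum>d=1..n. (if (c + d) mod n = u mod n then - dop \<sigma> c y (dop \<sigma> d z G) r else 0))
      = (\<Sum>d | d \<in> {1..n} \<and> (c + d) mod n = u mod n. - dop \<sigma> c y (dop \<sigma> d z G) r)" for c
      by (rule sum.inter_filter[symmetric]) simp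
    then show ?thesis by (simp only: sum_negf)
  qed
  finally show ?thesis by (simp add: n_def)
qed

lemma dop_scale:
  assumes \<sigma>: "field_aut (\<sigma> :: 'a::{field,finite} \<Rightarrow> 'a)" and u: "1 \<le> u" "u \<le> CARD('a) - 1"
  shows "dop \<sigma> u (a *s z) G r = \<sigma> a ^ u * dop \<sigma> u z G r"
proof (cases "a = 0")
  case True
  then show ?thesis using u dop_zero[OF \<sigma> u(1)] by (simp add: field_aut_0[OF \<sigma>] power_0_left)
next
  case False
  have a: "\<sigma> a \<noteq> 0" using False field_aut_eq_0_iff[OF \<sigma>] by auto
  have mult: "\<sigma> (x * y) = \<sigma> x * \<sigma> y" for x y using \<sigma> by (auto simp: field_aut_def)
  have "dop \<sigma> u z G r = (\<Sum>s\<in>UNIV. \<sigma> (s * a) ^ (CARD('a) - 1 - u) * G (r + (s * a) *s z))"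
    unfolding dop_def
    by (rule sum.reindex_bij_witness[of _ "\<lambda>s. s * a" "\<lambda>s. s / a"]) (use False in auto)
  also have "\<dots> = \<sigma> a ^ (CARD('a) - 1 - u) * dop \<sigma> u (a *s z) G r"
    by (simp add: dop_def mult power_mult_distrib sum_distrib_left mult_ac)
  finally have "\<sigma> a ^ u * dop \<sigma> u z G r = \<sigma> a ^ (CARD('a) - 1) * dop \<sigma> u (a *s z) G r"
    using u by (simp add: mult.assoc[symmetric] flip: power_add)
  then show ?thesis using power_card_minus_1[OF a] by simp
qed

text \<open>The sum extracts the part of \<open>dop \<sigma> u (x + a *s y)\<close> that scales like \<open>\<sigma> a ^ v\<close>.\<close>

lemma dop_split_sum:
  assumes \<sigma>: "field_aut (\<sigma> :: 'a::{field,finite} \<Rightarrow> 'a)" and v: "1 \<le> v" "v < u" "u \<le> CARD('a) - 1"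
  shows "(\<Sum>a\<in>UNIV. \<sigma> a ^ (CARD('a) - 1 - v) * dop \<sigma> u (x + a *s y) G r) = dop \<sigma> (u - v) x (dop \<sigma> v y G) r"
proof -
  define n where "n = CARD('a) - 1"
  have mult: "\<sigma> (x * y) = \<sigma> x * \<sigma> y" for x y using \<sigma> by (auto simp: field_aut_def)
  have inner: "(\<Sum>a\<in>UNIV. \<sigma> a ^ (n - v) * (\<sigma> s ^ (n - u) * G (r + s *s (x + a *s y))))
     = \<sigma> s ^ (n - (u - v)) * dop \<sigma> v y G (r + s *s x)" for s
  proof (cases "s = 0")
    case True
    have "(\<Sum>a\<in>UNIV. \<sigma> a ^ (n - v) * (\<sigma> s ^ (n - u) * G (r + s *s (x + a *s y))))
       = (\<Sum>a\<in>UNIV. \<sigma> a ^ (n - v)) * (\<sigma> s ^ (n - u) * G r)"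
      by (simp add: True sum_distrib_right)
    also have "\<dots> = 0" using sum_power_short[OF \<sigma> v(1)] by (simp add: n_def)
    finally have "(\<Sum>a\<in>UNIV. \<sigma> a ^ (n - v) * (\<sigma> s ^ (n - u) * G (r + s *s (x + a *s y)))) = 0" .
    moreover have "n - (u - v) > 0" using v by (simp add: n_def)
    then have "\<sigma> s ^ (n - (u - v)) = 0" using True by (simp add: field_aut_0[OF \<sigma>])
    ultimately show ?thesis by simp
  next
    case False
    have s: "\<sigma> s \<noteq> 0" using False field_aut_eq_0_iff[OF \<sigma>] by auto
    have "dop \<sigma> v y G (r + s *s x) = (\<Sum>a\<in>UNIV. \<sigma> (s * a) ^ (n - v) * G (r + s *s x + (s * a) *s y))"
      unfolding dop_def n_def
      by (rule sum.reindex_bij_witness[of _ "\<lambda>a. s * a" "\<lambda>a. a / s"]) (use False in auto)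
    also have "\<sigma> s ^ (n - (u - v)) * \<dots> = (\<Sum>a\<in>UNIV. (\<sigma> s ^ (n - (u - v)) * \<sigma> s ^ (n - v)) * \<sigma> a ^ (n - v) * G (r + s *s x + (s * a) *s y))"
      by (simp add: mult power_mult_distrib sum_distrib_left mult_ac)
    also have "\<sigma> s ^ (n - (u - v)) * \<sigma> s ^ (n - v) = \<sigma> s ^ n * \<sigma> s ^ (n - u)"
      using v by (simp add: n_def flip: power_add)
    also have "\<sigma> s ^ n = 1" using power_card_minus_1[OF s] by (simp add: n_def)
    finally show ?thesis
      by (simp add: vec.scale_right_distrib add.assoc mult_ac)
  qed
  have "(\<Sum>a\<in>UNIV. \<sigma> a ^ (n - v) * dop \<sigma> u (x + a *s y) G r)
     = (\<Sum>s\<in>UNIV. \<Sum>a\<in>UNIV. \<sigma> a ^ (n - v) * (\<sigma> s ^ (n - u) * G (r + s *s (x + a *s y))))"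
    by (simp add: dop_def n_def sum_distrib_left) (rule sum.swap)
  also have "\<dots> = dop \<sigma> (u - v) x (dop \<sigma> v y G) r"
    by (simp only: inner) (simp add: dop_def n_def)
  finally show ?thesis by (simp add: n_def)
qed

text \<open>With v = s + t the inner sum is a convolution of two powers. In its binomial expansion
  only k = a survives: the exponent n - a + k lies strictly between 0 and 2 n, so n divides it only
  if it equals n.\<close>

lemma dop_mult:
  assumes \<sigma>: "field_aut (\<sigma> :: 'a::{field,finite} \<Rightarrow> 'a)" and ab: "1 \<le> a" "1 \<le> b" "a + b \<le> CARD('a) - 1"
  shows "dop \<sigma> a z (dop \<sigma> b z G) r = (- ((- 1) ^ a) * of_nat ((CARD('a) - 1 - b) choose a)) * dop \<sigma> (a + b) z G r"
proof -
  define n where "n = CARD('a) - 1"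
  have add: "\<sigma> (x + y) = \<sigma> x + \<sigma> y" for x y using \<sigma> by (auto simp: field_aut_def)
  have minus: "\<sigma> (x - y) = \<sigma> x - \<sigma> y" for x y using add[of "x - y" y] by simp
  have inner: "(\<Sum>s\<in>UNIV. \<sigma> s ^ (n - a) * \<sigma> (v - s) ^ (n - b))
     = (- ((- 1) ^ a) * of_nat ((n - b) choose a)) * \<sigma> v ^ (n - (a + b))" for v
  proof -
    have "(\<Sum>s\<in>UNIV. \<sigma> s ^ (n - a) * \<sigma> (v - s) ^ (n - b))
       = (\<Sum>s\<in>UNIV. \<Sum>k\<le>n - b. of_nat ((n - b) choose k) * (- 1) ^ k * \<sigma> v ^ (n - b - k) * \<sigma> s ^ (n - a + k))"
    proof (rule sum.cong[OF refl])
      fix s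
      have "\<sigma> (v - s) ^ (n - b) = (- \<sigma> s + \<sigma> v) ^ (n - b)" by (simp add: minus)
      also have "\<dots> = (\<Sum>k\<le>n - b. of_nat ((n - b) choose k) * (- \<sigma> s) ^ k * \<sigma> v ^ (n - b - k))"
        by (rule binomial_ring)
      finally show "\<sigma> s ^ (n - a) * \<sigma> (v - s) ^ (n - b) = (\<Sum>k\<le>n - b. of_nat ((n - b) choose k) * (- 1) ^ k * \<sigma> v ^ (n - b - k) * \<sigma> s ^ (n - a + k))"
        by (simp add: sum_distrib_left power_add power_minus[of "\<sigma> s"] mult_ac)
    qed
    also have "\<dots> = (\<Sum>k\<le>n - b. of_nat ((n - b) choose k) * (- 1) ^ k * \<sigma> v ^ (n - b - k) * (\<Sum>s\<in>UNIV. \<sigma> s ^ (n - a + k)))"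
      by (subst sum.swap) (simp add: sum_distrib_left)
    also have "\<dots> = (\<Sum>k\<le>n - b. if k = a then - (of_nat ((n - b) choose a) * (- 1) ^ a * \<sigma> v ^ (n - b - a)) else 0)"
    proof (rule sum.cong[OF refl])
      fix k assume k: "k \<in> {..n - b}"
      have "(n - a + k > 0 \<and> n dvd (n - a + k)) \<longleftrightarrow> k = a"
      proof
        assume *: "n - a + k > 0 \<and> n dvd (n - a + k)"
        then obtain m where m: "n - a + k = n * m" by (auto elim: dvdE)
        have "m < 2"
        proof (rule ccontr)
          assume "\<not> m < 2"
          then have "n * m \<ge> n * 2" by simp
          moreover have "b \<le> n" using ab by (simp add: n_def)
          moreover have "k \<le> n - b" using k by simp
          ultimately show False using m ab(1,2) by linarith
        qed
        then have "m = 1" using m * by (cases m) auto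
        then show "k = a" using m ab by (simp add: n_def)
      qed (use ab in \<open>auto simp: n_def\<close>)
      then show "of_nat ((n - b) choose k) * (- 1) ^ k * \<sigma> v ^ (n - b - k) * (\<Sum>s\<in>UNIV. \<sigma> s ^ (n - a + k))
        = (if k = a then - (of_nat ((n - b) choose a) * (- 1) ^ a * \<sigma> v ^ (n - b - a)) else 0)"
        by (auto simp: sum_field_aut_power[OF \<sigma>] n_def)
    qed
    also have "\<dots> = - (of_nat ((n - b) choose a) * (- 1) ^ a * \<sigma> v ^ (n - b - a))"
      using ab by (simp add: n_def)
    finally show ?thesis by (simp add: algebra_simps)
  qed
  have "dop \<sigma> a z (dop \<sigma> b z G) r = (\<Sum>s\<in>UNIV. \<Sum>t\<in>UNIV. \<sigma> s ^ (n - a) * \<sigma> t ^ (n - b) * G (r + (s + t) *s z))"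
    by (simp add: dop_def n_def sum_distrib_left vec.scale_left_distrib algebra_simps)
  also have "\<dots> = (\<Sum>s\<in>UNIV. \<Sum>v\<in>UNIV. \<sigma> s ^ (n - a) * \<sigma> (v - s) ^ (n - b) * G (r + v *s z))"
  proof (rule sum.cong[OF refl])
    fix s
    show "(\<Sum>t\<in>UNIV. \<sigma> s ^ (n - a) * \<sigma> t ^ (n - b) * G (r + (s + t) *s z))
      = (\<Sum>v\<in>UNIV. \<sigma> s ^ (n - a) * \<sigma> (v - s) ^ (n - b) * G (r + v *s z))"
      by (rule sum.reindex_bij_witness[of _ "\<lambda>v. v - s" "\<lambda>t. s + t"]) auto
  qed
  also have "\<dots> = (\<Sum>v\<in>UNIV. (\<Sum>s\<in>UNIV. \<sigma> s ^ (n - a) * \<sigma> (v - s) ^ (n - b)) * G (r + v *s z))"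
    by (subst sum.swap) (simp add: sum_distrib_right)
  also have "\<dots> = (- ((- 1) ^ a) * of_nat ((n - b) choose a)) * dop \<sigma> (a + b) z G r"
    by (simp only: inner) (simp add: dop_def n_def sum_distrib_left mult_ac)
  finally show ?thesis by (simp add: n_def)
qed

section \<open>Products of operators\<close>

definition dops :: "('a \<Rightarrow> 'a) \<Rightarrow> (nat \<times> ('a::{field,finite} ^ 'n)) list \<Rightarrow> ('a ^ 'n \<Rightarrow> 'a) \<Rightarrow> 'a ^ 'n \<Rightarrow> 'a" where
  "dops \<sigma> L G = fold (\<lambda>(u, z). dop \<sigma> u z) L G"

lemma dops_Nil [simp]: "dops \<sigma> [] G = G"
  by (simp add: dops_def)

lemma dops_append: "dops \<sigma> (L @ L') G = dops \<sigma> L' (dops \<sigma> L G)"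
  by (simp add: dops_def)

lemma dops_mset_cong:
  assumes "mset L = mset L'"
  shows "dops \<sigma> L G = dops \<sigma> L' G"
proof -
  have "fold (\<lambda>(u, z). dop \<sigma> u z) L = fold (\<lambda>(u, z). dop \<sigma> u z) L'"
    by (rule fold_multiset_equiv) (use assms in \<open>auto simp: fun_eq_iff dop_commute\<close>)
  then show ?thesis by (simp add: dops_def)
qed

lemma dops_Cons: "dops \<sigma> ((u, z) # L) G = dop \<sigma> u z (dops \<sigma> L G)"
proof -
  have "dops \<sigma> ((u, z) # L) G = dops \<sigma> (L @ [(u, z)]) G"
    by (rule dops_mset_cong) simp
  then show ?thesis by (simp add: dops_append) (simp add: dops_def)
qed

text \<open>Vanishing is demanded only at points of C, where the weights are controlled; directions
  in C do not lead out of it.\<close>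

definition kills :: "('a \<Rightarrow> 'a) \<Rightarrow> ('a::{field,finite} ^ 'n) set \<Rightarrow> ('a ^ 'n \<Rightarrow> 'a) \<Rightarrow> (nat \<times> ('a ^ 'n)) list \<Rightarrow> bool" where
  "kills \<sigma> C g L \<longleftrightarrow> (\<forall>y\<in>C. dops \<sigma> L g y = 0)"

lemma kills_mset_cong: "mset L = mset L' \<Longrightarrow> kills \<sigma> C g L \<longleftrightarrow> kills \<sigma> C g L'"
  using dops_mset_cong by (metis kills_def)

lemma kills_Cons:
  assumes "vec.subspace C" "z \<in> C" "kills \<sigma> C g L"
  shows "kills \<sigma> C g ((u, z) # L)"
  using assms unfolding kills_def dops_Cons dop_def
  by (auto intro!: sum.neutral simp: vec.subspace_add vec.subspace_scale)

lemma kills_append: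
  assumes "vec.subspace C" "snd ` set L' \<subseteq> C" "kills \<sigma> C g L"
  shows "kills \<sigma> C g (L' @ L)"
  using assms(2) by (induction L') (auto intro: kills_Cons[OF assms(1)] assms(3))

text \<open>By \<open>dop_split_sum\<close> the product of two factors is a weighted sum, over a, of
  products in which they are merged into one factor with vector \<open>x + a *s y\<close>.\<close>

lemma kills_merge:
  assumes \<sigma>: "field_aut (\<sigma> :: 'a::{field,finite} \<Rightarrow> 'a)"
    and uv: "1 \<le> v" "v < u" "u \<le> CARD('a) - 1"
    and k: "\<And>a. kills \<sigma> C g ((u, x + a *s y) # L)"
  shows "kills \<sigma> C g ((u - v, x) # (v, y) # L)"
  unfolding kills_def dops_Cons
proof
  fix r assume r: "r \<in> C"
  have "dop \<sigma> (u - v) x (dop \<sigma> v y (dops \<sigma> L g)) r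
     = (\<Sum>a\<in>UNIV. \<sigma> a ^ (CARD('a) - 1 - v) * dop \<sigma> u (x + a *s y) (dops \<sigma> L g) r)"
    by (rule dop_split_sum[OF \<sigma> uv, symmetric])
  also have "\<dots> = 0"
    using k r by (auto simp: kills_def dops_Cons intro!: sum.neutral)
  finally show "dop \<sigma> (u - v) x (dop \<sigma> v y (dops \<sigma> L g)) r = 0" .
qed

text \<open>Induction over linear combinations of Y. Scaling is harmless, and each addition
  produces, by \<open>dop_add\<close>, only errors in which u is split in two; these vanish by
  \<open>corr\<close>.\<close>

lemma kills_span:
  assumes \<sigma>: "field_aut (\<sigma> :: 'a::{field,finite} \<Rightarrow> 'a)"
    and u: "1 \<le> u" "u \<le> CARD('a) - 1"
    and Y: "vec.span Y = C"
    and k: "\<And>y. y \<in> Y \<Longrightarrow> kills \<sigma> C g ((u, y) # L)"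
    and corr: "\<And>c d y z. c \<in> {1..CARD('a) - 1} \<Longrightarrow> d \<in> {1..CARD('a) - 1} \<Longrightarrow>
        (c + d) mod (CARD('a) - 1) = u mod (CARD('a) - 1) \<Longrightarrow> y \<in> C \<Longrightarrow> z \<in> C \<Longrightarrow>
        kills \<sigma> C g ((c, y) # (d, z) # L)"
    and z: "z \<in> C"
  shows "kills \<sigma> C g ((u, z) # L)"
proof -
  have "z \<in> vec.span Y" using z Y by simp
  then have "z \<in> C \<and> kills \<sigma> C g ((u, z) # L)"
  proof (induction rule: vec.span_induct_alt)
    case base
    show ?case
      using Y vec.span_zero[of Y] by (auto simp: kills_def dops_Cons dop_zero[OF \<sigma> u(1)])
  next
    case (step a y z)
    have yC: "y \<in> C" using step(1) Y vec.span_base by blast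
    have sub: "vec.subspace C" using Y vec.subspace_span by blast
    have ayC: "a *s y \<in> C" using yC sub by (simp add: vec.subspace_scale)
    have "dops \<sigma> ((u, a *s y + z) # L) g r = 0" if r: "r \<in> C" for r
    proof -
      have "dop \<sigma> u y (dops \<sigma> L g) r = 0" "dop \<sigma> u z (dops \<sigma> L g) r = 0"
        using k[OF step(1)] step(2) r by (auto simp: kills_def dops_Cons)
      moreover have "dop \<sigma> c (a *s y) (dop \<sigma> d z (dops \<sigma> L g)) r = 0"
        if "c \<in> {1..CARD('a) - 1}" "d \<in> {1..CARD('a) - 1}" "(c + d) mod (CARD('a) - 1) = u mod (CARD('a) - 1)" for c d
        using corr[OF that ayC] step(2) r by (auto simp: kills_def dops_Cons)
      ultimately show ?thesis
        unfolding dops_Cons dop_add[OF \<sigma> u] dop_scale[OF \<sigma> u]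
        by (auto intro!: sum.neutral)
    qed
    then show ?case using step(2) ayC sub by (auto simp: kills_def vec.subspace_add)
  qed
  then show ?thesis ..
qed

section \<open>Polynomial degree and nilpotency of long products\<close>

inductive poly_deg :: "nat \<Rightarrow> ('a::{field,finite} ^ 'n \<Rightarrow> 'a) \<Rightarrow> bool" where
  const: "poly_deg d (\<lambda>_. c)"
| coord: "poly_deg d G \<Longrightarrow> d < d' \<Longrightarrow> poly_deg d' (\<lambda>y. y $ i * G y)"
| add: "poly_deg d G \<Longrightarrow> poly_deg d H \<Longrightarrow> poly_deg d (\<lambda>y. G y + H y)"

lemma poly_deg_mono: "poly_deg d G \<Longrightarrow> d \<le> e \<Longrightarrow> poly_deg e G"
proof (induction arbitrary: e rule: poly_deg.induct)
  case (coord d G d' i)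
  then show ?case using poly_deg.coord[of d G e i] by simp
qed (auto intro: poly_deg.intros)

lemma poly_deg_scale: "poly_deg d G \<Longrightarrow> poly_deg d (\<lambda>y. a * G y)"
proof (induction rule: poly_deg.induct)
  case (coord d G d' i)
  then show ?case using poly_deg.coord[of d "\<lambda>y. a * G y" d' i] by (simp add: mult.left_commute)
qed (auto simp: distrib_left intro: poly_deg.intros)

lemma poly_deg_sum:
  "(\<And>i. i \<in> A \<Longrightarrow> poly_deg d (h i)) \<Longrightarrow> poly_deg d (\<lambda>y. \<Sum>i\<in>A. h i y)"
  by (induction A rule: infinite_finite_induct) (auto intro: poly_deg.intros)

lemma poly_deg_mult: "poly_deg d G \<Longrightarrow> poly_deg e H \<Longrightarrow> poly_deg (d + e) (\<lambda>y. G y * H y)"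
proof (induction rule: poly_deg.induct)
  case (const d c)
  then show ?case by (auto intro: poly_deg_scale poly_deg_mono)
next
  case (coord d G d' i)
  then show ?case using poly_deg.coord[of "d + e" "\<lambda>y. G y * H y" "d' + e" i] by (simp add: mult.assoc)
next
  case (add d G H')
  then show ?case by (auto simp: distrib_right intro: poly_deg.add)
qed

lemma poly_deg_power: "poly_deg d G \<Longrightarrow> poly_deg (k * d) (\<lambda>y. G y ^ k)"
  by (induction k) (auto intro: poly_deg.const poly_deg_mult)

lemma poly_deg_prod:
  "(\<And>i. i \<in> A \<Longrightarrow> poly_deg d (h i)) \<Longrightarrow> poly_deg (card A * d) (\<lambda>y. \<Prod>i\<in>A. h i y)"
  by (induction A rule: infinite_finite_induct) (auto intro: poly_deg.const poly_deg_mult)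

text \<open>Every function is a combination of indicators of points, and the indicator of c is the
  product over i of \<open>1 - (y $ i - c $ i) ^ (q - 1)\<close>.\<close>

lemma poly_deg_all:
  fixes G :: "'a::{field,finite} ^ 'n::finite \<Rightarrow> 'a"
  shows "poly_deg (CARD('n) * (CARD('a) - 1)) G"
proof -
  define n where "n = CARD('a) - 1"
  have n: "n > 0" using card_UNIV_field_gt1[where 'a='a] by (simp add: n_def)
  have delta: "(\<Prod>i\<in>UNIV. 1 + (- 1) * (y $ i + (- (c $ i))) ^ n) = (if y = c then 1 else 0)" for y c :: "'a ^ 'n"
  proof (cases "y = c")
    case True
    then show ?thesis using n by (simp add: power_0_left)
  next
    case False
    then obtain i where "y $ i \<noteq> c $ i" by (auto simp: vec_eq_iff)
    then have "(y $ i + (- (c $ i))) ^ n = 1"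
      using power_card_minus_1[of "y $ i - c $ i"] by (simp add: n_def)
    then have "\<exists>i\<in>UNIV. 1 + (- 1) * (y $ i + (- (c $ i))) ^ n = 0" by (intro bexI[of _ i]) auto
    then show ?thesis using False by (subst prod_zero) auto
  qed
  have lin: "poly_deg 1 (\<lambda>y :: 'a ^ 'n. y $ i + a)" for i a
    using poly_deg.add[OF poly_deg.coord[OF poly_deg.const[of 0 1], of 1 i] poly_deg.const[of 1 a]] by simp
  have pw: "poly_deg n (\<lambda>y :: 'a ^ 'n. (y $ i + (- (c $ i))) ^ n)" for i and c :: "'a ^ 'n"
    using poly_deg_power[OF lin[of i "- (c $ i)"], of n] by simp
  have "poly_deg n (\<lambda>y :: 'a ^ 'n. 1 + (- 1) * (y $ i + (- (c $ i))) ^ n)" for i and c :: "'a ^ 'n"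
    by (rule poly_deg.add[OF poly_deg.const poly_deg_scale[OF pw]])
  then have "poly_deg (CARD('n) * n) (\<lambda>y. \<Sum>c\<in>UNIV. G c * (\<Prod>i\<in>UNIV. 1 + (- 1) * (y $ i + (- (c $ i))) ^ n))"
    by (intro poly_deg_sum poly_deg_scale poly_deg_prod) auto
  also have "(\<lambda>y. \<Sum>c\<in>UNIV. G c * (\<Prod>i\<in>UNIV. 1 + (- 1) * (y $ i + (- (c $ i))) ^ n)) = G"
    unfolding delta by (simp add: fun_eq_iff if_distrib[of "\<lambda>x. _ * x"] cong: if_cong)
  finally show ?thesis by (simp add: n_def)
qed

text \<open>Induction on the construction, with the product rule for differences in the coordinate
  case. Degree 0 is separate because natural numbers offer no degree below it.\<close>

lemma poly_deg_translate_diff: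
  "poly_deg d G \<Longrightarrow> (if d = 0 then \<forall>y. G (y + c) - G y = 0 else poly_deg (d - 1) (\<lambda>y. G (y + c) - G y))"
proof (induction rule: poly_deg.induct)
  case (const d a)
  then show ?case by (auto intro: poly_deg.const)
next
  case (coord d G d' i)
  have "poly_deg (d' - 1) (\<lambda>y. y $ i * (G (y + c) - G y))"
  proof (cases "d = 0")
    case True
    then show ?thesis using coord poly_deg.const[of "d' - 1" 0] by simp
  next
    case False
    then show ?thesis using coord poly_deg.coord[of "d - 1" "\<lambda>y. G (y + c) - G y" "d' - 1"] by simp
  qed
  moreover have "poly_deg (d' - 1) (\<lambda>y. c $ i * (G (y + c) - G y))"
    using coord poly_deg_scale[OF poly_deg_mono[of "d - 1" "\<lambda>y. G (y + c) - G y" "d' - 1"]]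
      poly_deg.const[of "d' - 1" 0] by (cases "d = 0") auto
  moreover have "poly_deg (d' - 1) (\<lambda>y. c $ i * G y)"
    using coord by (intro poly_deg_scale poly_deg_mono[OF coord(1)]) auto
  ultimately have "poly_deg (d' - 1) (\<lambda>y. (y $ i * (G (y + c) - G y) + c $ i * (G (y + c) - G y)) + c $ i * G y)"
    by (intro poly_deg.add)
  then show ?case using coord(2) by (simp add: algebra_simps)
next
  case (add d G H)
  then show ?case
    using poly_deg.add[of "d - 1" "\<lambda>y. G (y + c) - G y" "\<lambda>y. H (y + c) - H y"]
    by (auto simp: algebra_simps split: if_splits)
qed

lemma dop_eq_translate_diff:
  assumes \<sigma>: "field_aut (\<sigma> :: 'a::{field,finite} \<Rightarrow> 'a)" and u: "1 \<le> u"
  shows "dop \<sigma> u z G y = (\<Sum>s\<in>UNIV. \<sigma> s ^ (CARD('a) - 1 - u) * (G (y + s *s z) - G y))"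
  using sum_power_short[OF assms]
  by (simp add: dop_def right_diff_distrib sum_subtractf flip: sum_distrib_right)

lemma poly_deg_dop:
  assumes \<sigma>: "field_aut (\<sigma> :: 'a::{field,finite} \<Rightarrow> 'a)" and u: "1 \<le> u" and G: "poly_deg d G"
  shows "if d = 0 then dop \<sigma> u z G = (\<lambda>_. 0) else poly_deg (d - 1) (dop \<sigma> u z G)"
proof (cases "d = 0")
  case True
  then show ?thesis using poly_deg_translate_diff[OF G] by (simp add: fun_eq_iff dop_eq_translate_diff[OF \<sigma> u])
next
  case False
  then have "poly_deg (d - 1) (\<lambda>y. \<Sum>s\<in>UNIV. \<sigma> s ^ (CARD('a) - 1 - u) * (G (y + s *s z) - G y))"
    using poly_deg_translate_diff[OF G] by (intro poly_deg_sum poly_deg_scale) auto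
  moreover have "dop \<sigma> u z G = (\<lambda>y. \<Sum>s\<in>UNIV. \<sigma> s ^ (CARD('a) - 1 - u) * (G (y + s *s z) - G y))"
    by (rule ext) (rule dop_eq_translate_diff[OF \<sigma> u])
  ultimately show ?thesis using False by simp
qed

text \<open>Each factor of weight at least 1 lowers the polynomial degree, so long products vanish.\<close>

lemma dops_nilpotent:
  fixes G :: "'a::{field,finite} ^ 'n::finite \<Rightarrow> 'a"
  assumes \<sigma>: "field_aut (\<sigma> :: 'a::{field,finite} \<Rightarrow> 'a)" and L: "\<forall>(u, z)\<in>set L. 1 \<le> u"
    and len: "length L > CARD('n) * (CARD('a) - 1)"
  shows "dops \<sigma> L G = (\<lambda>_. 0)"
proof -
  have "if length L > d then dops \<sigma> L G = (\<lambda>_. 0) else poly_deg (d - length L) (dops \<sigma> L G)"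
    if "poly_deg d G" for d
    using L
  proof (induction L)
    case Nil
    then show ?case using that by simp
  next
    case (Cons uz L)
    obtain u z where uz: "uz = (u, z)" by force
    have u: "1 \<le> u" using Cons.prems uz by auto
    have IH: "if length L > d then dops \<sigma> L G = (\<lambda>_. 0) else poly_deg (d - length L) (dops \<sigma> L G)"
      using Cons by auto
    show ?case
    proof (cases "length L > d")
      case True
      then show ?thesis using IH by (simp add: uz dops_Cons dop_def fun_eq_iff)
    next
      case False
      then have "poly_deg (d - length L) (dops \<sigma> L G)" using IH by simp
      from poly_deg_dop[OF \<sigma> u this, of z] show ?thesis
        using False by (auto simp: uz dops_Cons split: if_splits)
    qed
  qed
  from this[OF poly_deg_all[of G]] len show ?thesis by simp
qed

section \<open>Rotations of base-p digits\<close>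

locale digit_rotation =
  fixes p f :: nat
  assumes p: "p \<ge> 2" and f: "f \<ge> 1"
begin

definition "n = p ^ f - 1"

lemma pow_pos [simp]: "p ^ i > 0"
  using p by simp

lemma n_Suc: "p ^ f = Suc n"
  using pow_pos[of f] by (simp add: n_def del: pow_pos)

lemma n_pos: "n \<ge> 1"
proof -
  have "p ^ f \<ge> p ^ 1" using p f by (intro power_increasing) auto
  then show ?thesis using p by (simp add: n_def)
qed

text \<open>\<open>rr l u\<close> rotates the \<open>f\<close> base-\<open>p\<close> digits of \<open>u\<close> down by \<open>l\<close> places, that is, it
  divides by \<open>p ^ l\<close> modulo \<open>p ^ f - 1\<close> with representatives \<open>1, \<dots>, p ^ f - 1\<close>.\<close>

definition rr :: "nat \<Rightarrow> nat \<Rightarrow> nat" where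
  "rr l u = u div p ^ l + (u mod p ^ l) * p ^ (f - l)"

lemma rr_0 [simp]: "rr 0 u = u"
  by (simp add: rr_def)

text \<open>Moving the low part to the top multiplies it by \<open>p ^ f = n + 1\<close> relative to
  its old place, which leaves n extra copies.\<close>

lemma rr_eq: "l \<le> f \<Longrightarrow> p ^ l * rr l u = u + n * (u mod p ^ l)"
proof -
  assume l: "l \<le> f"
  have "p ^ l * rr l u = p ^ l * (u div p ^ l) + (p ^ l * p ^ (f - l)) * (u mod p ^ l)"
    by (simp add: rr_def algebra_simps)
  also have "p ^ l * p ^ (f - l) = Suc n"
    using l by (simp flip: power_add n_Suc)
  finally show ?thesis by simp
qed

lemma rr_range:
  assumes "l \<le> f" "1 \<le> u" "u \<le> n"
  shows "1 \<le> rr l u" "rr l u \<le> n"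
proof -
  show "1 \<le> rr l u"
    using rr_eq[OF assms(1), of u] assms(2) by (cases "rr l u") auto
  have "p ^ l * rr l u \<le> n + n * (p ^ l - 1)"
  proof -
    have "u mod p ^ l < p ^ l" by (rule mod_less_divisor[OF pow_pos])
    then have "u mod p ^ l \<le> p ^ l - 1" by linarith
    then show ?thesis using assms by (subst rr_eq) (auto intro!: add_mono mult_le_mono2)
  qed
  also have "\<dots> = p ^ l * n"
    by (cases "p ^ l") (use pow_pos[of l] in auto)
  finally show "rr l u \<le> n" using p by simp
qed

lemma coprime_pow_n: "coprime (p ^ l) n"
proof -
  have "coprime p (p ^ f - 1)"
    using f p by (metis coprime_diff_one_right_nat coprime_power_left_iff not_one_le_zero pow_pos)
  then show ?thesis by (simp add: n_def)
qed

lemma rr_mod: "l \<le> f \<Longrightarrow> (p ^ l * rr l u) mod n = u mod n"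
  by (simp add: rr_eq)

lemma mod_cancel_pow:
  assumes "(p ^ l * x) mod n = (p ^ l * y) mod n"
  shows "x mod n = y mod n"
proof -
  have "[p ^ l * x = p ^ l * y] (mod n)" using assms by (simp add: unique_euclidean_semiring_class.cong_def)
  then have "[x = y] (mod n)"
    using cong_mult_lcancel_nat[OF coprime_pow_n[of l]] by blast
  then show ?thesis by (simp add: unique_euclidean_semiring_class.cong_def)
qed

lemma range_mod_inj:
  assumes "x mod n = y mod n" "1 \<le> x" "x \<le> n" "1 \<le> y" "y \<le> n"
  shows "x = y"
proof -
  have "[x - 1 = y - 1] (mod n)"
    using assms by (metis cong_diff_nat unique_euclidean_semiring_class.cong_def)
  then show ?thesis using assms by (auto simp: unique_euclidean_semiring_class.cong_def)
qed

lemma rr_split_mod: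
  assumes "l \<le> f" "(c + d) mod n = u mod n"
  shows "(rr l c + rr l d) mod n = rr l u mod n"
proof (rule mod_cancel_pow[of l])
  have "(p ^ l * (rr l c + rr l d)) mod n = (p ^ l * rr l c + p ^ l * rr l d) mod n"
    by (simp add: distrib_left)
  also have "\<dots> = (c + d) mod n"
    by (metis mod_add_cong rr_mod[OF assms(1)])
  finally show "(p ^ l * (rr l c + rr l d)) mod n = (p ^ l * rr l u) mod n"
    using assms by (simp add: rr_mod)
qed

text \<open>Both sides agree modulo n. A sum below \<open>rr l u\<close> would be another
  representative in 1, ..., n, hence equal to it.\<close>

lemma rr_split_le:
  assumes l: "l \<le> f" and cd: "(c + d) mod n = u mod n" and r: "c \<in> {1..n}" "d \<in> {1..n}" "u \<in> {1..n}"
  shows "rr l u \<le> rr l c + rr l d"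
proof (rule ccontr)
  assume *: "\<not> rr l u \<le> rr l c + rr l d"
  have "rr l c + rr l d = rr l u"
    by (rule range_mod_inj[OF rr_split_mod[OF l cd]])
      (use * rr_range[OF l] r in \<open>auto simp: trans_le_add1 less_imp_le intro: order_trans[of _ "rr l u"]\<close>)
  then show False using * by simp
qed

text \<open>Rotation by i turns \<open>p ^ i\<close> into 1. Two positive numbers whose sum is
  congruent to 1 modulo n have sum at least n + 1; this is the strict gain behind the termination
  order.\<close>

lemma rr_split_coin:
  assumes i: "i < f" and cd: "(c + d) mod n = p ^ i mod n" and r: "c \<in> {1..n}" "d \<in> {1..n}"
  shows "rr i c + rr i d \<ge> n + 1"
proof -
  have l: "i \<le> f" using i by simp
  have "rr i (p ^ i) = 1" using p by (simp add: rr_def)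
  then have m: "(rr i c + rr i d) mod n = 1 mod n"
    using rr_split_mod[OF l cd] by simp
  have "rr i c + rr i d \<ge> 2" using rr_range(1)[OF l, of c] rr_range(1)[OF l, of d] r by simp
  have "n dvd (rr i c + rr i d - 1)"
    using m \<open>rr i c + rr i d \<ge> 2\<close> by (subst mod_eq_dvd_iff_nat[symmetric]) auto
  then show ?thesis using \<open>rr i c + rr i d \<ge> 2\<close> by (auto dest!: dvd_imp_le)
qed

section \<open>Sums of rotations over lists of weights\<close>

definition S :: "nat \<Rightarrow> nat list \<Rightarrow> nat" where
  "S l us = sum_list (map (rr l) us)"

definition Lam :: "nat \<Rightarrow> nat list \<Rightarrow> nat" where
  "Lam l us = sum_list (map (\<lambda>u. u mod p ^ l) us)"

lemma S_simps [simp]: "S l [] = 0" "S l (u # us) = rr l u + S l us" "S l (us @ vs) = S l us + S l vs"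
  by (simp_all add: S_def)

lemma Lam_simps [simp]: "Lam l [] = 0" "Lam l (u # us) = u mod p ^ l + Lam l us" "Lam l (us @ vs) = Lam l us + Lam l vs"
  by (simp_all add: Lam_def)

lemma S_0 [simp]: "S 0 us = sum_list us"
  by (induction us) auto

lemma S_Lam: "l \<le> f \<Longrightarrow> p ^ l * S l us = sum_list us + n * Lam l us"
  by (induction us) (auto simp: distrib_left rr_eq)

text \<open>By \<open>S_Lam\<close>, total weight n a makes \<open>p ^ l * S l us\<close> equal to
  \<open>n * (a + Lam l us)\<close>. Bounds on \<open>S l\<close> thus become bounds on residues,
  which can be followed while coins are distributed or merged.\<close>

lemma S_ge_iff:
  assumes "l \<le> f" "sum_list us = n * a"
  shows "S l us \<ge> n * b \<longleftrightarrow> a + Lam l us \<ge> p ^ l * b"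
proof -
  have "p ^ l * S l us = n * (a + Lam l us)" using assms by (simp add: S_Lam distrib_left)
  moreover have "S l us \<ge> n * b \<longleftrightarrow> p ^ l * S l us \<ge> p ^ l * (n * b)" using p by simp
  moreover have "p ^ l * (n * b) = n * (p ^ l * b)" by simp
  ultimately show ?thesis using n_pos by (simp del: mult_le_cancel1)
qed

lemma S_le: "\<forall>u\<in>set us. 1 \<le> u \<and> u \<le> n \<Longrightarrow> l \<le> f \<Longrightarrow> S l us \<le> n * length us"
  by (induction us) (auto simp: rr_range intro!: add_mono)

text \<open>Rotating down by f - 1 places is rotating up by one: multiplication by p modulo
  n.\<close>

definition rot :: "nat \<Rightarrow> nat" where "rot u = rr (f - 1) u"

lemma rot_range: "1 \<le> u \<Longrightarrow> u \<le> n \<Longrightarrow> 1 \<le> rot u \<and> rot u \<le> n"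
  using rr_range[of "f - 1" u] by (simp add: rot_def)

lemma rr_rot:
  assumes "1 \<le> l" "l < f" "1 \<le> u" "u \<le> n"
  shows "rr l (rot u) = rr (l - 1) u"
proof (rule range_mod_inj)
  have p1: "(p ^ (f - 1) * rot u) mod n = u mod n" by (simp add: rot_def rr_mod)
  show "rr l (rot u) mod n = rr (l - 1) u mod n"
  proof (rule mod_cancel_pow[of "f - 1 + l"])
    have "(p ^ (f - 1 + l) * rr l (rot u)) mod n = (p ^ (f - 1) * (p ^ l * rr l (rot u))) mod n"
      by (simp add: power_add mult.assoc)
    also have "\<dots> = (p ^ (f - 1) * rot u) mod n"
      using assms by (intro mod_mult_cong refl rr_mod) simp
    also have "\<dots> = u mod n" by (rule p1)
    also have "\<dots> = (p ^ (l - 1) * rr (l - 1) u) mod n"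
      using assms by (simp add: rr_mod)
    also have "\<dots> = (p ^ f * (p ^ (l - 1) * rr (l - 1) u)) mod n"
      by (simp add: n_Suc)
    also have "p ^ f * (p ^ (l - 1) * rr (l - 1) u) = p ^ (f - 1 + l) * rr (l - 1) u"
      using assms by (simp flip: power_add mult.assoc)
    finally show "(p ^ (f - 1 + l) * rr l (rot u)) mod n = (p ^ (f - 1 + l) * rr (l - 1) u) mod n" .
  qed
qed (use assms rr_range[of l "rot u"] rr_range[of "l - 1" u] rot_range[of u] in auto)

lemma S_rot: "1 \<le> l \<Longrightarrow> l < f \<Longrightarrow> \<forall>u\<in>set us. 1 \<le> u \<and> u \<le> n \<Longrightarrow> S l (map rot us) = S (l - 1) us"
  by (induction us) (auto simp: rr_rot)

lemma S_rot_0: "sum_list (map rot us) = S (f - 1) us"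
  by (simp add: S_def rot_def[abs_def])

text \<open>A coin is a weight of the form \<open>p ^ i\<close>. Multisets of coins are given by the exponents.\<close>

definition val :: "nat multiset \<Rightarrow> nat" where
  "val G = (\<Sum>i\<in>#G. p ^ i)"

definition lam :: "nat \<Rightarrow> nat multiset \<Rightarrow> nat" where
  "lam l G = val (filter_mset (\<lambda>i. i < l) G)"

lemma val_simps [simp]: "val {#} = 0" "val (add_mset i G) = p ^ i + val G" "val (G + H) = val G + val H"
  by (simp_all add: val_def)

lemma val_replicate [simp]: "val (replicate_mset m i) = m * p ^ i"
  by (induction m) auto

lemma val_eq_0_iff [simp]: "val G = 0 \<longleftrightarrow> G = {#}"
  using p by (induction G) auto

lemma pow_dvd_val: "\<forall>i\<in>#G. l \<le> i \<Longrightarrow> p ^ l dvd val G"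
  by (induction G) (auto intro: dvd_add le_imp_power_dvd)

lemma lam_simps [simp]: "lam l {#} = 0" "lam l (add_mset i G) = (if i < l then p ^ i else 0) + lam l G"
  "lam l (G + H) = lam l G + lam l H"
  by (simp_all add: lam_def)

lemma lam_replicate [simp]: "lam l (replicate_mset m i) = (if i < l then m * p ^ i else 0)"
  by (induction m) auto

lemma lam_eq_val: "\<forall>i\<in>#G. i < l \<Longrightarrow> lam l G = val G"
  by (simp add: lam_def filter_mset_cong[of G G "\<lambda>i. i < l" "\<lambda>_. True"])

text \<open>A coin is its own residue modulo \<open>p ^ l\<close> if its exponent is below l, and
  has residue 0 otherwise.\<close>

lemma Lam_coins: "Lam l (map (\<lambda>i. p ^ i) ts) = lam l (mset ts)"
proof -
  have "p ^ i mod p ^ l = (if i < l then p ^ i else 0)" for i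
    using p by (auto simp: mod_eq_0_iff_dvd le_imp_power_dvd intro!: mod_less power_strict_increasing)
  then show ?thesis by (induction ts) auto
qed

lemma val_mset: "val (mset ts) = sum_list (map (\<lambda>i. p ^ i) ts)"
  by (induction ts) auto

text \<open>The quotients \<open>(lam l D + \<tau> 0) / p ^ l\<close> are carries; they are distributed from the
  highest digit downwards, the lower bounds \<open>\<tau>\<close> and \<open>\<rho>\<close> keeping both parts feasible.\<close>

lemma coin_split:
  assumes "\<forall>i\<in>#G. i < m" "\<And>l. l < m \<Longrightarrow> \<tau> l \<le> p * \<tau> (Suc l)" "\<And>l. l < m \<Longrightarrow> \<rho> l \<le> p * \<rho> (Suc l)"
    "\<tau> m \<le> \<alpha>" "\<rho> m \<le> \<beta>" "val G + \<tau> 0 + \<rho> 0 = p ^ m * (\<alpha> + \<beta>)"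
    "\<And>l. l \<le> m \<Longrightarrow> p ^ l * (\<tau> l + \<rho> l) \<le> lam l G + \<tau> 0 + \<rho> 0"
  shows "\<exists>D V. G = D + V \<and> val D + \<tau> 0 = p ^ m * \<alpha> \<and> val V + \<rho> 0 = p ^ m * \<beta> \<and>
      (\<forall>l\<le>m. p ^ l * \<tau> l \<le> lam l D + \<tau> 0 \<and> p ^ l * \<rho> l \<le> lam l V + \<rho> 0)"
  using assms
proof (induction m arbitrary: G \<alpha> \<beta>)
  case 0
  then have "G = {#}" by (auto simp: multiset_nonemptyE)
  then show ?case using 0 by (intro exI[of _ "{#}"]) auto
next
  case (Suc m)
  define k where "k = count G m"
  define G' where "G' = filter_mset (\<lambda>i. i < m) G"
  have G: "G = G' + replicate_mset k m"
    using Suc.prems(1) by (auto simp: multiset_eq_iff G'_def k_def less_Suc_eq dest: not_in_iff[THEN iffD1] intro!: not_in_iff[THEN iffD1])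
  have G'm: "\<forall>i\<in>#G'. i < m" by (simp add: G'_def)
  have lamG: "lam l G = lam l G'" if "l \<le> m" for l using that by (simp add: G)
  have lamm: "lam m G' = val G'" using G'm by (rule lam_eq_val)
  have tot: "val G' + \<tau> 0 + \<rho> 0 + k * p ^ m = p ^ m * (p * (\<alpha> + \<beta>))"
    using Suc.prems(6) by (simp add: G algebra_simps)
  \<comment> \<open>s is the total carry into place m, produced by the coins below
    \<open>p ^ m\<close> and the two initial carries.\<close>
  define s where "s = p * (\<alpha> + \<beta>) - k"
  have "p ^ m * k \<le> p ^ m * (p * (\<alpha> + \<beta>))" using tot by (metis le_add2 mult.commute)
  then have k_le: "k \<le> p * (\<alpha> + \<beta>)" using p by simp
  then have s: "val G' + \<tau> 0 + \<rho> 0 = p ^ m * s"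
    using tot by (simp add: s_def diff_mult_distrib2 mult.commute)
  have "p ^ m * (\<tau> m + \<rho> m) \<le> p ^ m * s"
    using Suc.prems(7)[of m] lamG[of m] by (simp add: s lamm)
  then have s_ge: "\<tau> m + \<rho> m \<le> s" using p by simp
  have s_le: "s \<le> p * \<alpha> + p * \<beta>" by (simp add: s_def distrib_left)
  have t_le: "\<tau> m \<le> p * \<alpha>" "\<rho> m \<le> p * \<beta>"
    using Suc.prems(2,3)[of m] Suc.prems(4,5) p by (auto intro: order_trans[OF _ mult_left_mono])
  \<comment> \<open>The first part takes as much of s as it may: at most
    \<open>p * \<alpha>\<close>, the rest being topped up by coins \<open>p ^ m\<close>, and leaving
    \<open>\<rho> m\<close> for the second part.\<close>
  define \<alpha>' where "\<alpha>' = min (s - \<rho> m) (p * \<alpha>)"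
  define \<beta>' where "\<beta>' = s - \<alpha>'"
  have ab: "\<tau> m \<le> \<alpha>'" "\<rho> m \<le> \<beta>'" "\<alpha>' \<le> p * \<alpha>" "\<beta>' \<le> p * \<beta>" "\<alpha>' + \<beta>' = s"
    using s_ge s_le t_le by (auto simp: \<alpha>'_def \<beta>'_def min_def)
  have "\<exists>D V. G' = D + V \<and> val D + \<tau> 0 = p ^ m * \<alpha>' \<and> val V + \<rho> 0 = p ^ m * \<beta>' \<and>
      (\<forall>l\<le>m. p ^ l * \<tau> l \<le> lam l D + \<tau> 0 \<and> p ^ l * \<rho> l \<le> lam l V + \<rho> 0)"
  proof (rule Suc.IH[OF G'm])
    show "p ^ l * (\<tau> l + \<rho> l) \<le> lam l G' + \<tau> 0 + \<rho> 0" if "l \<le> m" for l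
      using Suc.prems(7)[of l] lamG[OF that] that by simp
  qed (use Suc.prems ab s in auto)
  then obtain D V where DV: "G' = D + V" "val D + \<tau> 0 = p ^ m * \<alpha>'" "val V + \<rho> 0 = p ^ m * \<beta>'"
    "\<And>l. l \<le> m \<Longrightarrow> p ^ l * \<tau> l \<le> lam l D + \<tau> 0 \<and> p ^ l * \<rho> l \<le> lam l V + \<rho> 0" by blast
  define D' where "D' = D + replicate_mset (p * \<alpha> - \<alpha>') m"
  define V' where "V' = V + replicate_mset (p * \<beta> - \<beta>') m"
  have "(p * \<alpha> - \<alpha>') + (p * \<beta> - \<beta>') = k"
    using ab k_le by (simp add: s_def distrib_left)
  then have GDV: "G = D' + V'"
    by (simp add: G DV(1) D'_def V'_def multiset_eq_iff)
  have vD: "val D' + \<tau> 0 = p ^ Suc m * \<alpha>"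
  proof -
    have "val D' + \<tau> 0 = p ^ m * \<alpha>' + (p * \<alpha> - \<alpha>') * p ^ m" using DV(2) by (simp add: D'_def)
    also have "\<dots> = p ^ m * (\<alpha>' + (p * \<alpha> - \<alpha>'))" by (simp add: algebra_simps)
    finally show ?thesis using ab by simp
  qed
  have vV: "val V' + \<rho> 0 = p ^ Suc m * \<beta>"
  proof -
    have "val V' + \<rho> 0 = p ^ m * \<beta>' + (p * \<beta> - \<beta>') * p ^ m" using DV(3) by (simp add: V'_def)
    also have "\<dots> = p ^ m * (\<beta>' + (p * \<beta> - \<beta>'))" by (simp add: algebra_simps)
    finally show ?thesis using ab by simp
  qed
  have "lam (Suc m) D' = val D'" "lam (Suc m) V' = val V'"
    using Suc.prems(1) by (auto intro!: lam_eq_val simp: GDV)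
  then have "p ^ l * \<tau> l \<le> lam l D' + \<tau> 0 \<and> p ^ l * \<rho> l \<le> lam l V' + \<rho> 0" if "l \<le> Suc m" for l
  proof (cases "l = Suc m")
    case True
    then show ?thesis using \<open>lam (Suc m) D' = val D'\<close> \<open>lam (Suc m) V' = val V'\<close> vD vV Suc.prems(4,5) p
      by (simp only:) simp
  next
    case False
    then have "l \<le> m" using that by simp
    then show ?thesis using DV(4)[of l] by (simp add: D'_def V'_def)
  qed
  then show ?case using GDV vD vV by blast
qed

text \<open>A block D of value n is split off so that the rest V keeps all bounds at level a - 1. D
  is then arranged to fill two factors up to \<open>n - p ^ R\<close> and \<open>p ^ R - 1\<close>,
  with one coin 1 set aside.\<close>

lemma coin_decompose:
  assumes G: "\<forall>i\<in>#G. i < f" and a: "a \<ge> 1" and R: "R < f" and val: "val G = n * a"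
    and lo: "\<And>l. l \<le> f \<Longrightarrow> p ^ l * a \<le> a + lam l G"
    and run: "\<And>l. 1 \<le> l \<Longrightarrow> l \<le> R \<Longrightarrow> p ^ l * (a + 1) \<le> a + lam l G"
  obtains L1 L2 V where "G = add_mset 0 (L1 + L2 + V)" "val L1 = p ^ f - 1 - p ^ R" "val L2 = p ^ R - 1"
    "\<And>l. l \<le> f \<Longrightarrow> p ^ l * (a - 1) \<le> (a - 1) + lam l V"
proof -
  \<comment> \<open>The initial carry 1 completes n to \<open>p ^ f\<close>. The value 2 in the
    window is affordable by \<open>run\<close>, as 2 + (a - 1) = a + 1; this surplus provides for
    both \<open>L2\<close> and the separate coin 1.\<close>
  define \<tau> :: "nat \<Rightarrow> nat" where "\<tau> l = (if 1 \<le> l \<and> l \<le> R then 2 else 1)" for l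
  have "\<exists>D V. G = D + V \<and> val D + \<tau> 0 = p ^ f * 1 \<and> val V + (a - 1) = p ^ f * (a - 1) \<and>
      (\<forall>l\<le>f. p ^ l * \<tau> l \<le> lam l D + \<tau> 0 \<and> p ^ l * (a - 1) \<le> lam l V + (a - 1))"
  proof (rule coin_split[OF G])
    show "\<tau> l \<le> p * \<tau> (Suc l)" for l using p by (auto simp: \<tau>_def)
    show "val G + \<tau> 0 + (a - 1) = p ^ f * (1 + (a - 1))"
      using a by (simp add: \<tau>_def val n_Suc)
    show "p ^ l * (\<tau> l + (a - 1)) \<le> lam l G + \<tau> 0 + (a - 1)" if "l \<le> f" for l
      using lo[OF that] run[of l] a by (auto simp: \<tau>_def)
  qed (use R p in \<open>auto simp: \<tau>_def\<close>)
  then obtain D V where DV: "G = D + V" "val D + 1 = p ^ f"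
    "\<And>l. l \<le> f \<Longrightarrow> p ^ l * \<tau> l \<le> lam l D + 1" "\<And>l. l \<le> f \<Longrightarrow> p ^ l * (a - 1) \<le> lam l V + (a - 1)"
    by (auto simp: \<tau>_def)
  have Df: "\<forall>i\<in>#D. i < f" using G DV(1) by auto
  have has0: "0 \<in># M" if "lam 1 M \<ge> 1" for M
  proof (rule ccontr)
    assume "0 \<notin># M"
    then have "filter_mset (\<lambda>i. i < 1) M = {#}" by (auto simp: filter_mset_eq_conv intro: gr0I)
    then have "lam 1 M = 0" by (simp only: lam_def val_simps)
    then show False using that by simp
  qed
  show thesis
  proof (cases "R = 0")
    case True
    have "p * 1 \<le> lam 1 D + 1" using DV(3)[of 1] f True by (simp add: \<tau>_def)
    then have "0 \<in># D" using has0[of D] p by simp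
    then obtain L1 where L1: "D = add_mset 0 L1" by (auto dest: multi_member_split)
    show thesis
      by (rule that[of L1 "{#}" V]) (use DV L1 True in \<open>auto simp: add.commute\<close>)
  next
    case False
    define D1 where "D1 = filter_mset (\<lambda>i. i < R) D"
    define D2 where "D2 = filter_mset (\<lambda>i. \<not> i < R) D"
    have D12: "D = D1 + D2" by (simp add: D1_def D2_def)
    have lamD1: "lam l D1 = lam l D" if "l \<le> R" for l
      unfolding lam_def D1_def filter_filter_mset
      by (intro arg_cong[where f=val] filter_mset_cong refl) (use that in auto)
    have "p ^ R dvd val D2"
      by (rule pow_dvd_val) (simp add: D2_def)
    have "p ^ R dvd p ^ f" using R by (intro le_imp_power_dvd) simp
    then have "p ^ R dvd val D1 + 1"
    proof -
      have "(val D1 + 1) + val D2 = p ^ f" using DV(2) D12 by simp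
      then have "p ^ R dvd (val D1 + 1) + val D2" using \<open>p ^ R dvd p ^ f\<close> by (simp only:)
      then show ?thesis using \<open>p ^ R dvd val D2\<close> by (simp only: dvd_add_left_iff)
    qed
    then obtain \<gamma> where \<gamma>: "val D1 + 1 = p ^ R * \<gamma>" by (auto elim: dvdE)
    have "lam R D1 = val D1" by (rule lam_eq_val) (simp add: D1_def)
    then have "p ^ R * 2 \<le> p ^ R * \<gamma>"
      using DV(3)[of R] lamD1[of R] R False \<gamma> by (simp add: \<tau>_def)
    then have \<gamma>2: "2 \<le> \<gamma>" using p by simp
    \<comment> \<open>A demanded carry at place 1 forces a coin 1 into B, while A receives exactly
      the value \<open>p ^ R - 1\<close>.\<close>
    define \<rho> :: "nat \<Rightarrow> nat" where "\<rho> l = (if l = 0 then 0 else 1)" for l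
    have "\<exists>A B. D1 = A + B \<and> val A + 1 = p ^ R * 1 \<and> val B + \<rho> 0 = p ^ R * (\<gamma> - 1) \<and>
      (\<forall>l\<le>R. p ^ l * 1 \<le> lam l A + 1 \<and> p ^ l * \<rho> l \<le> lam l B + \<rho> 0)"
    proof (rule coin_split)
      show "val D1 + 1 + \<rho> 0 = p ^ R * (1 + (\<gamma> - 1))" using \<gamma> \<gamma>2 by (simp add: \<rho>_def)
      show "p ^ l * (1 + \<rho> l) \<le> lam l D1 + 1 + \<rho> 0" if "l \<le> R" for l
        using DV(3)[of l] lamD1[OF that] R that by (auto simp: \<rho>_def \<tau>_def split: if_splits)
    qed (use p \<gamma>2 in \<open>auto simp: \<rho>_def D1_def\<close>)
    then obtain A B where AB: "D1 = A + B" "val A + 1 = p ^ R" "val B = p ^ R * (\<gamma> - 1)"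
      "\<And>l. l \<le> R \<Longrightarrow> p ^ l * \<rho> l \<le> lam l B" by (auto simp: \<rho>_def)
    have "p * 1 \<le> lam 1 B" using AB(4)[of 1] False by (simp add: \<rho>_def)
    then have "0 \<in># B" using has0[of B] p by simp
    then obtain B' where B': "B = add_mset 0 B'" by (auto dest: multi_member_split)
    show thesis
    proof (rule that[of "B' + D2" A V])
      show "G = add_mset 0 (B' + D2 + A + V)"
        using DV(1) D12 AB(1) B' by (simp add: ac_simps)
      have "val D = val A + (1 + val B') + val D2" using D12 AB(1) B' by simp
      then show "val (B' + D2) = p ^ f - 1 - p ^ R"
        using DV(2) AB(2) by simp
      show "val A = p ^ R - 1" using AB(2) by simp
      show "p ^ l * (a - 1) \<le> a - 1 + lam l V" if "l \<le> f" for l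
        using DV(4)[OF that] by simp
    qed
  qed
qed

end

section \<open>Annihilating products\<close>

text \<open>No independence is asked for: zero vectors must be allowed, since they stand for factors
  not yet started.\<close>

definition good2 :: "('a::field ^ 'n) set \<Rightarrow> 'a ^ 'n \<Rightarrow> 'a ^ 'n \<Rightarrow> bool" where
  "good2 M x y \<longleftrightarrow> (\<forall>a b. a *s x + b *s y \<in> M)"

definition good3 :: "('a::field ^ 'n) set \<Rightarrow> 'a ^ 'n \<Rightarrow> 'a ^ 'n \<Rightarrow> 'a ^ 'n \<Rightarrow> bool" where
  "good3 M x y z \<longleftrightarrow> (\<forall>a b c. a *s x + b *s y + c *s z \<in> M)"

lemma good3_first: "good3 M 0 y z \<Longrightarrow> good2 M z y"
  by (auto simp: good2_def good3_def add.commute) (metis add.commute)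

lemma good3_second: "good3 M x 0 z \<Longrightarrow> good2 M x z"
  by (auto simp: good2_def good3_def)

lemma good3_merge_first:
  assumes "good3 M x y z" shows "good2 M (x + a *s z) y"
  unfolding good2_def
proof (intro allI)
  fix c d
  have "c *s x + d *s y + (c * a) *s z \<in> M" using assms by (auto simp: good3_def)
  then show "c *s (x + a *s z) + d *s y \<in> M"
    by (simp add: vec.scale_right_distrib algebra_simps)
qed

lemma good3_merge_second:
  assumes "good3 M x y z" shows "good2 M x (y + a *s z)"
  unfolding good2_def
proof (intro allI)
  fix c d
  have "c *s x + d *s y + (d * a) *s z \<in> M" using assms by (auto simp: good3_def)
  then show "c *s x + d *s (y + a *s z) \<in> M"
    by (simp add: vec.scale_right_distrib algebra_simps)
qed

locale weighted_kills = digit_rotation p f for p f :: nat +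
  fixes C :: "('a::{field,finite} ^ 'n::finite) set"
  assumes prime_p: "prime p" and card_a: "CARD('a) = p ^ f" and subC: "vec.subspace C"
begin

lemma n_card: "CARD('a) - 1 = n" "CARD('a) - Suc 0 = n"
  by (simp_all add: n_def card_a)

definition frob :: "nat \<Rightarrow> 'a \<Rightarrow> 'a" where
  "frob t = (\<lambda>s. s ^ (p ^ t))"

lemma frob_aut: "field_aut (frob t)"
  unfolding frob_def by (rule field_aut_frobenius[OF prime_p card_a])

text \<open>Vectors range over all of C and the order is irrelevant, so for given g only the twist
  and the multiset of weights matter.\<close>

definition H :: "nat \<Rightarrow> ('a ^ 'n \<Rightarrow> 'a) \<Rightarrow> nat list \<Rightarrow> bool" where
  "H t g us \<longleftrightarrow> (\<forall>L. mset (map fst L) = mset us \<longrightarrow> snd ` set L \<subseteq> C \<longrightarrow> kills (frob t) C g L)"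

lemma H_mset_cong: "mset us = mset vs \<Longrightarrow> H t g us \<longleftrightarrow> H t g vs"
  by (simp add: H_def)

lemma H_nilpotent:
  assumes "set us \<subseteq> {1..n}" "length us > CARD('n) * n"
  shows "H t g us"
  unfolding H_def
proof (intro allI impI)
  fix L :: "(nat \<times> ('a ^ 'n)) list" assume L: "mset (map fst L) = mset us"
  have "length L = length us" using L by (metis length_map size_mset)
  moreover have "set (map fst L) = set us" using L by (metis set_mset_mset)
  then have "\<forall>(u, z)\<in>set L. 1 \<le> u" using assms(1) by fastforce
  ultimately have "dops (frob t) L g = (\<lambda>_. 0)"
    using assms(2) by (intro dops_nilpotent frob_aut) (auto simp: n_card)
  then show "kills (frob t) C g L" by (simp add: kills_def)
qed

text \<open>The exponents \<open>p ^ (t + (f - 1)) * (n - rot u)\<close> and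
  \<open>p ^ t * (n - u)\<close> agree modulo n, because \<open>p ^ (f - 1) * rot u\<close> is
  congruent to u, and they are zero together.\<close>

lemma dop_rot:
  assumes "1 \<le> u" "u \<le> n"
  shows "dop (frob (t + (f - 1))) (rot u) z G = dop (frob t) u z G"
proof -
  have "frob (t + (f - 1)) s ^ (n - rot u) = frob t s ^ (n - u)" for s
  proof -
    have r: "1 \<le> rot u" "rot u \<le> n" using rot_range assms by auto
    have "(p ^ (f - 1) * rot u) mod n = u mod n" by (simp add: rot_def rr_mod)
    have "(p ^ (f - 1) * (n - rot u)) mod n = (n - u) mod n"
    proof -
      have "int (p ^ (f - 1)) * int (rot u) mod int n = int u mod int n"
        using \<open>(p ^ (f - 1) * rot u) mod n = u mod n\<close> by (metis of_nat_mod of_nat_mult)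
      then have "int n dvd int (p ^ (f - 1)) * int (rot u) - int u"
        by (simp add: mod_eq_dvd_iff)
      then have "int n dvd int (p ^ (f - 1)) * int n - (int (p ^ (f - 1)) * int (rot u) - int u) - int n"
        by (meson dvd_diff dvd_refl dvd_triv_right)
      then have "int n dvd int (p ^ (f - 1) * (n - rot u)) - int (n - u)"
        using r assms by (simp add: of_nat_diff algebra_simps)
      then show ?thesis by (metis mod_eq_dvd_iff of_nat_eq_iff of_nat_mod)
    qed
    then have m: "(p ^ (t + (f - 1)) * (n - rot u)) mod n = (p ^ t * (n - u)) mod n"
      by (metis mod_mult_right_eq mult.assoc power_add)
    have "(n - rot u) mod n = 0 \<longleftrightarrow> (n - u) mod n = 0"
      using \<open>(p ^ (f - 1) * (n - rot u)) mod n = (n - u) mod n\<close> coprime_pow_n[of "f - 1"]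
      by (metis coprime_dvd_mult_right_iff coprime_commute mod_0_imp_dvd mod_eq_0_iff_dvd)
    then have z: "n - rot u = 0 \<longleftrightarrow> n - u = 0"
      using r assms by (auto simp: mod_if split: if_splits)
    show ?thesis
      unfolding frob_def power_mult[symmetric]
      by (rule power_eq_power_if_cong) (use m z p in \<open>auto simp: n_card\<close>)
  qed
  then show ?thesis by (simp add: dop_def fun_eq_iff n_card)
qed

lemma H_rot:
  assumes us: "set us \<subseteq> {1..n}" and H: "H (t + (f - 1)) g (map rot us)"
  shows "H t g us"
  unfolding H_def
proof (intro allI impI)
  fix L :: "(nat \<times> ('a ^ 'n)) list" assume L: "mset (map fst L) = mset us" "snd ` set L \<subseteq> C"
  have "set (map fst L) = set us" using L by (metis set_mset_mset)
  then have "\<forall>(u, z)\<in>set L. 1 \<le> u \<and> u \<le> n" using us by fastforce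
  then have "dops (frob (t + (f - 1))) (map (apfst rot) L) g = dops (frob t) L g"
    by (induction L) (auto simp: dops_Cons dop_rot[unfolded One_nat_def])
  moreover have "mset (map fst (map (apfst rot) L)) = mset (map rot us)"
  proof -
    have "map fst (map (apfst rot) L) = map rot (map fst L)" by simp
    then show ?thesis using L(1) by (simp only: mset_map)
  qed
  then have "kills (frob (t + (f - 1))) C g (map (apfst rot) L)"
    using H L(2) unfolding H_def by fastforce
  ultimately show "kills (frob t) C g L" by (simp add: kills_def)
qed

text \<open>A case of Lucas' theorem. In characteristic p the inner coefficients of
  \<open>(1 + X) ^ (p ^ i)\<close> vanish, so lowering N by \<open>p ^ i\<close> lowers the binomial
  coefficient by 1.\<close>

lemma of_nat_choose_prime_power: "(of_nat (N choose p ^ i) :: 'a) = of_nat (N div p ^ i)"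
proof (induction N rule: less_induct)
  case (less N)
  have char: "(of_nat m :: 'a) = 0 \<longleftrightarrow> p dvd m" for m
    using CHAR_finite_field[OF prime_p card_a] by (metis of_nat_eq_0_iff_char_dvd)
  show ?case
  proof (cases "N < p ^ i")
    case True
    then show ?thesis by (simp add: binomial_eq_0)
  next
    case False
    define M where "M = N - p ^ i"
    have N: "N = p ^ i + M" using False by (simp add: M_def)
    have zero: "(of_nat (p ^ i choose k) :: 'a) = 0" if k: "0 < k" "k < p ^ i" for k
    proof -
      have "\<not> p ^ i dvd k" using k by (auto dest: dvd_imp_le)
      have "k * (p ^ i choose k) = p ^ i * ((p ^ i - 1) choose (k - 1))"
        using k by (metis times_binomial_minus1_eq)
      then have "p ^ i dvd k * (p ^ i choose k)" by simp
      then have "p dvd (p ^ i choose k)"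
        using \<open>\<not> p ^ i dvd k\<close> prime_p by (metis coprime_commute coprime_dvd_mult_left_iff coprime_power_left_iff prime_imp_coprime power_0 one_dvd)
      then show ?thesis by (simp add: char)
    qed
    have "(of_nat (N choose p ^ i) :: 'a) = (\<Sum>k\<le>p ^ i. of_nat (p ^ i choose k) * of_nat (M choose (p ^ i - k)))"
      unfolding N vandermonde[symmetric] by simp
    also have "\<dots> = (\<Sum>k\<in>{0, p ^ i}. of_nat (p ^ i choose k) * of_nat (M choose (p ^ i - k)))"
      by (rule sum.mono_neutral_right) (auto simp: zero)
    also have "\<dots> = of_nat (M choose p ^ i) + 1"
      using pow_pos[of i] by (subst sum.insert) (auto simp: add.commute simp del: pow_pos)
    also have "\<dots> = of_nat (M div p ^ i) + 1"
    proof -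
      have "M < N" using False pow_pos[of i] by (simp only: M_def)
      then show ?thesis using less.IH by simp
    qed
    also have "\<dots> = of_nat (N div p ^ i)"
    proof -
      have "p ^ i \<noteq> 0" using p by simp
      then have "N div p ^ i = Suc (M div p ^ i)" unfolding N using div_add_self1[of "p ^ i" M] by simp
      then show ?thesis by simp
    qed
    finally show ?thesis .
  qed
qed

lemma dop_const_mult: "dop \<sigma> u z (\<lambda>y. \<kappa> * G y) r = \<kappa> * dop \<sigma> u z G r"
  by (simp add: dop_def sum_distrib_left mult.left_commute)

text \<open>Coins are removed from the leading digit of u one at a time. Adding \<open>p ^ i\<close>
  back to b causes no carry, so the coefficient in \<open>dop_mult\<close> is nonzero and rotations
  add up exactly.\<close>

lemma coin_expansion:
  assumes "1 \<le> u" "u \<le> n"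
  shows "\<exists>ts \<kappa>. \<kappa> \<noteq> 0 \<and> ts \<noteq> [] \<and> set ts \<subseteq> {..<f} \<and> (\<forall>l\<le>f. S l (map (\<lambda>i. p ^ i) ts) = rr l u) \<and>
     (\<forall>(z :: 'a ^ 'n) G r. dops (frob t) (map (\<lambda>i. (p ^ i, z)) ts) G r = \<kappa> * dop (frob t) u z G r)"
  using assms
proof (induction u rule: less_induct)
  case (less u)
  have "\<exists>i. p ^ i \<le> u \<and> u < p ^ Suc i"
    using ex_power_ivl1[OF p less.prems(1)] by simp
  then obtain i where i: "p ^ i \<le> u" "u < p ^ Suc i" by blast
  have "p ^ i < p ^ f" using i(1) less.prems by (simp add: n_Suc)
  then have if': "i < f" using p power_less_imp_less_exp by auto
  show ?case
  proof (cases "u = p ^ i")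
    case True
    then show ?thesis
      using if' by (intro exI[of _ "[i]"] exI[of _ 1]) (auto simp: dops_Cons)
  next
    case False
    define b where "b = u - p ^ i"
    have b: "1 \<le> b" "b < u" "b \<le> n" "p ^ i + b = u" using False i less.prems pow_pos[of i] unfolding b_def by linarith+
    obtain ts \<kappa> where IH: "\<kappa> \<noteq> 0" "ts \<noteq> []" "set ts \<subseteq> {..<f}" "\<forall>l\<le>f. S l (map (\<lambda>i. p ^ i) ts) = rr l b"
      "\<forall>(z :: 'a ^ 'n) G r. dops (frob t) (map (\<lambda>i. (p ^ i, z)) ts) G r = \<kappa> * dop (frob t) b z G r"
      using less.IH[OF b(2,1,3)] by (elim exE conjE) (rule that; assumption)
    define \<kappa>' :: 'a where "\<kappa>' = - ((- 1) ^ (p ^ i)) * of_nat ((n - b) choose p ^ i)"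
    have "\<kappa>' \<noteq> 0"
    proof -
      define d where "d = u div p ^ i"
      have d: "1 \<le> d" "d < p"
        using div_le_mono[OF i(1), of "p ^ i"] p less_mult_imp_div_less[of u p "p ^ i"] i(2)
        by (simp_all add: d_def)
      define r where "r = u mod p ^ i"
      have u: "u = d * p ^ i + r" "r < p ^ i"
        unfolding d_def r_def by (rule div_mult_mod_eq[symmetric], rule mod_less_divisor[OF pow_pos])
      \<comment> \<open>For leading digit d of u, the quotient of n - b by \<open>p ^ i\<close> is
        \<open>p ^ (f - i) - d\<close>, which is - d modulo p and so nonzero.\<close>
      define K where "K = p ^ (f - i) - d"
      have pf: "p ^ f = p ^ (f - i) * p ^ i" using if' by (simp flip: power_add)
      have "p ^ (f - i) \<ge> p ^ 1" using if' p by (intro power_increasing) auto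
      then have K: "p ^ (f - i) = K + d" using d by (simp add: K_def)
      have "n - b = K * p ^ i + (p ^ i - 1 - r)"
      proof -
        have "Suc n = (K + d) * p ^ i" using n_Suc pf K by simp
        then show ?thesis using u b(4) by (simp add: distrib_right)
      qed
      then have "(n - b) div p ^ i = K"
        using u(2) by (intro div_nat_eqI) (simp_all add: algebra_simps)
      moreover have "\<not> p dvd K"
      proof
        assume "p dvd K"
        moreover have "p dvd K + d" using K if' by (metis dvd_power zero_less_diff)
        ultimately have "p dvd d" using dvd_add_right_iff by blast
        then show False using d by (auto dest: dvd_imp_le)
      qed
      ultimately show ?thesis
        using CHAR_finite_field[OF prime_p card_a]
        by (simp add: \<kappa>'_def of_nat_choose_prime_power of_nat_eq_0_iff_char_dvd)
    qed
    have mult: "dop (frob t) (p ^ i) z (dop (frob t) b z G) r = \<kappa>' * dop (frob t) u z G r" for z :: "'a ^ 'n" and G r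
      using dop_mult[OF frob_aut, of "p ^ i" b t z G r] b less.prems pow_pos[of i]
      by (simp add: n_card \<kappa>'_def Suc_le_eq del: pow_pos)
    have rr: "rr l (p ^ i) + rr l b = rr l u" if l: "l \<le> f" for l
    proof (cases "l \<le> i")
      case True
      then have pi: "p ^ i = p ^ (i - l) * p ^ l" by (simp flip: power_add)
      have "u = b + p ^ (i - l) * p ^ l" using b(4) pi by simp
      then have "u div p ^ l = p ^ (i - l) + b div p ^ l" "u mod p ^ l = b mod p ^ l"
        using p by auto
      then show ?thesis using p by (simp add: rr_def pi)
    next
      case False
      then have "p ^ Suc i \<le> p ^ l" using p by (intro power_increasing) auto
      then have "u < p ^ l" using i by simp
      then show ?thesis using b by (simp add: rr_def flip: distrib_right)
    qed
    have "dops (frob t) (map (\<lambda>i. (p ^ i, z)) (i # ts)) G r = (\<kappa> * \<kappa>') * dop (frob t) u z G r" for z :: "'a ^ 'n" and G r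
    proof -
      have "dops (frob t) (map (\<lambda>i. (p ^ i, z)) ts) G = (\<lambda>r. \<kappa> * dop (frob t) b z G r)"
        using IH(5) by (simp add: fun_eq_iff)
      then show ?thesis by (simp add: dops_Cons dop_const_mult mult)
    qed
    moreover have "\<kappa> * \<kappa>' \<noteq> 0" using IH(1) \<open>\<kappa>' \<noteq> 0\<close> by simp
    moreover have "set (i # ts) \<subseteq> {..<f}" using IH(3) if' by simp
    moreover have "\<forall>l\<le>f. S l (map (\<lambda>i. p ^ i) (i # ts)) = rr l u" using IH(4) rr by simp
    ultimately show ?thesis by blast
  qed
qed

lemma H_coins_Cons:
  assumes "1 \<le> u" "u \<le> n"
  shows "\<exists>ts. ts \<noteq> [] \<and> set ts \<subseteq> {..<f} \<and> (\<forall>l\<le>f. S l (map (\<lambda>i. p ^ i) ts) = rr l u) \<and>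
     (\<forall>ws. H t g (map (\<lambda>i. p ^ i) ts @ ws) \<longrightarrow> H t g (u # ws))"
proof -
  from coin_expansion[OF assms, of t] obtain ts \<kappa> where ts: "\<kappa> \<noteq> 0" "ts \<noteq> []" "set ts \<subseteq> {..<f}"
    "\<forall>l\<le>f. S l (map (\<lambda>i. p ^ i) ts) = rr l u"
    "\<forall>(z :: 'a ^ 'n) G r. dops (frob t) (map (\<lambda>i. (p ^ i, z)) ts) G r = \<kappa> * dop (frob t) u z G r"
    by (elim exE conjE) (rule that; assumption)
  have "H t g (u # ws)" if Hw: "H t g (map (\<lambda>i. p ^ i) ts @ ws)" for ws
    unfolding H_def
  proof (intro allI impI)
    fix L :: "(nat \<times> ('a ^ 'n)) list" assume L: "mset (map fst L) = mset (u # ws)" "snd ` set L \<subseteq> C"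
    have "u \<in> set (map fst L)" using L(1) by (metis list.set_intros(1) set_mset_mset)
    then obtain z where z: "(u, z) \<in> set L" by auto
    define L' where "L' = remove1 (u, z) L"
    have mL: "mset L = mset ((u, z) # L')" using z by (simp add: L'_def)
    then have "mset (map fst ((u, z) # L')) = mset (u # ws)" using L(1) by (metis mset_map)
    then have L': "mset (map fst L') = mset ws" by simp
    have sub: "snd ` set ((u, z) # L') \<subseteq> C" using L(2) mL by (metis set_mset_mset)
    have "kills (frob t) C g (map (\<lambda>i. (p ^ i, z)) ts @ L')"
      using Hw unfolding H_def
    proof (elim allE impE)
      show "mset (map fst (map (\<lambda>i. (p ^ i, z)) ts @ L')) = mset (map (\<lambda>i. p ^ i) ts @ ws)"
        using L' by (simp add: comp_def)
      show "snd ` set (map (\<lambda>i. (p ^ i, z)) ts @ L') \<subseteq> C" using sub by auto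
    qed
    then have "kills (frob t) C g (L' @ map (\<lambda>i. (p ^ i, z)) ts)"
      by (subst kills_mset_cong[where L' = "map (\<lambda>i. (p ^ i, z)) ts @ L'"]) auto
    then have "kills (frob t) C g ((u, z) # L')"
      using ts(1) unfolding kills_def dops_append dops_Cons ts(5)[rule_format] by simp
    then show "kills (frob t) C g L" using kills_mset_cong[OF mL] by blast
  qed
  then show ?thesis using ts by blast
qed

lemma H_coins:
  assumes "set us \<subseteq> {1..n}"
  shows "\<exists>ts. set ts \<subseteq> {..<f} \<and> (\<forall>l\<le>f. S l (map (\<lambda>i. p ^ i) ts) = S l us) \<and>
     (\<forall>ws. H t g (map (\<lambda>i. p ^ i) ts @ ws) \<longrightarrow> H t g (us @ ws))"
  using assms
proof (induction us)
  case Nil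
  then show ?case by (intro exI[of _ "[]"]) auto
next
  case (Cons u us)
  then obtain ts where ts: "set ts \<subseteq> {..<f}" "\<forall>l\<le>f. S l (map (\<lambda>i. p ^ i) ts) = S l us"
     "\<And>ws. H t g (map (\<lambda>i. p ^ i) ts @ ws) \<Longrightarrow> H t g (us @ ws)" by auto
  obtain ts' where ts': "set ts' \<subseteq> {..<f}" "\<forall>l\<le>f. S l (map (\<lambda>i. p ^ i) ts') = rr l u"
     "\<And>ws. H t g (map (\<lambda>i. p ^ i) ts' @ ws) \<Longrightarrow> H t g (u # ws)"
    using H_coins_Cons[of u t g] Cons.prems by auto
  have "H t g ((u # us) @ ws)" if "H t g (map (\<lambda>i. p ^ i) (ts' @ ts) @ ws)" for ws
  proof -
    have "H t g (map (\<lambda>i. p ^ i) ts @ (map (\<lambda>i. p ^ i) ts' @ ws))"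
      using that by (subst H_mset_cong[where vs = "map (\<lambda>i. p ^ i) (ts' @ ts) @ ws"]) auto
    then have "H t g (us @ (map (\<lambda>i. p ^ i) ts' @ ws))" by (rule ts(3))
    then have "H t g (map (\<lambda>i. p ^ i) ts' @ (us @ ws))"
      by (subst H_mset_cong[where vs = "us @ (map (\<lambda>i. p ^ i) ts' @ ws)"]) auto
    from ts'(3)[OF this] show ?thesis by simp
  qed
  then show ?case using ts ts' by (intro exI[of _ "ts' @ ts"]) auto
qed

end

section \<open>Merging coins into two factors\<close>

definition flag_sum :: "bool \<Rightarrow> (bool \<times> nat) list \<Rightarrow> nat" where
  "flag_sum b xs = sum_list (map snd (filter (\<lambda>x. fst x = b) xs))"

lemma flag_sum_simps [simp]: "flag_sum b [] = 0" "flag_sum b (x # xs) = (if fst x = b then snd x else 0) + flag_sum b xs"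
  "flag_sum b (xs @ ys) = flag_sum b xs + flag_sum b ys"
  by (simp_all add: flag_sum_def)

text \<open>A weight 0 stands for an absent factor.\<close>

definition bw :: "nat \<Rightarrow> nat list" where
  "bw b = (if b = 0 then [] else [b])"

definition bin :: "nat \<Rightarrow> 'v \<Rightarrow> (nat \<times> 'v) list" where
  "bin b x = (if b = 0 then [] else [(b, x)])"

lemma map_fst_bin [simp]: "map fst (bin b x) = bw b"
  by (simp add: bin_def bw_def)

context weighted_kills
begin

text \<open>Coins are moved one by one into one of two factors with vectors \<open>x1\<close>, \<open>x2\<close>. A coin is
  first given a vector that extends the span of \<open>x1\<close> and \<open>x2\<close> inside \<open>M\<close>, so that it can be
  merged; then its vector is made arbitrary by linearity, up to products in which
  the coin has been split in two. Without \<open>three\<close>, only one factor is used.\<close>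

lemma chain:
  assumes M: "M \<subseteq> C" and line: "\<And>x. x \<in> M \<Longrightarrow> kills (frob t) C g [(n, x)]"
    and ext: "\<And>x1 x2. good2 M x1 x2 \<Longrightarrow> three \<or> x2 = 0 \<Longrightarrow> vec.span {y. good3 M x1 x2 y} = C"
    and Vl: "snd ` set Vl \<subseteq> C"
  shows "\<lbrakk>good2 M x1 x2; b1 = 0 \<longrightarrow> x1 = 0; b2 = 0 \<longrightarrow> x2 = 0;
     three \<or> (b2 = 0 \<and> (\<forall>x\<in>set Lr. fst (fst x))); \<forall>x\<in>set Lr. 1 \<le> snd (fst x) \<and> snd x \<in> C;
     b1 + flag_sum True (map fst Lr) + (b2 + flag_sum False (map fst Lr)) = n;
     b2 + flag_sum False (map fst Lr) = 0 \<or> b1 + flag_sum True (map fst Lr) > 0;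
     \<And>pre b c post d e. map fst Lr = pre @ (b, c) # post \<Longrightarrow> d \<in> {1..n} \<Longrightarrow> e \<in> {1..n} \<Longrightarrow>
       (d + e) mod n = c mod n \<Longrightarrow>
       H t g (bw (b1 + flag_sum True pre) @ bw (b2 + flag_sum False pre) @ d # e # map snd post @ map fst Vl)\<rbrakk>
   \<Longrightarrow> kills (frob t) C g (bin b1 x1 @ bin b2 x2 @ map (\<lambda>x. (snd (fst x), snd x)) Lr @ Vl)"
proof (induction Lr arbitrary: b1 b2 x1 x2)
  case Nil
  have comb: "a *s x1 + b *s x2 \<in> M" for a b using Nil(1) by (auto simp: good2_def)
  \<comment> \<open>The finished factors have total weight n; merged, they form a plain line sum in
    a direction of M.\<close>
  have k: "kills (frob t) C g ((n, x1 + a *s x2) # Vl)" for a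
  proof -
    have "x1 + a *s x2 \<in> M" using comb[of 1 a] by simp
    from kills_append[OF subC Vl line[OF this]] show ?thesis
      by (subst kills_mset_cong[where L' = "Vl @ [(n, x1 + a *s x2)]"]) auto
  qed
  show ?case
  proof (cases "b2 = 0")
    case True
    then have "b1 = n" using Nil by simp
    then show ?thesis using True k[of 0] n_pos by (simp add: bin_def)
  next
    case False
    then have b: "b1 > 0" "b1 + b2 = n" using Nil by auto
    have "kills (frob t) C g ((n - b2, x1) # (b2, x2) # Vl)"
      by (rule kills_merge[OF frob_aut]) (use b False k in \<open>auto simp: n_card\<close>)
    moreover have "n - b2 = b1" using b by simp
    ultimately show ?thesis using b False by (simp add: bin_def)
  qed
next
  case (Cons x Lr)
  obtain b c z where x: "x = ((b, c), z)" by (metis surj_pair)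
  let ?rest = "map (\<lambda>x. (snd (fst x), snd x)) Lr @ Vl"
  have zC: "z \<in> C" and c1: "1 \<le> c" using Cons.prems(5) by (auto simp: x)
  have cn: "c \<le> n" using Cons.prems(6) by (auto simp: x split: if_splits)
  have x12: "x1 \<in> M" "x2 \<in> M"
    using Cons.prems(1)[unfolded good2_def, rule_format, of 1 0]
      Cons.prems(1)[unfolded good2_def, rule_format, of 0 1] by auto
  have corrIH: "H t g (bw (b1' + flag_sum True pre) @ bw (b2' + flag_sum False pre) @ d # e # map snd post @ map fst Vl)"
    if "b1' = b1 + (if b then c else 0)" "b2' = b2 + (if b then 0 else c)"
      "map fst Lr = pre @ (b', c') # post" "d \<in> {1..n}" "e \<in> {1..n}" "(d + e) mod n = c' mod n" for b1' b2' pre b' c' post d e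
    using Cons.prems(8)[of "(b, c) # pre" b' c' post d e] that by (cases b) (auto simp: x add.assoc)
  \<comment> \<open>For y extending x1 and x2 within M, the coin is absorbed: an empty factor takes
    y as its vector, and otherwise \<open>kills_merge\<close> reduces to vectors shifted by
    multiples of y.\<close>
  have main: "kills (frob t) C g ((c, y) # bin b1 x1 @ bin b2 x2 @ ?rest)" if y: "good3 M x1 x2 y" for y
  proof (cases b)
    case True
    have IH: "kills (frob t) C g (bin (b1 + c) x1' @ bin b2 x2 @ ?rest)" if "good2 M x1' x2" for x1'
      by (rule Cons.IH) (use that Cons.prems corrIH[of "b1 + c" b2] True c1 in \<open>auto simp: x\<close>)
    show ?thesis
    proof (cases "b1 = 0")
      case b10: True
      then have "good2 M y x2" using y Cons.prems(2) good3_first by blast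
      from IH[OF this] show ?thesis using b10 c1 by (simp add: bin_def)
    next
      case False
      have "kills (frob t) C g ((b1 + c - c, x1) # (c, y) # bin b2 x2 @ ?rest)"
      proof (rule kills_merge[OF frob_aut])
        show "kills (frob t) C g ((b1 + c, x1 + a *s y) # bin b2 x2 @ ?rest)" for a
          using IH[OF good3_merge_first[OF y]] c1 by (simp add: bin_def)
        show "b1 + c \<le> CARD('a) - 1" using Cons.prems(6) True by (simp add: x n_card)
      qed (use c1 False in auto)
      then show ?thesis
        using False by (subst kills_mset_cong[where L' = "(b1 + c - c, x1) # (c, y) # bin b2 x2 @ ?rest"]) (auto simp: bin_def)
    qed
  next
    case bF: False
    then have three using Cons.prems(4) by (auto simp: x)
    have IH: "kills (frob t) C g (bin b1 x1 @ bin (b2 + c) x2' @ ?rest)" if "good2 M x1 x2'" for x2'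
      by (rule Cons.IH) (use that Cons.prems corrIH[of b1 "b2 + c"] bF c1 \<open>three\<close> in \<open>auto simp: x\<close>)
    show ?thesis
    proof (cases "b2 = 0")
      case b20: True
      then have "good2 M x1 y" using y Cons.prems(3) good3_second by blast
      from IH[OF this] have "kills (frob t) C g (bin b1 x1 @ (c, y) # ?rest)"
        using b20 c1 by (simp add: bin_def)
      then show ?thesis
        using b20 by (subst kills_mset_cong[where L' = "bin b1 x1 @ (c, y) # ?rest"]) (auto simp: bin_def)
    next
      case False
      have "kills (frob t) C g ((b2 + c - c, x2) # (c, y) # bin b1 x1 @ ?rest)"
      proof (rule kills_merge[OF frob_aut])
        fix a
        have "kills (frob t) C g (bin b1 x1 @ (b2 + c, x2 + a *s y) # ?rest)"
          using IH[OF good3_merge_second[OF y]] c1 by (simp add: bin_def)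
        then show "kills (frob t) C g ((b2 + c, x2 + a *s y) # bin b1 x1 @ ?rest)"
          by (subst kills_mset_cong[where L' = "bin b1 x1 @ (b2 + c, x2 + a *s y) # ?rest"]) auto
        show "b2 + c \<le> CARD('a) - 1" using Cons.prems(6) bF by (simp add: x n_card)
      qed (use c1 False in auto)
      then show ?thesis
        using False by (subst kills_mset_cong[where L' = "(b2 + c - c, x2) # (c, y) # bin b1 x1 @ ?rest"]) (auto simp: bin_def)
    qed
  qed
  \<comment> \<open>The vectors y treated in \<open>main\<close> span C, so linearity reaches every
    z; its errors split c into d and e and vanish by hypothesis.\<close>
  have "kills (frob t) C g ((c, z) # bin b1 x1 @ bin b2 x2 @ ?rest)"
  proof (rule kills_span[OF frob_aut, where Y = "{y. good3 M x1 x2 y}" and C = C])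
    show "vec.span {y. good3 M x1 x2 y} = C"
      by (rule ext) (use Cons.prems in auto)
  next
    fix d e y z'
    assume de: "d \<in> {1..CARD('a) - 1}" "e \<in> {1..CARD('a) - 1}" "(d + e) mod (CARD('a) - 1) = c mod (CARD('a) - 1)"
      "y \<in> C" "z' \<in> C"
    have "H t g (bw b1 @ bw b2 @ d # e # map snd (map fst Lr) @ map fst Vl)"
      using Cons.prems(8)[of "[]" b c "map fst Lr" d e] de by (simp add: x n_card)
    then show "kills (frob t) C g ((d, y) # (e, z') # bin b1 x1 @ bin b2 x2 @ ?rest)"
      unfolding H_def
    proof (elim allE impE)
      show "mset (map fst ((d, y) # (e, z') # bin b1 x1 @ bin b2 x2 @ ?rest)) =
          mset (bw b1 @ bw b2 @ d # e # map snd (map fst Lr) @ map fst Vl)"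
        by (simp add: comp_def)
      have "snd ` set ?rest \<subseteq> C" using Vl Cons.prems(5) by auto
      moreover have "snd ` set (bin b1 x1 @ bin b2 x2) \<subseteq> C" using x12 M by (auto simp: bin_def)
      ultimately show "snd ` set ((d, y) # (e, z') # bin b1 x1 @ bin b2 x2 @ ?rest) \<subseteq> C"
        using de by (simp only: set_append set_simps image_Un image_insert snd_conv) blast
    qed
  qed (use c1 cn zC main in \<open>auto simp: n_card\<close>)
  then show ?case
    by (subst kills_mset_cong[where L' = "(c, z) # bin b1 x1 @ bin b2 x2 @ ?rest"]) (auto simp: x)
qed

lemma Lam_bw [simp]: "Lam l (bw b) = b mod p ^ l"
  by (simp add: bw_def)

lemma sum_list_bw [simp]: "sum_list (bw b) = b"
  by (simp add: bw_def)

text \<open>All base-p digits of n are p - 1. Up to R both residues are maximal; above R they sum to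
  \<open>p ^ l - 2\<close>, and the coin 1 added last will supply the missing unit.\<close>

lemma n_minus_mod:
  assumes "R < f" "l < f" "1 \<le> l"
  shows "p ^ l - 1 \<le> (n - p ^ R) mod p ^ l + (p ^ R - 1) mod p ^ l + (if l \<le> R then 0 else 1)"
    and "l \<le> R \<Longrightarrow> p ^ l - 1 \<le> (n - p ^ R) mod p ^ l \<and> p ^ l - 1 \<le> (p ^ R - 1) mod p ^ l"
proof -
  have last: "(K * p ^ l - 1) mod p ^ l = p ^ l - 1" if "K > 0" for K
  proof -
    have "K * p ^ l - 1 = (K - 1) * p ^ l + (p ^ l - 1)"
      using that pow_pos[of l] by (cases K) (simp_all add: Suc_le_eq del: pow_pos)
    then have "(K * p ^ l - 1) mod p ^ l = (p ^ l - 1) mod p ^ l" by (simp only: mod_mult_self3)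
    then show ?thesis by (simp only: mod_less[OF diff_less[OF zero_less_one pow_pos]])
  qed
  have Rf: "p ^ R < p ^ f" using assms p by (intro power_strict_increasing) auto
  have pf: "p ^ f = p ^ (f - l) * p ^ l" using assms by (simp flip: power_add)
  show two: "p ^ l - 1 \<le> (n - p ^ R) mod p ^ l \<and> p ^ l - 1 \<le> (p ^ R - 1) mod p ^ l" if "l \<le> R"
  proof -
    have pR: "p ^ R = p ^ (R - l) * p ^ l" using that by (simp flip: power_add)
    have "p ^ (R - l) < p ^ (f - l)" using assms that p by (intro power_strict_increasing) auto
    then have "n - p ^ R = (p ^ (f - l) - p ^ (R - l)) * p ^ l - 1" "p ^ (f - l) - p ^ (R - l) > 0"
      unfolding n_def pf pR by (auto simp: diff_mult_distrib)
    then show ?thesis using last[of "p ^ (f - l) - p ^ (R - l)"] last[OF pow_pos, of "R - l"]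
      unfolding pR by simp
  qed
  show "p ^ l - 1 \<le> (n - p ^ R) mod p ^ l + (p ^ R - 1) mod p ^ l + (if l \<le> R then 0 else 1)"
  proof (cases "l \<le> R")
    case True then show ?thesis using two by simp
  next
    case False
    then have Rl: "p ^ R < p ^ l" using p by (intro power_strict_increasing) auto
    have "n - p ^ R = (p ^ (f - l) - 1) * p ^ l + (p ^ l - 1 - p ^ R)"
    proof -
      have "p ^ (f - l) \<ge> 1" using p by simp
      then have "p ^ f = (p ^ (f - l) - 1) * p ^ l + p ^ l"
        unfolding pf by (metis add.commute le_add_diff_inverse2 mult.commute mult_Suc_right plus_1_eq_Suc)
      then show ?thesis using Rl by (simp add: n_def)
    qed
    then have "(n - p ^ R) mod p ^ l = (p ^ l - 1 - p ^ R) mod p ^ l" by simp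
    also have "\<dots> = p ^ l - 1 - p ^ R" using Rl by (intro mod_less) simp
    finally show ?thesis using Rl False by simp
  qed
qed

lemma flag_sum_mset_cong: "mset xs = mset ys \<Longrightarrow> flag_sum b xs = flag_sum b ys"
proof -
  assume "mset xs = mset ys"
  then have "mset (map snd (filter (\<lambda>x. fst x = b) xs)) = mset (map snd (filter (\<lambda>x. fst x = b) ys))"
    by simp
  then show ?thesis unfolding flag_sum_def by (metis sum_mset_sum_list)
qed

lemma ex_list_with_fst:
  "mset (map fst L) = mset ws \<Longrightarrow> \<exists>L'. mset L' = mset L \<and> map fst L' = ws"
proof (induction ws arbitrary: L)
  case (Cons w ws)
  have "w \<in> set (map fst L)" using Cons.prems by (metis list.set_intros(1) set_mset_mset)
  then obtain z where z: "(w, z) \<in> set L" by auto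
  then have "mset (map fst (remove1 (w, z) L)) = mset ws"
    using Cons.prems by (simp add: image_mset_Diff)
  then obtain L' where L': "mset L' = mset (remove1 (w, z) L)" "map fst L' = ws" using Cons.IH by blast
  have "mset ((w, z) # L') = mset L" using L'(1) z by simp
  then show ?case using L'(2) by (metis fst_conv list.simps(9))
qed auto

text \<open>The flag selects the factor that the coin will join, \<open>True\<close> standing for
  the first.\<close>

abbreviation wt :: "bool \<times> nat \<Rightarrow> bool \<times> nat" where
  "wt x \<equiv> (fst x, p ^ snd x)"

text \<open>Merging can only lower residue sums, so a partly filled state is bounded below by the
  state with the remaining coins merged too.\<close>

lemma bins_mod_le:
  "(B1 + flag_sum True (map wt xs)) mod p ^ l + (B2 + flag_sum False (map wt xs)) mod p ^ l
     \<le> B1 mod p ^ l + B2 mod p ^ l + Lam l (map (\<lambda>x. p ^ snd x) xs)"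
proof (induction xs arbitrary: B1 B2)
  case (Cons x xs)
  have sub: "(B + c) mod m \<le> B mod m + c mod m" for B c m :: nat
    by (metis mod_add_eq mod_less_eq_dividend)
  show ?case
  proof (cases "fst x")
    case True
    then show ?thesis using Cons[of "B1 + p ^ snd x" B2] sub[of B1 "p ^ snd x" "p ^ l"] by (simp add: add.assoc)
  next
    case False
    then show ?thesis using Cons[of B1 "B2 + p ^ snd x"] sub[of B2 "p ^ snd x" "p ^ l"] by (simp add: add.assoc)
  qed
qed simp

text \<open>The two factors are filled up to \<open>n - p ^ R\<close> and \<open>p ^ R\<close>, with a coin 1 coming last. Until
  then the coins kept apart in \<open>L1\<close>, \<open>L2\<close> and \<open>V\<close> preserve the lower bounds on all \<open>S l\<close>.
  Taking the coins in descending order, merging only affects \<open>S l\<close> for \<open>l\<close> above the current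
  exponent, while splitting the current coin increases \<open>S\<close> at that exponent.\<close>

lemma step:
  assumes M: "M \<subseteq> C" "0 \<in> M" and line: "\<And>x. x \<in> M \<Longrightarrow> kills (frob t) C g [(n, x)]"
    and ext: "\<And>x1 x2. good2 M x1 x2 \<Longrightarrow> three \<or> x2 = 0 \<Longrightarrow> vec.span {y. good3 M x1 x2 y} = C"
    and ts: "set ts \<subseteq> {..<f}" and us_def: "us = map (\<lambda>i. p ^ i) ts"
    and a: "a \<ge> 1" and R: "R < f" "three \<or> R = 0" and sum: "sum_list us = n * a"
    and ge: "\<And>l. l < f \<Longrightarrow> S l us \<ge> n * a"
    and run: "\<And>l. 1 \<le> l \<Longrightarrow> l \<le> R \<Longrightarrow> S l us \<ge> n * (a + 1)"
    and IH: "\<And>vs. set vs \<subseteq> {1..n} \<Longrightarrow> n dvd sum_list vs \<Longrightarrow> \<forall>l<f. S l vs \<ge> n * a \<Longrightarrow>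
       \<forall>l. 1 \<le> l \<longrightarrow> l \<le> R \<longrightarrow> S l vs \<ge> n * (a + 1) \<Longrightarrow>
       \<exists>i<f. S i us < S i vs \<and> (\<forall>l\<le>i. S l us \<le> S l vs) \<Longrightarrow> H t g vs"
  shows "H t g us"
proof -
  have lamG: "Lam l us = lam l (mset ts)" for l by (simp add: us_def Lam_coins)
  have valG: "val (mset ts) = n * a" using sum by (simp add: val_mset us_def)
  obtain L1 L2 V where G: "mset ts = add_mset 0 (L1 + L2 + V)" "val L1 = p ^ f - 1 - p ^ R" "val L2 = p ^ R - 1"
    "\<And>l. l \<le> f \<Longrightarrow> p ^ l * (a - 1) \<le> (a - 1) + lam l V"
  proof (rule coin_decompose[of "mset ts" a R])
    show "p ^ l * a \<le> a + lam l (mset ts)" if "l \<le> f" for l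
    proof (cases "l = f")
      case True
      then have "lam l (mset ts) = n * a" using ts valG by (subst lam_eq_val) auto
      then show ?thesis by (simp add: True n_Suc)
    next
      case False
      then show ?thesis using ge[of l] S_ge_iff[OF that sum, of a] that by (simp add: lamG)
    qed
    show "p ^ l * (a + 1) \<le> a + lam l (mset ts)" if "1 \<le> l" "l \<le> R" for l
      using run[OF that] S_ge_iff[OF _ sum, of l "a + 1"] that R by (simp add: lamG)
  qed (use ts a R valG in auto)
  obtain l1 l2 vl where l: "mset l1 = L1" "mset l2 = L2" "mset vl = V" using ex_mset by metis
  \<comment> \<open>In descending order, all coins merged before \<open>p ^ i\<close> are multiples
    of it. The separate coin 1 follows in \<open>seq\<close>: for R = 0 it joins the first factor,
    the second staying empty; otherwise it completes the second to \<open>p ^ R\<close>.\<close>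
  define seq0 where "seq0 = rev (sort_key snd (map (Pair True) l1 @ map (Pair False) l2))"
  define seq where "seq = seq0 @ [(R = 0, 0)]"
  define vw where "vw = map (\<lambda>i. p ^ i) vl"
  define cs where "cs = map wt seq"
  have mset0: "mset seq0 = image_mset (Pair True) L1 + image_mset (Pair False) L2"
    by (simp add: seq0_def flip: l)
  have sorted0: "sorted_wrt (\<lambda>x y. snd y \<le> snd x) seq0"
    unfolding seq0_def sorted_wrt_rev using sorted_sort_key[of snd] unfolding sorted_map .
  then have sorted: "sorted_wrt (\<lambda>x y. snd y \<le> snd x) seq"
    by (simp add: seq_def sorted_wrt_append)
  have fs0: "flag_sum True (map wt seq0) = n - p ^ R" "flag_sum False (map wt seq0) = p ^ R - 1"
  proof -
    have "flag_sum b (map wt seq0) = flag_sum b (map wt (map (Pair True) l1 @ map (Pair False) l2))" for b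
      by (rule flag_sum_mset_cong) (simp add: mset0 image_mset.compositionality flip: l)
    moreover have "flag_sum b (map wt (map (Pair b') xs)) = (if b = b' then val (mset xs) else 0)" for b b' xs
      by (induction xs) auto
    ultimately show "flag_sum True (map wt seq0) = n - p ^ R" "flag_sum False (map wt seq0) = p ^ R - 1"
      using G l by (simp_all add: n_def)
  qed
  have pRn: "p ^ R \<le> n"
    using power_strict_increasing[OF R(1), of p] p n_Suc by simp
  have tsf: "\<forall>x\<in>set seq. snd x < f"
  proof -
    have "snd ` set seq0 \<subseteq> set ts"
    proof -
      have "set seq0 = Pair True ` set_mset L1 \<union> Pair False ` set_mset L2"
        using arg_cong[OF mset0, of set_mset] by simp
      moreover have "set_mset L1 \<union> set_mset L2 \<subseteq> set ts" using arg_cong[OF G(1), of set_mset] by auto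
      ultimately show ?thesis by auto
    qed
    then show ?thesis using ts f by (auto simp: seq_def)
  qed
  have vlf: "set vl \<subseteq> {..<f}" using ts arg_cong[OF G(1), of set_mset] l by auto
  have us_perm: "mset us = mset (map snd cs @ vw)"
  proof -
    have "mset (map snd cs) = image_mset (\<lambda>i. p ^ i) (image_mset snd (mset seq))"
      by (simp add: cs_def comp_def image_mset.compositionality)
    also have "image_mset snd (mset seq) = add_mset 0 (L1 + L2)"
      by (simp add: seq_def mset0 image_mset.compositionality comp_def)
    finally show ?thesis using G(1) by (simp add: us_def vw_def l ac_simps)
  qed
  have pow_n: "p ^ i \<in> {1..n}" if "i < f" for i
    using power_strict_increasing[OF that, of p] p n_Suc by (simp add: Suc_le_eq)
  have corr: "H t g (bw (flag_sum True pre) @ bw (flag_sum False pre) @ d # e # map snd post @ vw)"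
    if dec: "cs = pre @ (b, c) # post" and d: "d \<in> {1..n}" and e: "e \<in> {1..n}" and de: "(d + e) mod n = c mod n"
    for pre b c post d e
  proof -
    obtain pre' i post' where s: "seq = pre' @ (b, i) # post'" "pre = map wt pre'" "c = p ^ i" "post = map wt post'"
      using dec unfolding cs_def by (auto simp: map_eq_append_conv map_eq_Cons_conv)
    have if': "i < f" using tsf s by auto
    have pre_ge: "\<forall>x\<in>set pre'. i \<le> snd x" using sorted s by (auto simp: sorted_wrt_append)
    define B1 where "B1 = flag_sum True pre"
    define B2 where "B2 = flag_sum False pre"
    define tail where "tail = map (\<lambda>x. p ^ snd x) post' @ vw"
    have tail: "map snd post @ vw = tail" by (simp add: tail_def s(4) comp_def)
    \<comment> \<open>\<open>st\<close> holds the weights just before c is merged, and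
      \<open>vs\<close> those of the error in which c is split into d and e.\<close>
    define st where "st = bw B1 @ bw B2 @ c # tail"
    define vs where "vs = bw B1 @ bw B2 @ d # e # tail"
    have "flag_sum True xs + flag_sum False xs = sum_list (map snd xs)" for xs
      by (induction xs) auto
    then have sum_pre: "B1 + B2 = sum_list (map snd pre)" by (simp add: B1_def B2_def)
    have sum_us: "sum_list us = sum_list (map snd cs) + sum_list vw"
      using us_perm by (metis sum_list_append sum_mset_sum_list)
    have sum_st: "sum_list st = n * a"
      using sum sum_us sum_pre by (simp add: st_def tail[symmetric] dec)
    have tail_range: "set tail \<subseteq> {1..n}"
      using tsf vlf s pow_n by (auto simp: tail_def vw_def subset_iff)
    have "B1 + B2 \<le> n"
    proof -
      have "flag_sum True cs + flag_sum False cs = (n - p ^ R) + (p ^ R - 1) + 1"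
        using fs0 by (simp add: cs_def seq_def)
      moreover have "1 \<le> p ^ R" using p by simp
      ultimately have "flag_sum True cs + flag_sum False cs = n"
        using pRn by linarith
      then show ?thesis using dec by (simp add: B1_def B2_def)
    qed
    then have vs_range: "set vs \<subseteq> {1..n}"
      using tail_range d e by (auto simp: vs_def bw_def split: if_splits)
    have c_range: "c \<in> {1..n}" using pow_n[OF if'] s by simp
    have S_vs: "S l st \<le> S l vs" if "l \<le> f" for l
      using rr_split_le[OF that de d e c_range] by (simp add: st_def vs_def)
    have S_vs_i: "S i st < S i vs"
      using rr_split_coin[OF if' _ d e] de s(3) p n_pos by (simp add: st_def vs_def rr_def)
    have "n dvd sum_list vs"
    proof -
      have "sum_list vs + c = sum_list st + (d + e)" by (simp add: st_def vs_def)
      then have "(sum_list vs + c) mod n = (d + e) mod n" by (simp add: sum_st)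
      then have "(sum_list vs + c) mod n = (0 + c) mod n" using de by simp
      then show ?thesis by (metis add_diff_cancel_right' diff_zero le_add2 mod_eq_dvd_iff_nat)
    qed
    \<comment> \<open>Everything merged so far is a multiple of \<open>p ^ i\<close>, so residues up
      to level i are unchanged.\<close>
    have Lam_low: "S l st = S l us" if "l \<le> i" for l
    proof -
      have lf: "l \<le> f" using that if' by simp
      have dvd: "p ^ l dvd p ^ snd x" if "x \<in> set pre'" for x
        using pre_ge that \<open>l \<le> i\<close> by (intro le_imp_power_dvd) auto
      then have z: "Lam l (map snd pre) = 0" by (auto simp: Lam_def s(2))
      have "p ^ l dvd flag_sum b' (map wt pre')" for b'
        using dvd by (induction pre') auto
      then have "Lam l st = Lam l (c # tail)" by (simp add: st_def B1_def B2_def s(2))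
      also have "\<dots> = Lam l (map snd cs @ vw)" using z by (simp add: dec tail[symmetric])
      also have "\<dots> = Lam l us" unfolding Lam_def using us_perm by (metis mset_map sum_mset_sum_list)
      finally have "p ^ l * S l st = p ^ l * S l us"
        using sum sum_st by (simp add: S_Lam[OF lf])
      then show ?thesis using p by simp
    qed
    \<comment> \<open>The comparison is with the state where the factors are filled to
      \<open>n - p ^ R\<close> and \<open>p ^ R - 1\<close>, and only the last coin 1 and V
      remain.\<close>
    have Lam_st: "(n - p ^ R) mod p ^ l + (p ^ R - 1) mod p ^ l + 1 mod p ^ l + lam l V \<le> Lam l st" for l
    proof -
      define last where "last = (R = 0, 0 :: nat)"
      have "\<exists>rest. (b, i) # post' = rest @ [last] \<and> seq0 = pre' @ rest"
      proof -
        have "(b, i) # post' = butlast ((b, i) # post') @ [List.last ((b, i) # post')]" by simp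
        then have "seq0 @ [last] = (pre' @ butlast ((b, i) # post')) @ [List.last ((b, i) # post')]"
          using s(1) unfolding seq_def last_def by (metis append.assoc)
        then have "seq0 = pre' @ butlast ((b, i) # post')" "last = List.last ((b, i) # post')" by auto
        then show ?thesis by (metis append_butlast_last_id list.distinct(1))
      qed
      then obtain rest where rest: "(b, i) # post' = rest @ [last]" "seq0 = pre' @ rest" by blast
      have "Lam l (map (\<lambda>x. p ^ snd x) ((b, i) # post')) = Lam l (map (\<lambda>x. p ^ snd x) rest) + 1 mod p ^ l"
        unfolding rest(1) by (simp add: last_def)
      then have "Lam l st = B1 mod p ^ l + B2 mod p ^ l + Lam l (map (\<lambda>x. p ^ snd x) rest) + 1 mod p ^ l + lam l V"
        by (simp add: st_def tail_def s(3) vw_def Lam_coins l)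
      moreover have "(B1 + flag_sum True (map wt rest)) = n - p ^ R" "(B2 + flag_sum False (map wt rest)) = p ^ R - 1"
        using fs0 by (simp_all add: B1_def B2_def s(2) rest(2))
      ultimately show ?thesis using bins_mod_le[of B1 rest l B2] by simp
    qed
    have pl1: "1 mod p ^ l = 1" if "1 \<le> l" for l
    proof -
      have "p ^ l \<ge> p ^ 1" using that p by (intro power_increasing) auto
      then show ?thesis using p that by simp
    qed
    have bound: "S l st \<ge> n * a" if "l < f" for l
    proof (cases "l = 0")
      case True
      then show ?thesis using sum_st by simp
    next
      case False
      \<comment> \<open>The contribution \<open>p ^ l - 1\<close> lifts the bound from level a - 1,
        which V satisfies, to level a.\<close>
      then have "p ^ l - 1 + lam l V \<le> Lam l st"
        using Lam_st[of l] n_minus_mod(1)[OF R(1) that] pl1[of l] by (auto split: if_splits)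
      then have "p ^ l * a \<le> a + Lam l st"
        using G(4)[of l] that a pow_pos[of l] by (cases a) (simp_all del: pow_pos)
      then show ?thesis using S_ge_iff[OF _ sum_st, of l a] that by simp
    qed
    have bound_run: "S l st \<ge> n * (a + 1)" if "1 \<le> l" "l \<le> R" for l
    proof -
      \<comment> \<open>In the window both factors contribute \<open>p ^ l - 1\<close>; with the
        coin 1 this lifts the bound by two levels.\<close>
      have "(p ^ l - 1) + (p ^ l - 1) + 1 + lam l V \<le> Lam l st"
        using Lam_st[of l] n_minus_mod(2)[OF R(1) _ that(1,2)] pl1[of l] that R by auto
      then have "p ^ l * (a + 1) \<le> a + Lam l st"
        using G(4)[of l] that R a pow_pos[of l] by (cases a) (simp_all del: pow_pos)
      then show ?thesis using S_ge_iff[OF _ sum_st, of l "a + 1"] that R by simp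
    qed
    have "H t g vs"
    proof (rule IH[OF vs_range \<open>n dvd sum_list vs\<close>])
      show "\<forall>l<f. n * a \<le> S l vs" using bound S_vs by (meson less_imp_le order_trans)
      show "\<forall>l. 1 \<le> l \<longrightarrow> l \<le> R \<longrightarrow> n * (a + 1) \<le> S l vs"
        using bound_run S_vs R by (meson le_less_trans less_imp_le order_trans)
      show "\<exists>i<f. S i us < S i vs \<and> (\<forall>l\<le>i. S l us \<le> S l vs)"
      proof (intro exI[of _ i] conjI allI impI if')
        show "S i us < S i vs" using Lam_low[of i] S_vs_i by simp
        show "S l us \<le> S l vs" if "l \<le> i" for l
          using Lam_low[OF that] S_vs[of l] that if' by simp
      qed
    qed
    then show ?thesis by (simp add: vs_def tail[symmetric] B1_def B2_def)
  qed
  show ?thesis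
    unfolding H_def
  proof (intro allI impI)
    fix L :: "(nat \<times> ('a ^ 'n)) list" assume L: "mset (map fst L) = mset us" "snd ` set L \<subseteq> C"
    then obtain L' where L': "mset L' = mset L" "map fst L' = map snd cs @ vw"
      using ex_list_with_fst us_perm by metis
    define Vl where "Vl = drop (length cs) L'"
    define Lr where "Lr = zip cs (map snd (take (length cs) L'))"
    have len: "length L' = length cs + length vw" using L'(2) by (metis length_append length_map)
    have fstLr: "map fst Lr = cs" using len by (simp add: Lr_def)
    have fstVl: "map fst Vl = vw" using L'(2) by (simp add: Vl_def flip: drop_map)
    have "map (\<lambda>x. (snd (fst x), snd x)) Lr = take (length cs) L'"
    proof -
      have tk: "map fst (take (length cs) L') = map snd cs" using L'(2) by (simp flip: take_map)
      have "map (\<lambda>x. (snd (fst x), snd x)) Lr = zip (map snd cs) (map snd (take (length cs) L'))"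
        by (simp add: Lr_def zip_map1 case_prod_beta' split_def)
      then show ?thesis by (metis tk zip_map_fst_snd)
    qed
    then have LrVl: "map (\<lambda>x. (snd (fst x), snd x)) Lr @ Vl = L'" by (simp add: Vl_def)
    have subL': "snd ` set L' \<subseteq> C" using L(2) L'(1) by (metis set_mset_mset)
    have "kills (frob t) C g (bin 0 0 @ bin 0 0 @ map (\<lambda>x. (snd (fst x), snd x)) Lr @ Vl)"
    proof (rule chain[OF M(1) line ext, where three = three])
      have "set Vl \<subseteq> set L'" unfolding Vl_def by (rule set_drop_subset)
      then show "snd ` set Vl \<subseteq> C" using subL' by (meson image_mono order_trans)
      show "good2 M 0 0" using M(2) by (simp add: good2_def)
      show "three \<or> (0 :: nat) = 0 \<and> (\<forall>x\<in>set Lr. fst (fst x))"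
      proof (cases three)
        case False
        then have R0: "R = 0" using R by simp
        then have "L2 = {#}" using G(3) by simp
        then have "\<forall>x\<in>set seq0. fst x" using arg_cong[OF mset0, of set_mset] by auto
        then have "\<forall>x\<in>set cs. fst x" using R0 by (simp add: cs_def seq_def)
        then show ?thesis using fstLr by (metis image_eqI list.set_map)
      qed simp
      show "\<forall>x\<in>set Lr. 1 \<le> snd (fst x) \<and> snd x \<in> C"
      proof
        fix x assume x: "x \<in> set Lr"
        then have "fst x \<in> set cs" using fstLr by (metis image_eqI list.set_map)
        then have "1 \<le> snd (fst x)" using p by (auto simp: cs_def Suc_le_eq)
        moreover have "snd x \<in> C" using x subL' LrVl by (metis (no_types, lifting) UnCI image_eqI image_subset_iff list.set_map set_append snd_conv)
        ultimately show "1 \<le> snd (fst x) \<and> snd x \<in> C" ..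
      qed
      have fsT: "flag_sum True cs = n - p ^ R + (if R = 0 then 1 else 0)"
        and fsF: "flag_sum False cs = p ^ R - 1 + (if R = 0 then 0 else 1)"
        using fs0 by (simp_all add: cs_def seq_def)
      show "0 + flag_sum True (map fst Lr) + (0 + flag_sum False (map fst Lr)) = n"
      proof -
        have "1 \<le> p ^ R" using p by simp
        then show ?thesis using pRn unfolding fstLr fsT fsF by (cases "R = 0") auto
      qed
      have "R > 0 \<Longrightarrow> p ^ R < n"
      proof -
        assume "R > 0"
        have "p ^ R * 2 \<le> p ^ R * p" using p by simp
        also have "\<dots> \<le> p ^ f" using R p by (metis Suc_leI power_Suc2 power_increasing le_trans one_le_numeral)
        finally have "p ^ R * 2 \<le> Suc n" by (simp add: n_Suc)
        moreover have "p ^ R \<ge> p ^ 1" using \<open>R > 0\<close> p by (intro power_increasing) auto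
        ultimately show ?thesis using p by simp
      qed
      then show "0 + flag_sum False (map fst Lr) = 0 \<or> 0 < 0 + flag_sum True (map fst Lr)"
        unfolding fstLr fsT fsF by auto
    next
      fix pre b c post d e
      assume "map fst Lr = pre @ (b, c) # post" "d \<in> {1..n}" "e \<in> {1..n}" "(d + e) mod n = c mod n"
      then show "H t g (bw (0 + flag_sum True pre) @ bw (0 + flag_sum False pre) @ d # e # map snd post @ map fst Vl)"
        using corr by (simp add: fstLr fstVl)
    qed auto
    then have "kills (frob t) C g L'" unfolding LrVl by (simp add: bin_def)
    then show "kills (frob t) C g L" using kills_mset_cong[OF L'(1)] by blast
  qed
qed

section \<open>Induction over admissible lists of weights\<close>

definition admissible :: "nat \<Rightarrow> nat \<Rightarrow> nat list \<Rightarrow> bool" where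
  "admissible a R us \<longleftrightarrow> set us \<subseteq> {1..n} \<and> n dvd sum_list us \<and> (\<forall>l<f. n * a \<le> S l us) \<and>
     (\<forall>l. 1 \<le> l \<longrightarrow> l \<le> R \<longrightarrow> n * (a + 1) \<le> S l us)"

text \<open>As p is a unit modulo n, divisibility of the total passes to every \<open>S l\<close>.
  By \<open>ge_next\<close>, a bound not attained then improves by a full n.\<close>

lemma dvd_S:
  assumes "l \<le> f" "n dvd sum_list us"
  shows "n dvd S l us"
proof -
  have "n dvd p ^ l * S l us" using assms by (simp add: S_Lam)
  then show ?thesis using coprime_pow_n[of l] by (metis coprime_commute coprime_dvd_mult_right_iff)
qed

lemma ge_next:
  assumes "n dvd x" "n * a \<le> x" "x \<noteq> n * a"
  shows "n * (a + 1) \<le> x"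
proof -
  obtain k where k: "x = n * k" using assms(1) by (auto elim: dvdE)
  then have "a < k" using assms(2,3) n_pos by auto
  then show ?thesis unfolding k by (intro mult_le_mono2) simp
qed

lemma S_map_rot:
  assumes "set us \<subseteq> {1..n}" "l < f"
  shows "S l (map rot us) = S (if l = 0 then f - 1 else l - 1) us"
proof (cases "l = 0")
  case True
  then show ?thesis by (simp add: S_rot_0)
next
  case False
  then show ?thesis using S_rot[of l us] assms by (auto simp: subset_iff)
qed

lemma n_dvd_sum_rot:
  assumes "set us \<subseteq> {1..n}" "n dvd sum_list us"
  shows "n dvd sum_list (map rot us)"
  using dvd_S[of "f - 1" us] assms by (simp add: S_rot_0)

lemma rr_n:
  assumes "l \<le> f" shows "rr l n = n"
proof -
  have "n dvd S l [n]" by (rule dvd_S[OF assms]) simp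
  then show ?thesis using rr_range[OF assms, of n] n_pos by (auto dest: dvd_imp_le)
qed

text \<open>The first place where x and y differ is at most i, and there the hypotheses make x
  smaller.\<close>

lemma lex_less_thanI:
  assumes "i < k" "\<And>l. l < i \<Longrightarrow> x l \<le> y l" "x i < (y i :: nat)"
  shows "(map x [0..<k], map y [0..<k]) \<in> lex less_than"
proof -
  define j where "j = (LEAST j. x j \<noteq> y j)"
  have "x j \<noteq> y j" unfolding j_def by (rule LeastI[of _ i]) (use assms(3) in simp)
  have ji: "j \<le> i" unfolding j_def by (rule Least_le) (use assms(3) in simp)
  have eq: "x l = y l" if "l < j" for l using not_less_Least that unfolding j_def by blast
  have xy: "x j < y j" using ji assms(2)[of j] assms(3) \<open>x j \<noteq> y j\<close> by (cases "j = i") auto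
  have "[0..<k] = [0..<j] @ j # [Suc j..<k]"
    using ji assms(1) by (metis le_less_trans less_imp_le upt_add_eq_append[of 0 j "k - j"] add_0 le_add_diff_inverse upt_conv_Cons zero_le)
  then show ?thesis
    using xy eq unfolding lex_conv
    by (auto intro!: exI[of _ "map x [0..<j]"])
qed

text \<open>Induction on the smallest \<open>S l / n\<close>, then on the length \<open>R\<close> of a window of larger ones, then
  lexicographically on \<open>S\<close>, all increasing. If \<open>S 0\<close> is not minimal, then a rotation lengthens the window.\<close>

lemma admissible_H:
  assumes M: "M \<subseteq> C" "0 \<in> M" and line: "\<And>t x. x \<in> M \<Longrightarrow> kills (frob t) C g [(n, x)]"
    and ext: "\<And>x1 x2. good2 M x1 x2 \<Longrightarrow> vec.span {y. good3 M x1 x2 y} = C"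
  shows "1 \<le> a \<Longrightarrow> admissible a 0 us \<Longrightarrow> H t g us"
proof (induction "CARD('n) * n + 1 - a" arbitrary: a t us rule: less_induct)
  case (less a)
  define N where "N = CARD('n) * n"
  have short: "H t g us" if "set us \<subseteq> {1..n}" "length us > N" for t us
    using that H_nilpotent[of us t g] by (simp add: N_def)
  \<comment> \<open>\<open>S 0\<close> is at most n times the length, so level a + 1 needs length at
    least a + 1, while products longer than N vanish. Hence a is bounded and the outer induction
    ends.\<close>
  have next_a: "H t g us" if "admissible (a + 1) 0 us" for t us
  proof (cases "length us > N")
    case False
    have "n * (a + 1) \<le> S 0 us" using that f by (auto simp: admissible_def)
    also have "\<dots> \<le> n * length us" by (rule S_le) (use that in \<open>auto simp: admissible_def\<close>)
    finally have "a + 1 \<le> length us" using n_pos nat_mult_le_cancel1[of n "a + 1" "length us"] by linarith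
    then have "a + 1 \<le> N" using False by simp
    then show ?thesis using less.hyps[of "a + 1" us t] that by (simp add: N_def)
  next
    case True
    then show ?thesis using that short by (simp add: admissible_def)
  qed
  have inner: "H t g us"
    if R: "R < f" and next_R: "\<And>t us. R + 1 < f \<Longrightarrow> admissible a (R + 1) us \<Longrightarrow> H t g us"
      and adm: "admissible a R us" for R t us
    using adm
  proof (induction us rule: wf_induct_rule[OF wf_inv_image[OF wf_lex[OF wf_less_than],
        of "\<lambda>us. map (\<lambda>l. n * N - S l us) [0..<f]"]])
    case (1 us)
    have us: "set us \<subseteq> {1..n}" "n dvd sum_list us" "\<forall>l<f. n * a \<le> S l us"
      "\<forall>l. 1 \<le> l \<longrightarrow> l \<le> R \<longrightarrow> n * (a + 1) \<le> S l us"
      using 1(2) by (auto simp: admissible_def)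
    show ?case
    proof (cases "S 0 us = n * a")
      case True
      obtain ts where ts: "set ts \<subseteq> {..<f}" "\<forall>l\<le>f. S l (map (\<lambda>i. p ^ i) ts) = S l us"
        "\<forall>ws. H t g (map (\<lambda>i. p ^ i) ts @ ws) \<longrightarrow> H t g (us @ ws)"
        using H_coins[OF us(1)] by blast
      have "H t g (map (\<lambda>i. p ^ i) ts)"
      proof (rule step[where M = M and three = True and R = R and a = a])
        show "sum_list (map (\<lambda>i. p ^ i) ts) = n * a"
          using ts(2)[rule_format, of 0] True by simp
        fix vs
        assume vs: "set vs \<subseteq> {1..n}" "n dvd sum_list vs" "\<forall>l<f. n * a \<le> S l vs"
          "\<forall>l. 1 \<le> l \<longrightarrow> l \<le> R \<longrightarrow> n * (a + 1) \<le> S l vs"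
          "\<exists>i<f. S i (map (\<lambda>i. p ^ i) ts) < S i vs \<and> (\<forall>l\<le>i. S l (map (\<lambda>i. p ^ i) ts) \<le> S l vs)"
        have adm_vs: "admissible a R vs" using vs by (simp add: admissible_def)
        obtain i where i: "i < f" "S i us < S i vs" "\<forall>l\<le>i. S l us \<le> S l vs"
          using vs(5) ts(2) by auto
        show "H t g vs"
        proof (cases "length vs > N")
          case False
          \<comment> \<open>For short lists \<open>S i vs\<close> is at most n N, so the truncated
            difference in the measure strictly decreases.\<close>
          have "S i vs \<le> n * length vs" by (rule S_le) (use vs i in auto)
          also have "\<dots> \<le> n * N" using False by simp
          finally have "n * N - S i vs < n * N - S i us" using i by simp
          then have "(vs, us) \<in> inv_image (lex less_than) (\<lambda>us. map (\<lambda>l. n * N - S l us) [0..<f])"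
            unfolding in_inv_image
            by (intro lex_less_thanI[OF i(1)]) (use i(3) in \<open>auto intro: diff_le_mono2\<close>)
          then show ?thesis using 1(1) adm_vs by blast
        qed (use short vs(1) in blast)
      qed (use M line ext ts us R less.prems in auto)
      then show ?thesis using ts(3)[rule_format, of "[]"] by simp
    next
      case False
      have S0: "n * (a + 1) \<le> S 0 us"
        by (rule ge_next) (use us f False in auto)
      show ?thesis
      proof (cases "R + 1 < f")
        case True
        \<comment> \<open>Rotation moves \<open>S 0\<close>, ..., \<open>S R\<close> to places 1,
          ..., R + 1; since \<open>S 0\<close> is not minimal, the window grows by one.\<close>
        have "admissible a (R + 1) (map rot us)"
          unfolding admissible_def
        proof (intro conjI allI impI)
          show "set (map rot us) \<subseteq> {1..n}" using us(1) rot_range by fastforce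
          show "n dvd sum_list (map rot us)" using n_dvd_sum_rot us by blast
          show "n * a \<le> S l (map rot us)" if "l < f" for l
            unfolding S_map_rot[OF us(1) that] using us(3) that f by auto
          show "n * (a + 1) \<le> S l (map rot us)" if l: "1 \<le> l" "l \<le> R + 1" for l
          proof -
            have "S l (map rot us) = S (l - 1) us" using S_map_rot[OF us(1), of l] l True by simp
            then show ?thesis using S0 us(4)[rule_format, of "l - 1"] l by (cases "l = 1") auto
          qed
        qed
        then show ?thesis using next_R[OF True] H_rot[OF us(1)] by blast
      next
        case False
        \<comment> \<open>Now place 0 and the window cover all f rotations, so the minimum itself
          has risen.\<close>
        have "admissible (a + 1) 0 us"
          unfolding admissible_def
        proof (intro conjI allI impI)
          show "n * (a + 1) \<le> S l us" if "l < f" for l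
            using S0 us(4)[rule_format, of l] that False by (cases "l = 0") auto
        qed (use us in auto)
        then show ?thesis by (rule next_a)
      qed
    qed
  qed
  have "\<forall>t us. admissible a R us \<longrightarrow> H t g us" if "R < f" for R
    using that
  proof (induction "f - R" arbitrary: R rule: less_induct)
    case outer: less
    show ?case
    proof (intro allI impI)
      fix t us assume adm: "admissible a R us"
      show "H t g us"
      proof (rule inner[OF outer.prems _ adm])
        fix t us assume "R + 1 < f" "admissible a (R + 1) us"
        then show "H t g us" using outer.hyps[of "R + 1"] by simp
      qed
    qed
  qed
  moreover have "0 < f" using f by simp
  ultimately show ?case using less.prems(2) by blast
qed

text \<open>The weight n is fixed by every rotation, so the list \<open>[n]\<close> is admissible at
  level 1.\<close>

lemma kills_all_lines:
  assumes M: "M \<subseteq> C" "0 \<in> M" and line: "\<And>t x. x \<in> M \<Longrightarrow> kills (frob t) C g [(n, x)]"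
    and ext: "\<And>x1 x2. good2 M x1 x2 \<Longrightarrow> vec.span {y. good3 M x1 x2 y} = C"
    and z: "z \<in> C"
  shows "kills (frob 0) C g [(n, z)]"
proof -
  have "admissible 1 0 [n]"
    using n_pos f by (auto simp: admissible_def rr_n)
  then have "H 0 g [n]"
    using admissible_H[OF M line ext] by blast
  then show ?thesis using z by (simp add: H_def)
qed

section \<open>Sums of (q - 1)-st powers of coordinates\<close>

lemma dop_coordinate_power:
  assumes \<sigma>: "field_aut (\<sigma> :: 'a \<Rightarrow> 'a)" and u: "1 \<le> u" "u \<le> n" and d: "d \<le> n"
  shows "\<exists>\<kappa>. \<forall>y. dop \<sigma> u z (\<lambda>y. \<sigma> (y $ i) ^ d) y = (if u \<le> d then \<kappa> * \<sigma> (y $ i) ^ (d - u) else 0)"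
proof -
  have "dop \<sigma> u z (\<lambda>y. \<sigma> (y $ i) ^ d) y
      = (if u \<le> d then (- (of_nat (d choose u) * \<sigma> (z $ i) ^ u)) * \<sigma> (y $ i) ^ (d - u) else 0)" for y
  proof -
    have "dop \<sigma> u z (\<lambda>y. \<sigma> (y $ i) ^ d) y
       = (\<Sum>s\<in>UNIV. \<Sum>k\<le>d. of_nat (d choose k) * \<sigma> (z $ i) ^ k * \<sigma> (y $ i) ^ (d - k) * \<sigma> s ^ (n - u + k))"
    proof -
      have "\<sigma> ((y + s *s z) $ i) ^ d = (\<sigma> s * \<sigma> (z $ i) + \<sigma> (y $ i)) ^ d" for s
        using \<sigma> by (simp add: field_aut_def add.commute)
      then show ?thesis
        by (simp add: dop_def n_card binomial_ring sum_distrib_left power_add power_mult_distrib mult_ac)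
    qed
    also have "\<dots> = (\<Sum>k\<le>d. of_nat (d choose k) * \<sigma> (z $ i) ^ k * \<sigma> (y $ i) ^ (d - k) * (\<Sum>s\<in>UNIV. \<sigma> s ^ (n - u + k)))"
      by (subst sum.swap) (simp add: sum_distrib_left)
    also have "\<dots> = (\<Sum>k\<le>d. if k = u then - (of_nat (d choose u) * \<sigma> (z $ i) ^ u * \<sigma> (y $ i) ^ (d - u)) else 0)"
    proof (rule sum.cong[OF refl])
      fix k assume k: "k \<in> {..d}"
      have "(n - u + k > 0 \<and> n dvd (n - u + k)) \<longleftrightarrow> k = u"
      proof
        assume *: "n - u + k > 0 \<and> n dvd (n - u + k)"
        then obtain m where m: "n - u + k = n * m" by (auto elim: dvdE)
        have "m < 2"
        proof (rule ccontr)
          assume "\<not> m < 2"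
          then have "n * m \<ge> n * 2" by simp
          moreover have "k \<le> d" using k by simp
          ultimately show False using m d u by linarith
        qed
        then have "m = 1" using m * by (cases m) auto
        then show "k = u" using m u by simp
      qed (use u in auto)
      then show "of_nat (d choose k) * \<sigma> (z $ i) ^ k * \<sigma> (y $ i) ^ (d - k) * (\<Sum>s\<in>UNIV. \<sigma> s ^ (n - u + k))
        = (if k = u then - (of_nat (d choose u) * \<sigma> (z $ i) ^ u * \<sigma> (y $ i) ^ (d - u)) else 0)"
        by (auto simp: sum_field_aut_power[OF \<sigma>] n_card)
    qed
    also have "\<dots> = (if u \<le> d then - (of_nat (d choose u) * \<sigma> (z $ i) ^ u * \<sigma> (y $ i) ^ (d - u)) else 0)"
      by simp
    finally show ?thesis by simp
  qed
  then show ?thesis by blast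
qed

lemma dops_coordinate_power:
  assumes \<sigma>: "field_aut (\<sigma> :: 'a \<Rightarrow> 'a)" and L: "set (map fst L) \<subseteq> {1..n}"
  shows "\<exists>\<kappa>. \<forall>y. dops \<sigma> L (\<lambda>y. \<sigma> (y $ i) ^ n) y
     = (if sum_list (map fst L) \<le> n then \<kappa> * \<sigma> (y $ i) ^ (n - sum_list (map fst L)) else 0)"
  using L
proof (induction L)
  case Nil
  then show ?case by (intro exI[of _ 1]) simp
next
  case (Cons uz L)
  obtain u z where uz: "uz = (u, z)" by force
  obtain \<kappa> where \<kappa>: "\<And>y. dops \<sigma> L (\<lambda>y. \<sigma> (y $ i) ^ n) y
     = (if sum_list (map fst L) \<le> n then \<kappa> * \<sigma> (y $ i) ^ (n - sum_list (map fst L)) else 0)"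
    using Cons by auto
  show ?case
  proof (cases "sum_list (map fst L) \<le> n")
    case False
    then have "dops \<sigma> L (\<lambda>y. \<sigma> (y $ i) ^ n) = (\<lambda>_. 0)" using \<kappa> by (simp add: fun_eq_iff)
    then show ?thesis using False by (intro exI[of _ 0]) (simp add: uz dops_Cons dop_def)
  next
    case True
    define d where "d = n - sum_list (map fst L)"
    have "dops \<sigma> L (\<lambda>y. \<sigma> (y $ i) ^ n) = (\<lambda>y. \<kappa> * \<sigma> (y $ i) ^ d)"
      using \<kappa> True by (simp add: fun_eq_iff d_def)
    moreover obtain \<kappa>' where "\<And>y. dop \<sigma> u z (\<lambda>y. \<sigma> (y $ i) ^ d) y = (if u \<le> d then \<kappa>' * \<sigma> (y $ i) ^ (d - u) else 0)"
      using dop_coordinate_power[OF \<sigma>, of u d z i] Cons.prems uz by (auto simp: d_def)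
    ultimately show ?thesis
      using True by (intro exI[of _ "\<kappa> * \<kappa>'"]) (auto simp: uz dops_Cons dop_const_mult d_def add.commute)
  qed
qed

lemma dops_sum: "dops \<sigma> L (\<lambda>y. \<Sum>i\<in>I. h i y) y = (\<Sum>i\<in>I. dops \<sigma> L (h i) y)"
proof (induction L arbitrary: y)
  case (Cons uz L)
  obtain u z where uz: "uz = (u, z)" by force
  have "dops \<sigma> L (\<lambda>y. \<Sum>i\<in>I. h i y) = (\<lambda>y. \<Sum>i\<in>I. dops \<sigma> L (h i) y)" using Cons by (simp add: fun_eq_iff)
  then show ?case
    by (simp add: uz dops_Cons dop_def sum_distrib_left) (rule sum.swap)
qed simp

text \<open>Rotations carry place l to place 0; Frobenius fixes n-th powers, so the twist does not
  matter. There the total weight exceeds the degree n, and each operator lowers the degree by its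
  weight.\<close>

lemma H_sum_powers:
  assumes "l < f" "set us \<subseteq> {1..n}" "n < S l us"
  shows "H t (\<lambda>y. \<Sum>i\<in>I. (y $ i) ^ n) us"
  using assms
proof (induction "if l = 0 then 0 else f - l" arbitrary: l us t rule: less_induct)
  case (less l)
  show ?case
  proof (cases "l = 0")
    case True
    have fr: "frob t x ^ n = x ^ n" for x
      unfolding frob_def power_mult[symmetric]
      by (rule power_eq_power_if_cong) (use n_card p in auto)
    show ?thesis
      unfolding H_def kills_def
    proof (intro allI impI ballI)
      fix L :: "(nat \<times> ('a ^ 'n)) list" and y
      assume L: "mset (map fst L) = mset us"
      have "set (map fst L) \<subseteq> {1..n}" using L less.prems by (metis set_mset_mset)
      moreover have "sum_list (map fst L) = sum_list us" using L by (metis sum_mset_sum_list)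
      then have "\<not> sum_list (map fst L) \<le> n" using less.prems True by simp
      ultimately have "dops (frob t) L (\<lambda>y. frob t (y $ i) ^ n) y = 0" for i
        using dops_coordinate_power[OF frob_aut, of L t i] by auto
      then have "dops (frob t) L (\<lambda>y. (y $ i) ^ n) y = 0" for i
        unfolding fr by blast
      then show "dops (frob t) L (\<lambda>y. \<Sum>i\<in>I. (y $ i) ^ n) y = 0"
        unfolding dops_sum by simp
    qed
  next
    case False
    define l' where "l' = (if l + 1 = f then 0 else l + 1)"
    have l': "l' < f" using less.prems f by (auto simp: l'_def)
    have "S l' (map rot us) = S l us"
      using S_map_rot[OF less.prems(2) l'] less.prems(1) False f by (auto simp: l'_def split: if_splits)
    moreover have "set (map rot us) \<subseteq> {1..n}" using less.prems(2) rot_range by fastforce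
    ultimately have "H (t + (f - 1)) (\<lambda>y. \<Sum>i\<in>I. (y $ i) ^ n) (map rot us)"
      using less.prems False l' by (intro less.hyps[of l']) (auto simp: l'_def)
    then show ?thesis by (rule H_rot[OF less.prems(2)])
  qed
qed

text \<open>Every error in \<open>step\<close> has some \<open>S i\<close> above n and vanishes by
  \<open>H_sum_powers\<close>. A single factor is used, so extensions of one vector suffice.\<close>

lemma kills_all_lines_sum_powers:
  assumes M: "M \<subseteq> C" "0 \<in> M"
    and line: "\<And>t x. x \<in> M \<Longrightarrow> kills (frob t) C (\<lambda>y. \<Sum>i\<in>I. (y $ i) ^ n) [(n, x)]"
    and ext: "\<And>x. good2 M x 0 \<Longrightarrow> vec.span {y. good3 M x 0 y} = C"
    and z: "z \<in> C"
  shows "kills (frob 0) C (\<lambda>y. \<Sum>i\<in>I. (y $ i) ^ n) [(n, z)]"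
proof -
  let ?g = "\<lambda>y :: 'a ^ 'n. \<Sum>i\<in>I. (y $ i) ^ n"
  obtain ts where ts: "set ts \<subseteq> {..<f}" "\<forall>l\<le>f. S l (map (\<lambda>i. p ^ i) ts) = S l [n]"
    "\<forall>ws. H 0 ?g (map (\<lambda>i. p ^ i) ts @ ws) \<longrightarrow> H 0 ?g ([n] @ ws)"
    using H_coins[of "[n]" 0 ?g] n_pos by auto
  have "H 0 ?g (map (\<lambda>i. p ^ i) ts)"
  proof (rule step[where M = M and three = False and R = 0 and a = 1])
    show "sum_list (map (\<lambda>i. p ^ i) ts) = n * 1" using ts(2)[rule_format, of 0] by simp
    fix vs
    assume "set vs \<subseteq> {1..n}"
      "\<exists>i<f. S i (map (\<lambda>i. p ^ i) ts) < S i vs \<and> (\<forall>l\<le>i. S l (map (\<lambda>i. p ^ i) ts) \<le> S l vs)"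
    then show "H 0 ?g vs" using H_sum_powers ts(2) by (auto simp: rr_n)
  qed (use M line ext ts f in \<open>auto simp: rr_n\<close>)
  then have "H 0 ?g [n]" using ts(3)[rule_format, of "[]"] by simp
  then show ?thesis using z by (simp add: H_def)
qed

end

section \<open>Residual codes and maximal subspaces\<close>

definition weight_on :: "'n set \<Rightarrow> 'a::zero ^ 'n::finite \<Rightarrow> nat" where
  "weight_on I c = card {i \<in> I. c $ i \<noteq> 0}"

lemma weight_on_UNIV: "weight_on UNIV = hamming_weight"
  by (simp add: weight_on_def hamming_weight_def fun_eq_iff)

lemma weight_on_eq_sum: "weight_on I c = (\<Sum>i\<in>I. if c $ i \<noteq> 0 then 1 else 0)"
  unfolding weight_on_def by (simp add: sum.If_cases Int_def)

lemma weight_on_scale: "a \<noteq> 0 \<Longrightarrow> weight_on I (a *s c) = weight_on I (c :: 'a::field ^ 'n::finite)"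
  by (simp add: weight_on_def)

lemma weight_on_add_vanishing:
  "\<forall>i\<in>I. x $ i = 0 \<Longrightarrow> weight_on I (x + c) = weight_on I (c :: 'a::field ^ 'n::finite)"
  unfolding weight_on_def by (intro arg_cong[where f = card]) auto

text \<open>At a coordinate where x is nonzero, the line takes every field value once and is nonzero
  q - 1 times; where x is zero, the value of y is repeated q times.\<close>

lemma sum_weight_on_line:
  fixes x y :: "'a::{field,finite} ^ 'n::finite"
  shows "(\<Sum>a\<in>UNIV. weight_on I (y + a *s x))
     = (CARD('a) - 1) * weight_on I x + CARD('a) * weight_on {i \<in> I. x $ i = 0} y"
proof -
  have pt: "(\<Sum>a\<in>UNIV. if (y + a *s x) $ i \<noteq> 0 then 1 else 0 :: nat)
     = (if x $ i \<noteq> 0 then CARD('a) - 1 else 0) + (if x $ i = 0 \<and> y $ i \<noteq> 0 then CARD('a) else 0)" for i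
  proof (cases "x $ i = 0")
    case False
    have "(\<Sum>a\<in>UNIV. if (y + a *s x) $ i \<noteq> 0 then 1 else 0 :: nat) = card {a. (y + a *s x) $ i \<noteq> 0}"
      by (simp add: sum.If_cases)
    also have "{a. (y + a *s x) $ i \<noteq> 0} = UNIV - {- y $ i / x $ i}"
      using False by (auto simp: field_simps add_eq_0_iff)
    also have "card \<dots> = CARD('a) - 1" by (simp add: card_Diff_singleton)
    finally show ?thesis using False by simp
  qed simp
  have "(\<Sum>a\<in>UNIV. weight_on I (y + a *s x))
      = (\<Sum>i\<in>I. \<Sum>a\<in>UNIV. if (y + a *s x) $ i \<noteq> 0 then 1 else 0)"
    unfolding weight_on_eq_sum by (rule sum.swap)
  also have "\<dots> = (\<Sum>i\<in>I. if x $ i \<noteq> 0 then CARD('a) - 1 else 0)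
      + (\<Sum>i\<in>I. if x $ i = 0 \<and> y $ i \<noteq> 0 then CARD('a) else 0)"
    by (simp only: pt sum.distrib)
  also have "(\<Sum>i\<in>I. if x $ i \<noteq> 0 then CARD('a) - 1 else 0) = (CARD('a) - 1) * weight_on I x"
    by (simp add: weight_on_def sum.If_cases Int_def)
  also have "(\<Sum>i\<in>I. if x $ i = 0 \<and> y $ i \<noteq> 0 then CARD('a) else 0) = CARD('a) * weight_on {i \<in> I. x $ i = 0} y"
    by (simp add: weight_on_def sum.If_cases Int_def conj_assoc)
  finally show ?thesis .
qed

lemma card_support_zero:
  fixes x :: "'a::zero ^ 'n::finite"
  shows "card I = weight_on I x + card {i \<in> I. x $ i = 0}"
proof -
  have "I = {i \<in> I. x $ i \<noteq> 0} \<union> {i \<in> I. x $ i = 0}" by auto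
  then show ?thesis unfolding weight_on_def
    by (metis (mono_tags, lifting) card_Un_disjoint disjoint_iff finite mem_Collect_eq)
qed

text \<open>The code is represented by its coordinate functions on \<open>C\<close> indexed by \<open>I\<close>; these only
  see the quotient of \<open>C\<close> by a subspace \<open>K\<close>, of dimension \<open>k\<close>. Residual codes then
  live on the same space \<open>C\<close>.\<close>

definition code_mod :: "('a::{field,finite} ^ 'n::finite) set \<Rightarrow> ('a ^ 'n) set \<Rightarrow> 'n set \<Rightarrow> nat \<Rightarrow> nat \<Rightarrow> bool" where
  "code_mod C K I k \<delta> \<longleftrightarrow> vec.subspace C \<and> vec.subspace K \<and> K \<subseteq> C \<and> (\<forall>x\<in>K. \<forall>i\<in>I. x $ i = 0) \<and>
     (\<forall>i\<in>I. \<exists>c\<in>C. c $ i \<noteq> 0) \<and> vec.dim C = vec.dim K + k \<and> (\<forall>c\<in>C. weight_on I c \<le> \<delta>)"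

text \<open>This is \<open>anti_griesmer_length\<close> for k at least 1; including the term i = 0
  makes passing to a residual code a shift of the sum.\<close>

definition agl :: "nat \<Rightarrow> nat \<Rightarrow> nat \<Rightarrow> nat" where
  "agl q k \<delta> = (\<Sum>i<k. \<delta> div q ^ i)"

lemma agl_Suc: "agl q (Suc k) \<delta> = \<delta> + agl q k (\<delta> div q)"
  unfolding agl_def by (subst sum.lessThan_Suc_shift) (simp add: div_mult2_eq)

lemma agl_mono: "\<delta> \<le> \<delta>' \<Longrightarrow> agl q k \<delta> \<le> agl q k \<delta>'"
  unfolding agl_def by (intro sum_mono div_le_mono)

lemma code_mod_0:
  assumes "code_mod C K I 0 \<delta>"
  shows "K = C" "I = {}"
proof -
  show "K = C" using assms vec.subspace_dim_equal[of K C] by (auto simp: code_mod_def)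
  then show "I = {}" using assms by (fastforce simp: code_mod_def)
qed

lemma span_insert_subspace:
  assumes "vec.subspace K"
  shows "vec.span (insert x K) = {v. \<exists>a. v - a *s x \<in> K}"
proof -
  have "vec.span K = K" using assms by (simp only: vec.span_eq_iff)
  then show ?thesis using vec.span_insert[of x K] by (simp only:)
qed

text \<open>The q words of the line weigh at most q times the maximum; the residual weight, taken q
  times, is what the share of x leaves over.\<close>

lemma residual_weight_le:
  fixes x :: "'a::{field,finite} ^ 'n::finite"
  assumes C: "vec.subspace C" and w: "\<forall>c\<in>C. weight_on I c \<le> weight_on I x" and xy: "x \<in> C" "y \<in> C"
  shows "weight_on {i \<in> I. x $ i = 0} y \<le> weight_on I x div CARD('a)"
proof -
  have "(\<Sum>a\<in>UNIV. weight_on I (y + a *s x)) \<le> (\<Sum>a\<in>(UNIV :: 'a set). weight_on I x)"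
    using C w xy by (intro sum_mono) (simp add: vec.subspace_add vec.subspace_scale)
  then have "(CARD('a) - 1) * weight_on I x + CARD('a) * weight_on {i \<in> I. x $ i = 0} y
      \<le> (CARD('a) - 1) * weight_on I x + weight_on I x"
    unfolding sum_weight_on_line by (cases "CARD('a)") auto
  then show ?thesis by (simp add: less_eq_div_iff_mult_less_eq mult.commute)
qed

lemma code_mod_residual:
  fixes x :: "'a::{field,finite} ^ 'n::finite"
  assumes c: "code_mod C K I (Suc k) \<delta>" and x: "x \<in> C" "weight_on I x > 0"
    and max: "\<forall>c\<in>C. weight_on I c \<le> weight_on I x"
  shows "code_mod C (vec.span (insert x K)) {i \<in> I. x $ i = 0} k (weight_on I x div CARD('a))"
  unfolding code_mod_def
proof (intro conjI)
  have C: "vec.subspace C" and K: "vec.subspace K" and KC: "K \<subseteq> C" using c by (auto simp: code_mod_def)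
  show "vec.subspace C" by (rule C)
  show "vec.subspace (vec.span (insert x K))" by (rule vec.subspace_span)
  show "vec.span (insert x K) \<subseteq> C" using x KC C by (intro vec.span_minimal) auto
  have "x \<notin> vec.span K"
  proof
    assume "x \<in> vec.span K"
    then have "x \<in> K" using K vec.span_eq_iff by blast
    then have "weight_on I x = 0" using c by (auto simp: code_mod_def weight_on_def)
    then show False using x by simp
  qed
  then have "vec.dim (vec.span (insert x K)) = vec.dim K + 1"
    by (simp add: vec.dim_insert)
  then show "vec.dim C = vec.dim (vec.span (insert x K)) + k" using c by (simp add: code_mod_def)
  show "\<forall>y\<in>vec.span (insert x K). \<forall>i\<in>{i \<in> I. x $ i = 0}. y $ i = 0"
  proof (intro ballI)
    fix y i assume y: "y \<in> vec.span (insert x K)" and i: "i \<in> {i \<in> I. x $ i = 0}"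
    obtain a where "y - a *s x \<in> K" using y span_insert_subspace[OF K] by auto
    then have "(y - a *s x) $ i = 0" using c i by (auto simp: code_mod_def)
    then show "y $ i = 0" using i by simp
  qed
  show "\<forall>i\<in>{i \<in> I. x $ i = 0}. \<exists>c\<in>C. c $ i \<noteq> 0" using c by (auto simp: code_mod_def)
  show "\<forall>c\<in>C. weight_on {i \<in> I. x $ i = 0} c \<le> weight_on I x div CARD('a)"
    using residual_weight_le[OF C max x(1)] by blast
qed

text \<open>The analogue of the Griesmer bound: the support of a heaviest word is counted by its
  weight, the other coordinates by induction on the residual code.\<close>

lemma card_le_agl:
  "code_mod C K I k \<delta> \<Longrightarrow> card I \<le> agl CARD('a) k \<delta>" for C :: "('a::{field,finite} ^ 'n::finite) set"
proof (induction k arbitrary: K I \<delta>)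
  case 0
  then show ?case using code_mod_0(2) by fastforce
next
  case (Suc k)
  have C: "vec.subspace C" using Suc.prems by (simp add: code_mod_def)
  then have ne: "C \<noteq> {}" using vec.subspace_0 by blast
  have "Max (weight_on I ` C) \<in> weight_on I ` C" by (rule Max_in) (use ne in auto)
  then obtain x where "x \<in> C" "weight_on I x = Max (weight_on I ` C)" by auto
  then have x: "x \<in> C" "\<forall>c\<in>C. weight_on I c \<le> weight_on I x" by simp_all
  have le: "weight_on I x \<le> \<delta>" using Suc.prems x by (simp add: code_mod_def)
  show ?case
  proof (cases "weight_on I x = 0")
    case True
    have "I = {}"
    proof (rule ccontr)
      assume "I \<noteq> {}"
      then obtain i c where "i \<in> I" "c \<in> C" "c $ i \<noteq> 0" using Suc.prems by (fastforce simp: code_mod_def)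
      then have "weight_on I c > 0" by (auto simp: weight_on_def card_gt_0_iff)
      then show False using x(2) \<open>c \<in> C\<close> True by (metis le_zero_eq less_not_refl)
    qed
    then show ?thesis by simp
  next
    case False
    have "card {i \<in> I. x $ i = 0} \<le> agl CARD('a) k (weight_on I x div CARD('a))"
      using code_mod_residual[OF Suc.prems x(1) _ x(2)] False by (intro Suc.IH) auto
    then have "card I \<le> agl CARD('a) (Suc k) (weight_on I x)"
      by (simp add: agl_Suc card_support_zero[of I x])
    then show ?thesis using agl_mono[OF le] le_trans by blast
  qed
qed

definition antigriesmer_mod where
  "antigriesmer_mod C K I k \<delta> \<longleftrightarrow> code_mod C K I k \<delta> \<and> card I = agl CARD('a) k \<delta>"
  for C :: "('a::{field,finite} ^ 'n::finite) set"

text \<open>Otherwise the length bound for \<delta> - 1 would apply, which is strictly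
  smaller.\<close>

lemma antigriesmer_mod_max_attained:
  assumes ag: "antigriesmer_mod C K I (Suc k) \<delta>" and \<delta>: "\<delta> > 0"
  obtains x where "x \<in> C" "weight_on I x = \<delta>"
proof -
  have "\<exists>x\<in>C. weight_on I x = \<delta>"
  proof (rule ccontr)
    assume "\<not> ?thesis"
    then have "code_mod C K I (Suc k) (\<delta> - 1)"
      using ag \<delta> unfolding antigriesmer_mod_def code_mod_def by (metis One_nat_def Suc_pred le_neq_implies_less less_Suc_eq_le)
    then have "card I \<le> agl CARD('a) (Suc k) (\<delta> - 1)" by (rule card_le_agl)
    moreover have "agl CARD('a) (Suc k) (\<delta> - 1) < agl CARD('a) (Suc k) \<delta>"
      using \<delta> agl_mono[of "(\<delta> - 1) div CARD('a)" "\<delta> div CARD('a)" "CARD('a)" k]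
      by (simp add: agl_Suc div_le_mono)
    ultimately show False using ag by (simp add: antigriesmer_mod_def)
  qed
  then show thesis using that by blast
qed

lemma antigriesmer_mod_residual:
  fixes x :: "'a::{field,finite} ^ 'n::finite"
  assumes ag: "antigriesmer_mod C K I (Suc k) \<delta>" and x: "x \<in> C" "weight_on I x = \<delta>" and \<delta>: "\<delta> > 0"
  shows "antigriesmer_mod C (vec.span (insert x K)) {i \<in> I. x $ i = 0} k (\<delta> div CARD('a))"
proof -
  have "\<forall>c\<in>C. weight_on I c \<le> weight_on I x" using ag x by (simp add: antigriesmer_mod_def code_mod_def)
  then have "code_mod C (vec.span (insert x K)) {i \<in> I. x $ i = 0} k (\<delta> div CARD('a))"
    using code_mod_residual[of C K I k \<delta> x] ag x \<delta> by (simp add: antigriesmer_mod_def)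
  moreover have "card {i \<in> I. x $ i = 0} = agl CARD('a) k (\<delta> div CARD('a))"
    using ag card_support_zero[of I x] x by (simp add: antigriesmer_mod_def agl_Suc)
  ultimately show ?thesis by (simp add: antigriesmer_mod_def)
qed

text \<open>By induction the words of maximum residual weight span C together with x and K. Each
  lifts to weight \<delta> by adding a multiple of x: weights at most \<delta> - 1 on the whole line
  would contradict the line sum.\<close>

lemma max_words_span:
  "antigriesmer_mod C K I k \<delta> \<Longrightarrow> vec.span (K \<union> {x \<in> C. weight_on I x = \<delta>}) = C"
  for C :: "('a::{field,finite} ^ 'n::finite) set"
proof (induction k arbitrary: K I \<delta>)
  case 0
  then have "K = C" using code_mod_0 by (auto simp: antigriesmer_mod_def)
  moreover have "vec.subspace C" using 0 by (simp add: antigriesmer_mod_def code_mod_def)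
  ultimately show ?case by (metis (no_types, lifting) Un_absorb2 mem_Collect_eq subsetI vec.span_eq_iff)
next
  case (Suc k)
  let ?M = "{x \<in> C. weight_on I x = \<delta>}"
  have C: "vec.subspace C" and K: "vec.subspace K" and KC: "K \<subseteq> C" and le: "\<And>c. c \<in> C \<Longrightarrow> weight_on I c \<le> \<delta>"
    using Suc.prems by (auto simp: antigriesmer_mod_def code_mod_def)
  have sub: "vec.span (K \<union> ?M) \<subseteq> C" using KC C by (intro vec.span_minimal) auto
  show ?case
  proof (cases "\<delta> = 0")
    case True
    then have "?M = C" using le by fastforce
    then show ?thesis using sub vec.span_superset[of "K \<union> ?M"] by auto
  next
    case False
    then obtain x where x: "x \<in> C" "weight_on I x = \<delta>" using antigriesmer_mod_max_attained[OF Suc.prems] by blast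
    let ?I = "{i \<in> I. x $ i = 0}"
    have IH: "vec.span (vec.span (insert x K) \<union> {y \<in> C. weight_on ?I y = \<delta> div CARD('a)}) = C"
      using antigriesmer_mod_residual[OF Suc.prems x] False by (intro Suc.IH) auto
    have xs: "x \<in> vec.span (K \<union> ?M)" using x by (intro vec.span_base) auto
    have "vec.span (insert x K) \<subseteq> vec.span (K \<union> ?M)"
      using xs by (intro vec.span_minimal vec.subspace_span) (auto intro: vec.span_base)
    moreover have "y \<in> vec.span (K \<union> ?M)" if y: "y \<in> C" "weight_on ?I y = \<delta> div CARD('a)" for y
    proof -
      have "\<exists>a. weight_on I (y + a *s x) = \<delta>"
      proof (rule ccontr)
        assume "\<not> ?thesis"
        then have "weight_on I (y + a *s x) \<le> \<delta> - 1" for a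
          using le[of "y + a *s x"] C x y by (metis One_nat_def Suc_pred False le_neq_implies_less less_Suc_eq_le
              vec.subspace_add vec.subspace_scale neq0_conv)
        then have "(\<Sum>a\<in>UNIV. weight_on I (y + a *s x)) \<le> (\<Sum>a\<in>(UNIV :: 'a set). \<delta> - 1)"
          by (intro sum_mono)
        then have "(CARD('a) - 1) * \<delta> + CARD('a) * (\<delta> div CARD('a)) \<le> CARD('a) * (\<delta> - 1)"
          unfolding sum_weight_on_line x y by simp
        moreover have "CARD('a) * (\<delta> div CARD('a)) + \<delta> mod CARD('a) = \<delta>" by simp
        moreover have "\<delta> mod CARD('a) < CARD('a)" by simp
        moreover have "(CARD('a) - 1) * \<delta> + \<delta> = CARD('a) * \<delta>"
          by (cases "CARD('a)") auto
        moreover have "CARD('a) * (\<delta> - 1) + CARD('a) = CARD('a) * \<delta>" using False by (cases \<delta>) auto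
        ultimately show False by linarith
      qed
      then obtain a where "weight_on I (y + a *s x) = \<delta>" by blast
      then have "y + a *s x \<in> ?M" using C x y by (simp add: vec.subspace_add vec.subspace_scale)
      then have "y + a *s x \<in> vec.span (K \<union> ?M)" by (intro vec.span_base) simp
      then have "(y + a *s x) - a *s x \<in> vec.span (K \<union> ?M)"
        using xs by (intro vec.span_diff vec.span_scale)
      then show ?thesis by simp
    qed
    ultimately have "C \<subseteq> vec.span (K \<union> ?M)"
      by (subst IH[symmetric], intro vec.span_minimal vec.subspace_span) auto
    then show ?thesis using sub by blast
  qed
qed

text \<open>This is the equality case of the averaging over lines.\<close>

lemma max_subspace_extend:
  "antigriesmer_mod C K I k \<delta> \<Longrightarrow> vec.subspace U \<Longrightarrow> K \<subseteq> U \<Longrightarrow> U \<subseteq> C \<Longrightarrow>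
    \<forall>u\<in>U - K. weight_on I u = \<delta> \<Longrightarrow> vec.dim U = vec.dim K + d \<Longrightarrow> CARD('a) ^ d dvd \<delta> \<Longrightarrow>
    vec.span {z \<in> C. \<forall>v\<in>vec.span (insert z U). v \<in> K \<or> weight_on I v = \<delta>} = C"
  for C :: "('a::{field,finite} ^ 'n::finite) set"
proof (induction d arbitrary: K I k \<delta>)
  case 0
  let ?Z = "{z \<in> C. \<forall>v\<in>vec.span (insert z U). v \<in> K \<or> weight_on I v = \<delta>}"
  have C: "vec.subspace C" and K: "vec.subspace K" and KC: "K \<subseteq> C" and K0: "\<forall>x\<in>K. \<forall>i\<in>I. x $ i = 0"
    using 0 by (auto simp: antigriesmer_mod_def code_mod_def)
  have U: "U = K" using 0 K vec.subspace_dim_equal[of K U] by auto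
  have "K \<union> {x \<in> C. weight_on I x = \<delta>} \<subseteq> ?Z"
  proof
    fix z assume z: "z \<in> K \<union> {x \<in> C. weight_on I x = \<delta>}"
    have "v \<in> K \<or> weight_on I v = \<delta>" if v: "v \<in> vec.span (insert z K)" for v
    proof -
      obtain a where a: "v - a *s z \<in> K" using v span_insert_subspace[OF K] by auto
      have v_eq: "v = (v - a *s z) + a *s z" by simp
      show ?thesis
      proof (cases "z \<in> K \<or> a = 0")
        case True
        then have "a *s z \<in> K" using K by (auto simp: vec.subspace_scale vec.subspace_0)
        then show ?thesis using a K v_eq vec.subspace_add by metis
      next
        case False
        then have "weight_on I (a *s z) = \<delta>" using z by (simp add: weight_on_scale)
        then show ?thesis using weight_on_add_vanishing[of I "v - a *s z" "a *s z"] K0 a v_eq by auto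
      qed
    qed
    then show "z \<in> ?Z" using z KC U by auto
  qed
  then have "vec.span (K \<union> {x \<in> C. weight_on I x = \<delta>}) \<subseteq> vec.span ?Z" by (rule vec.span_mono)
  then have "C \<subseteq> vec.span ?Z" using max_words_span[OF 0(1)] by simp
  moreover have "vec.span ?Z \<subseteq> C" using C by (intro vec.span_minimal) auto
  ultimately show ?case by blast
next
  case (Suc d)
  let ?Z = "{z \<in> C. \<forall>v\<in>vec.span (insert z U). v \<in> K \<or> weight_on I v = \<delta>}"
  note ag = Suc.prems(1) and U = Suc.prems(2) and KU = Suc.prems(3) and UC = Suc.prems(4)
  have C: "vec.subspace C" and K: "vec.subspace K" and KC: "K \<subseteq> C" and K0: "\<forall>x\<in>K. \<forall>i\<in>I. x $ i = 0"
    and le: "\<And>c. c \<in> C \<Longrightarrow> weight_on I c \<le> \<delta>"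
    using ag by (auto simp: antigriesmer_mod_def code_mod_def)
  have ZC: "vec.span ?Z \<subseteq> C" using C by (intro vec.span_minimal) auto
  show ?case
  proof (cases "\<delta> = 0")
    case True
    have "vec.span (insert z U) \<subseteq> C" if "z \<in> C" for z using that UC C by (intro vec.span_minimal) auto
    then have "C \<subseteq> ?Z" using True le by fastforce
    then show ?thesis using ZC vec.span_superset by blast
  next
    case False
    have "\<not> U \<subseteq> K"
    proof
      assume "U \<subseteq> K"
      then have "U = K" using KU by blast
      then show False using Suc.prems(6) by simp
    qed
    then obtain x where x: "x \<in> U" "x \<notin> K" by blast
    have xC: "x \<in> C" and wx: "weight_on I x = \<delta>" using x UC Suc.prems(5) by auto
    obtain k' where k: "k = Suc k'"
      using ag x(2) xC code_mod_0(1)[of C K I \<delta>] by (cases k) (auto simp: antigriesmer_mod_def)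
    let ?K = "vec.span (insert x K)" and ?I = "{i \<in> I. x $ i = 0}"
    have ag': "antigriesmer_mod C ?K ?I k' (\<delta> div CARD('a))"
      using antigriesmer_mod_residual[OF ag[unfolded k] xC wx] False by simp
    have dvd: "CARD('a) dvd \<delta>" using Suc.prems(7) by (metis dvd_trans dvd_triv_left power_Suc)
    have line: "(\<Sum>a\<in>UNIV. weight_on I (v + a *s x)) = (CARD('a) - 1) * \<delta> + CARD('a) * weight_on ?I v" for v
      unfolding sum_weight_on_line wx ..
    have q1: "(CARD('a) - 1) * \<delta> + \<delta> = CARD('a) * \<delta>" by (cases "CARD('a)") auto
    have KU': "?K \<subseteq> U" using x KU U by (intro vec.span_minimal) auto
    have w': "weight_on ?I u = \<delta> div CARD('a)" if u: "u \<in> U - ?K" for u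
    proof -
      have "weight_on I (u + a *s x) = \<delta>" for a
      proof -
        have "u + a *s x \<in> U" using u x U by (simp add: vec.subspace_add vec.subspace_scale)
        moreover have "u + a *s x \<notin> K"
          using u span_insert_subspace[OF K, of x] by (auto dest!: spec[of _ "- a"])
        ultimately show ?thesis using Suc.prems(5) by blast
      qed
      then have "CARD('a) * \<delta> = (CARD('a) - 1) * \<delta> + CARD('a) * weight_on ?I u"
        using line[of u] by simp
      then have "CARD('a) * weight_on ?I u = \<delta>" using q1 by linarith
      then show ?thesis by (metis nonzero_mult_div_cancel_left zero_less_card_finite less_not_refl)
    qed
    have "x \<notin> vec.span K" using x K vec.span_eq_iff by blast
    then have "vec.dim ?K = vec.dim K + 1" by (simp add: vec.dim_insert)
    then have dimU: "vec.dim U = vec.dim ?K + d" using Suc.prems(6) by simp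
    have "CARD('a) ^ d dvd \<delta> div CARD('a)"
      using Suc.prems(7) dvd by (auto simp: dvd_def)
    then have IH: "vec.span {z \<in> C. \<forall>v\<in>vec.span (insert z U). v \<in> ?K \<or> weight_on ?I v = \<delta> div CARD('a)} = C"
      using Suc.IH[OF ag' U KU' UC _ dimU] w' by blast
    have "{z \<in> C. \<forall>v\<in>vec.span (insert z U). v \<in> ?K \<or> weight_on ?I v = \<delta> div CARD('a)} \<subseteq> ?Z"
    proof clarify
      fix z v assume z: "z \<in> C" "\<forall>v\<in>vec.span (insert z U). v \<in> ?K \<or> weight_on ?I v = \<delta> div CARD('a)"
        and v: "v \<in> vec.span (insert z U)" and ne: "weight_on I v \<noteq> \<delta>"
      show "v \<in> K"
      proof (rule ccontr)
        assume vK: "v \<notin> K"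
        have "vec.span (insert z U) \<subseteq> C" using z UC C by (intro vec.span_minimal) auto
        then have vC: "v \<in> C" using v by blast
        have "v \<notin> ?K"
        proof
          assume "v \<in> ?K"
          then have "v \<in> U - K" using KU' vK by (meson DiffI subsetD)
          then show False using Suc.prems(5) ne by simp
        qed
        then have "weight_on ?I v = \<delta> div CARD('a)"
          using bspec[OF z(2) v] by simp
        \<comment> \<open>The line sum attains q \<delta> while each of its q terms is at most
          \<delta>, so none can be smaller.\<close>
        then have "(\<Sum>a\<in>UNIV. weight_on I (v + a *s x)) = CARD('a) * \<delta>"
          unfolding line using dvd q1 by simp
        moreover have "(\<Sum>a\<in>UNIV. weight_on I (v + a *s x)) < (\<Sum>a\<in>(UNIV :: 'a set). \<delta>)"
        proof (rule sum_strict_mono_ex1)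
          show "\<forall>a\<in>UNIV. weight_on I (v + a *s x) \<le> \<delta>"
            using le C xC vC by (simp add: vec.subspace_add vec.subspace_scale)
          show "\<exists>a\<in>UNIV. weight_on I (v + a *s x) < \<delta>"
            using ne le[OF vC] by (intro bexI[of _ 0]) auto
        qed simp
        ultimately show False by simp
      qed
    qed
    from vec.span_mono[OF this] have "C \<subseteq> vec.span ?Z" by (simp only: IH)
    then show ?thesis using ZC by blast
  qed
qed

section \<open>Divisibility\<close>

context weighted_kills
begin

text \<open>K, x and y span a space U of dimension at most d modulo K, whose words outside K have
  weight \<delta>. Then \<open>max_subspace_extend\<close> supplies the further directions. M
  includes K so that zero combinations are allowed.\<close>

lemma extend_good:
  assumes ag: "antigriesmer_mod C K I k \<delta>" and M: "M = {c \<in> C. c \<in> K \<or> weight_on I c = \<delta>}"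
    and good: "good2 M x y" and d: "CARD('a) ^ d dvd \<delta>" "d = 2 \<or> d = 1 \<and> y = 0"
  shows "vec.span {z. good3 M x y z} = C"
proof -
  have K: "vec.subspace K" and KC: "K \<subseteq> C" and K0: "\<forall>x\<in>K. \<forall>i\<in>I. x $ i = 0"
    using ag by (auto simp: antigriesmer_mod_def code_mod_def)
  have comb: "a *s x + b *s y \<in> M" for a b using good by (simp add: good2_def)
  have xy: "x \<in> C" "y \<in> C" using comb[of 1 0] comb[of 0 1] by (auto simp: M)
  define W where "W = vec.span (insert y K)"
  define U where "U = vec.span (insert x W)"
  have W: "vec.subspace W" and U: "vec.subspace U" by (simp_all add: W_def U_def)
  have KW: "K \<subseteq> W" unfolding W_def using vec.span_superset by blast
  have WU: "W \<subseteq> U" unfolding U_def using vec.span_superset by blast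
  have WC: "W \<subseteq> C" unfolding W_def using xy KC subC by (intro vec.span_minimal) auto
  have UC: "U \<subseteq> C" unfolding U_def using xy WC subC by (intro vec.span_minimal) auto
  have yW: "y \<in> W" and xU: "x \<in> U" unfolding W_def U_def by (simp_all add: vec.span_base)
  have wU: "weight_on I u = \<delta>" if u: "u \<in> U - K" for u
  proof -
    obtain a where "u - a *s x \<in> W" using u span_insert_subspace[OF W] by (auto simp: U_def)
    then obtain b where b: "u - a *s x - b *s y \<in> K" using span_insert_subspace[OF K] by (auto simp: W_def)
    have u_eq: "u = (u - a *s x - b *s y) + (a *s x + b *s y)" by simp
    have "a *s x + b *s y \<notin> K" using u b u_eq vec.subspace_add[OF K] by (metis DiffD2)
    then have "weight_on I (a *s x + b *s y) = \<delta>" using comb[of a b] by (auto simp: M)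
    then show ?thesis using weight_on_add_vanishing[of I "u - a *s x - b *s y" "a *s x + b *s y"] K0 b u_eq by metis
  qed
  have dW: "vec.dim W = vec.dim K + (if y \<in> vec.span K then 0 else 1)"
    by (simp add: W_def vec.dim_insert)
  have dU: "vec.dim U = vec.dim W + (if x \<in> vec.span W then 0 else 1)"
    by (simp add: U_def vec.dim_insert)
  define d' where "d' = vec.dim U - vec.dim K"
  have d': "vec.dim U = vec.dim K + d'" "d' \<le> d"
    using dW dU d(2) vec.span_zero[of K] by (auto simp: d'_def)
  have "CARD('a) ^ d' dvd \<delta>" using d(1) d'(2) power_le_dvd by blast
  then have Z: "vec.span {z \<in> C. \<forall>v\<in>vec.span (insert z U). v \<in> K \<or> weight_on I v = \<delta>} = C"
    using max_subspace_extend[OF ag U _ UC _ d'(1)] KW WU wU by blast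
  have "{z \<in> C. \<forall>v\<in>vec.span (insert z U). v \<in> K \<or> weight_on I v = \<delta>} \<subseteq> {z. good3 M x y z}"
  proof
    fix z assume z: "z \<in> {z \<in> C. \<forall>v\<in>vec.span (insert z U). v \<in> K \<or> weight_on I v = \<delta>}"
    have "a *s x + b *s y + c *s z \<in> M" for a b c
    proof -
      have "a *s x + b *s y + c *s z \<in> vec.span (insert z U)"
        using xU yW WU by (intro vec.span_add vec.span_scale vec.span_base) auto
      moreover have "a *s x + b *s y + c *s z \<in> C"
        using xy z subC by (intro vec.subspace_add vec.subspace_scale) auto
      ultimately show ?thesis using z by (simp add: M)
    qed
    then show "z \<in> {z. good3 M x y z}" by (simp add: good3_def)
  qed
  from vec.span_mono[OF this] have "C \<subseteq> vec.span {z. good3 M x y z}" by (simp only: Z)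
  moreover have "vec.span {z. good3 M x y z} \<subseteq> C"
  proof (rule vec.span_minimal[OF _ subC])
    have "z \<in> C" if "good3 M x y z" for z
      using that[unfolded good3_def, rule_format, of 0 0 1] by (simp add: M)
    then show "{z. good3 M x y z} \<subseteq> C" by blast
  qed
  ultimately show ?thesis by blast
qed

lemma kills_line_iff: "kills (frob t) C g [(n, x)] \<longleftrightarrow> (\<forall>y\<in>C. (\<Sum>s\<in>UNIV. g (y + s *s x)) = 0)"
  by (simp add: kills_def dops_Cons dop_def n_card)

lemma of_nat_eq_0_iff_dvd: "(of_nat m :: 'a) = 0 \<longleftrightarrow> p dvd m"
  using CHAR_finite_field[OF prime_p card_a] by (metis of_nat_eq_0_iff_char_dvd)

lemma weight_on_0 [simp]: "weight_on I 0 = 0"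
  by (simp add: weight_on_def)

text \<open>On the line through 0 the q - 1 nonzero multiples of z have equal weight and 0
  contributes nothing, so the sum is \<open>- g z\<close>.\<close>

lemma dvd_weight_if_line_sum:
  assumes g: "\<And>y. g y = (of_nat (weight_on I y div m) :: 'a)"
    and k: "kills (frob 0) C g [(n, z)]"
  shows "p dvd weight_on I z div m"
proof -
  have "(\<Sum>s\<in>UNIV. g (0 + s *s z)) = 0" using k subC vec.subspace_0 unfolding kills_line_iff by blast
  also have "(\<Sum>s\<in>UNIV. g (0 + s *s z)) = (\<Sum>s\<in>UNIV - {0}. g (0 + s *s z))"
    by (rule sum.mono_neutral_right) (auto simp: g)
  also have "\<dots> = (\<Sum>s\<in>UNIV - {0 :: 'a}. g z)"
    by (rule sum.cong) (auto simp: g weight_on_scale)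
  also have "\<dots> = - g z"
    using of_nat_CARD_field[where 'a='a] by (simp add: card_Diff_singleton of_nat_diff)
  finally show ?thesis by (simp add: g of_nat_eq_0_iff_dvd)
qed

text \<open>If \<open>p ^ j\<close> divides all weights, the quotient modulo p has vanishing line
  sums in the directions of M, and \<open>kills_all_lines\<close> extends this to all
  directions.\<close>

lemma raise_divisibility:
  assumes ag: "antigriesmer_mod C K I k \<delta>" and q2: "CARD('a) ^ 2 dvd \<delta>"
    and line: "\<And>x y. x \<in> C \<Longrightarrow> weight_on I x = \<delta> \<Longrightarrow> y \<in> C \<Longrightarrow> p ^ J dvd (\<Sum>a\<in>UNIV. weight_on I (y + a *s x))"
  shows "j \<le> J \<Longrightarrow> \<forall>c\<in>C. p ^ j dvd weight_on I c"
proof (induction j)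
  case (Suc j)
  have K0: "\<forall>x\<in>K. \<forall>i\<in>I. x $ i = 0" and KC: "K \<subseteq> C" and K: "vec.subspace K"
    using ag by (auto simp: antigriesmer_mod_def code_mod_def)
  define M where "M = {c \<in> C. c \<in> K \<or> weight_on I c = \<delta>}"
  define g :: "'a ^ 'n \<Rightarrow> 'a" where "g y = of_nat (weight_on I y div p ^ j)" for y
  have dvd_j: "p ^ j dvd weight_on I c" if "c \<in> C" for c using Suc that by simp
  have lines: "kills (frob t) C g [(n, x)]" if x: "x \<in> M" for t x
    unfolding kills_line_iff
  proof
    fix y assume y: "y \<in> C"
    have xC: "x \<in> C" using x by (simp add: M_def)
    have in_C: "y + a *s x \<in> C" for a using xC y subC by (simp add: vec.subspace_add vec.subspace_scale)
    have "p ^ Suc j dvd (\<Sum>a\<in>UNIV. weight_on I (y + a *s x))"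
    proof (cases "x \<in> K")
      case True
      \<comment> \<open>In a direction of K the weight is constant, and the q equal terms supply the
        extra factor p.\<close>
      have "weight_on I (y + a *s x) = weight_on I y" for a
        using weight_on_add_vanishing[of I "a *s x" y] K0 True by (simp add: add.commute)
      then have "(\<Sum>a\<in>UNIV. weight_on I (y + a *s x)) = p ^ f * weight_on I y" by (simp add: card_a)
      moreover have "p dvd p ^ f" using f by (simp add: dvd_power)
      ultimately show ?thesis using mult_dvd_mono[OF _ dvd_j[OF y]] by simp
    next
      case False
      then have "p ^ J dvd (\<Sum>a\<in>UNIV. weight_on I (y + a *s x))" using line xC x y by (auto simp: M_def)
      then show ?thesis using Suc.prems by (meson dvd_trans le_imp_power_dvd)
    qed
    also have "(\<Sum>a\<in>UNIV. weight_on I (y + a *s x)) = p ^ j * (\<Sum>a\<in>UNIV. weight_on I (y + a *s x) div p ^ j)"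
      using dvd_j[OF in_C] by (simp add: sum_distrib_left)
    finally have "p dvd (\<Sum>a\<in>UNIV. weight_on I (y + a *s x) div p ^ j)"
      using p by simp
    then show "(\<Sum>s\<in>UNIV. g (y + s *s x)) = 0"
      unfolding g_def of_nat_sum[symmetric] of_nat_eq_0_iff_dvd .
  qed
  show ?case
  proof
    fix z assume z: "z \<in> C"
    have "kills (frob 0) C g [(n, z)]"
    proof (rule kills_all_lines[where M = M, OF _ _ lines _ z])
      show "0 \<in> M" using K KC vec.subspace_0 by (auto simp: M_def)
      show "vec.span {z. good3 M x y z} = C" if "good2 M x y" for x y
        by (rule extend_good[OF ag M_def that q2]) simp
    qed (auto simp: M_def)
    then have "p dvd weight_on I z div p ^ j"
      by (rule dvd_weight_if_line_sum[rotated]) (simp add: g_def)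
    then show "p ^ Suc j dvd weight_on I z"
      using dvd_j[OF z] p by (auto simp: dvd_def)
  qed
qed simp

text \<open>Modulo p the weight is the sum of the (q - 1)-st powers of the coordinates, so the
  one-factor argument applies and a single factor q in \<delta> suffices.\<close>

lemma divisible_by_p:
  assumes ag: "antigriesmer_mod C K I k \<delta>" and q1: "CARD('a) dvd \<delta>" and z: "z \<in> C"
  shows "p dvd weight_on I z"
proof -
  have K0: "\<forall>x\<in>K. \<forall>i\<in>I. x $ i = 0" and KC: "K \<subseteq> C" and K: "vec.subspace K"
    using ag by (auto simp: antigriesmer_mod_def code_mod_def)
  define M where "M = {c \<in> C. c \<in> K \<or> weight_on I c = \<delta>}"
  define g :: "'a ^ 'n \<Rightarrow> 'a" where "g y = (\<Sum>i\<in>I. (y $ i) ^ n)" for y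
  have g: "g y = of_nat (weight_on I y div 1)" for y
  proof -
    have "(y $ i) ^ n = of_nat (if y $ i \<noteq> 0 then 1 else 0)" for i
      using power_card_minus_1[of "y $ i"] n_pos by (auto simp: n_card power_0_left)
    then show ?thesis unfolding g_def weight_on_eq_sum by (simp add: of_nat_sum)
  qed
  have pq: "p dvd CARD('a)" using f by (simp add: card_a dvd_power)
  have lines: "kills (frob t) C g [(n, x)]" if x: "x \<in> M" for t x
    unfolding kills_line_iff
  proof
    fix y assume y: "y \<in> C"
    have "p dvd (\<Sum>a\<in>UNIV. weight_on I (y + a *s x))"
    proof (cases "x \<in> K")
      case True
      have "weight_on I (y + a *s x) = weight_on I y" for a
        using weight_on_add_vanishing[of I "a *s x" y] K0 True by (simp add: add.commute)
      then show ?thesis using pq by simp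
    next
      case False
      then have "weight_on I x = \<delta>" using x by (simp add: M_def)
      then show ?thesis unfolding sum_weight_on_line using pq q1 by (auto intro: dvd_trans)
    qed
    then show "(\<Sum>s\<in>UNIV. g (y + s *s x)) = 0"
      unfolding g of_nat_sum[symmetric] of_nat_eq_0_iff_dvd by simp
  qed
  have "kills (frob 0) C g [(n, z)]"
    unfolding g_def
  proof (rule kills_all_lines_sum_powers[where M = M, OF _ _ _ _ z])
    show "kills (frob t) C (\<lambda>y. \<Sum>i\<in>I. y $ i ^ n) [(n, x)]" if "x \<in> M" for t x
      using lines[OF that, of t] unfolding g_def .
    show "0 \<in> M" using K KC vec.subspace_0 by (auto simp: M_def)
    show "vec.span {z. good3 M x 0 z} = C" if "good2 M x 0" for x
      by (rule extend_good[OF ag M_def that, of 1]) (use q1 in auto)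
  qed (auto simp: M_def)
  then show ?thesis using dvd_weight_if_line_sum[OF g] by simp
qed

text \<open>Residual weights are handled by induction, and their factor q in the line sum adds f to
  the exponent. The other summand is a multiple of \<delta>, and f (E + 1) + 1 is at most f (E + 2).
  Then \<open>raise_divisibility\<close> passes from line sums to weights.\<close>

lemma antigriesmer_mod_divisible:
  "antigriesmer_mod C K I k \<delta> \<Longrightarrow> CARD('a) ^ Suc E dvd \<delta> \<Longrightarrow> \<forall>c\<in>C. p ^ (f * E + 1) dvd weight_on I c"
proof (induction E arbitrary: K I k \<delta>)
  case 0
  then show ?case using divisible_by_p by simp
next
  case (Suc E)
  have le: "\<And>c. c \<in> C \<Longrightarrow> weight_on I c \<le> \<delta>"
    using Suc.prems(1) by (auto simp: antigriesmer_mod_def code_mod_def)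
  have q1: "CARD('a) dvd \<delta>" using Suc.prems(2) by (metis dvd_trans dvd_triv_left power_Suc)
  have q2: "CARD('a) ^ 2 dvd \<delta>" using Suc.prems(2) by (rule power_le_dvd) simp
  have line: "p ^ (f * Suc E + 1) dvd (\<Sum>a\<in>UNIV. weight_on I (y + a *s x))"
    if x: "x \<in> C" "weight_on I x = \<delta>" and y: "y \<in> C" for x y
  proof (cases "\<delta> = 0")
    case True
    then have "weight_on I (y + a *s x) = 0" for a
      using le[of "y + a *s x"] x y subC by (simp add: vec.subspace_add vec.subspace_scale)
    then show ?thesis by simp
  next
    case False
    obtain k' where k: "k = Suc k'"
    proof (cases k)
      case 0
      then have "I = {}" using Suc.prems(1) code_mod_0(2) by (auto simp: antigriesmer_mod_def)
      then show ?thesis using x False by (simp add: weight_on_def)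
    qed
    have "CARD('a) ^ Suc E dvd \<delta> div CARD('a)" using Suc.prems(2) q1 by (auto simp: dvd_def)
    then have "p ^ (f * E + 1) dvd weight_on {i \<in> I. x $ i = 0} y"
      using Suc.IH antigriesmer_mod_residual[OF Suc.prems(1)[unfolded k] x] False y by blast
    then have "p ^ f * p ^ (f * E + 1) dvd CARD('a) * weight_on {i \<in> I. x $ i = 0} y"
      by (simp only: card_a mult_dvd_mono dvd_refl)
    then have "p ^ (f * Suc E + 1) dvd CARD('a) * weight_on {i \<in> I. x $ i = 0} y"
      by (simp add: power_add mult_ac)
    moreover have "p ^ (f * Suc E + 1) dvd \<delta>"
    proof -
      have "f * Suc E + 1 \<le> f * Suc (Suc E)" using f by simp
      then have "p ^ (f * Suc E + 1) dvd CARD('a) ^ Suc (Suc E)"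
        unfolding card_a power_mult[symmetric] by (rule le_imp_power_dvd)
      then show ?thesis using Suc.prems(2) dvd_trans by blast
    qed
    ultimately show ?thesis unfolding sum_weight_on_line x by (blast intro: dvd_add dvd_mult)
  qed
  show ?case using raise_divisibility[OF Suc.prems(1) q2 line order_refl] by blast
qed

end

section \<open>Transfer to antiGriesmer codes and comparison of exponents\<close>

lemma anti_griesmer_code_imp_mod:
  assumes "anti_griesmer_code k \<delta> C"
  shows "antigriesmer_mod C {0} UNIV k \<delta>"
proof -
  have C: "k \<ge> 1" "vec.subspace C" "vec.dim C = k" "full_length C"
    "Max (hamming_weight ` C) = \<delta>" "CARD('b) = anti_griesmer_length CARD('a) k \<delta>"
    using assms by (auto simp: anti_griesmer_code_def)
  have "weight_on UNIV c \<le> \<delta>" if "c \<in> C" for c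
    using that C(5) by (auto simp: weight_on_UNIV)
  moreover have "anti_griesmer_length CARD('a) k \<delta> = agl CARD('a) k \<delta>"
  proof -
    obtain k' where k: "k = Suc k'" using C(1) by (cases k) auto
    have "{..<Suc k'} = insert 0 {1..k'}" by auto
    then show ?thesis by (simp add: k agl_def anti_griesmer_length_def)
  qed
  moreover have "vec.dim {0 :: 'a ^ 'b} = 0" by (simp add: vec.dim_eq_0)
  ultimately show ?thesis
    using C vec.subspace_0[OF C(2)]
    by (auto simp: antigriesmer_mod_def code_mod_def full_length_def vec.subspace_single_0)
qed

theorem corollary4p6:
  fixes p f q e k \<delta> :: nat
    and C :: "('a::{field,finite} ^ 'n::finite) set"
  assumes "prime p" and "f \<ge> 1" and "q = p ^ f"
    and "CARD('a) = q"
    and "anti_griesmer_code k \<delta> C"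
  shows "(q ^ e dvd \<delta> \<longrightarrow> divisible_code (p ^ e) C) \<and>
         (p ^ e dvd \<delta> \<longrightarrow>
            divisible_code
              (nat \<lceil>real p powi (int e - (int f - 1) * (int q - 2))\<rceil>) C)"
proof -
  have p2: "p \<ge> 2" using assms(1) by (rule prime_ge_2_nat)
  interpret weighted_kills p f C
    using assms p2 by unfold_locales (auto simp: anti_griesmer_code_def)
  have div: "divisible_code (p ^ d) C" if "q ^ Suc E dvd \<delta>" "d \<le> f * E + 1" for E d
  proof -
    have "\<forall>c\<in>C. p ^ (f * E + 1) dvd weight_on UNIV c"
      by (rule antigriesmer_mod_divisible[OF anti_griesmer_code_imp_mod[OF assms(5)]])
        (use that assms in simp)
    moreover have "p ^ d dvd p ^ (f * E + 1)" using that(2) by (rule le_imp_power_dvd)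
    ultimately show ?thesis
      using p2 unfolding divisible_code_def weight_on_UNIV by (auto intro: dvd_trans)
  qed
  have div1: "divisible_code 1 C" by (simp add: divisible_code_def)
  show ?thesis
  proof (intro conjI impI)
    assume *: "q ^ e dvd \<delta>"
    show "divisible_code (p ^ e) C"
    proof (cases e)
      case 0
      then show ?thesis using div1 by simp
    next
      case (Suc E)
      have "1 * E \<le> f * E" using assms(2) by (rule mult_le_mono1)
      then show ?thesis using div[of E e] * Suc by simp
    qed
  next
    assume *: "p ^ e dvd \<delta>"
    define P where "P = (int f - 1) * (int q - 2)"
    define N where "N = int e - P"
    show "divisible_code (nat \<lceil>real p powi (int e - (int f - 1) * (int q - 2))\<rceil>) C"
    proof (cases "N \<le> 0")
      case True
      \<comment> \<open>A nonpositive exponent gives a value in the interval (0, 1], whose ceiling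
        is 1.\<close>
      have "real p powi N \<le> real p powi 0" using True p2 by (intro power_int_increasing) auto
      moreover have "real p powi N > 0" using p2 by simp
      ultimately have "\<lceil>real p powi N\<rceil> = 1" by (intro ceiling_unique) auto
      then show ?thesis using div1 by (simp add: N_def P_def)
    next
      case False
      \<comment> \<open>For f at least 2 one has q at least 4, so q - 2 is at least 2; for f = 1
        both sides are 0.\<close>
      have loss: "2 * (int f - 1) \<le> P"
      proof (cases "f = 1")
        case False
        then have "p ^ f \<ge> 2 ^ 2"
          using p2 assms(2) by (intro order_trans[OF power_increasing[of 2 f 2] power_mono[of 2 p f]]) auto
        then have "4 \<le> q" using assms(3) by simp
        then have "(int f - 1) * 2 \<le> (int f - 1) * (int q - 2)"
          using assms(2) by (intro mult_left_mono) auto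
        then show ?thesis by (simp only: P_def mult.commute[of 2])
      qed (simp add: P_def)
      have mod_lt: "e mod f < f" using assms(2) by (intro mod_less_divisor) simp
      \<comment> \<open>Otherwise e is at most f - 1, hence at most P, against N > 0.\<close>
      have "e div f \<noteq> 0"
      proof
        assume "e div f = 0"
        then have "int e \<le> int f - 1" using assms(2) by (simp add: div_eq_0_iff)
        moreover have "P < int e" using False unfolding N_def by simp
        moreover have "1 \<le> int f" using assms(2) by simp
        ultimately show False using loss by (simp add: algebra_simps)
      qed
      then obtain E where E: "e div f = Suc E" by (cases "e div f") auto
      have "q ^ Suc E = p ^ (f * Suc E)" by (simp only: assms(3) power_mult)
      moreover have e_eq: "f * E + f + e mod f = e" using mult_div_mod_eq[of f e] E by simp
      then have "f * Suc E \<le> e" by simp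
      ultimately have "q ^ Suc E dvd \<delta>" using * by (metis dvd_trans le_imp_power_dvd)
      \<comment> \<open>The remainder of e modulo f is at most f - 1, so e is at most f E + 2 f - 1;
        subtracting at least 2 (f - 1) leaves at most f E + 1.\<close>
      moreover have "nat N \<le> f * E + 1"
      proof -
        have "int e \<le> int (f * E) + int f + int f - 1"
          using e_eq mod_lt by linarith
        then have "int e - P \<le> int (f * E) + 1" using loss by (simp add: algebra_simps)
        then show ?thesis unfolding N_def by (simp add: nat_le_iff)
      qed
      ultimately have "divisible_code (p ^ nat N) C" by (rule div)
      moreover have "real p powi N = of_int (int (p ^ nat N))"
        using False by (simp add: power_int_def)
      then have "nat \<lceil>real p powi N\<rceil> = p ^ nat N" by (simp only: ceiling_of_int nat_int)
      ultimately show ?thesis by (simp add: N_def P_def)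
    qed
  qed
qed

end
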